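(* Let $(M,\nabla,\langle\cdot,\cdot\rangle)$ be an affine-Riemann manifold satisfying $\gamma=\gamma^*$ and $\mathrm{tr}_{\langle,\rangle}(\gamma)=0$. Then the Ricci curvature of $\langle\cdot,\cdot\rangle$ is nonnegative, and $\langle\cdot,\cdot\rangle$ is Ricci-flat if and only if $\gamma=0$. Moreover, if $M$ is compact then $\gamma=0$ and hence $\nabla$ is the Levi-Civita connection of $\langle\cdot,\cdot\rangle$.
   Context: An affine-Riemann manifold $(M,\nabla,\langle\cdot,\cdot\rangle)$ is a manifold with a flat torsionless connection $\nabla$ and a Riemannian metric. $D$ is the Levi-Civita connection of the metric; the difference tensor is $\gamma_XY=D_XY-\nabla_XY$, and $\gamma^*$ is defined by $\langle\gamma^*_XY,Z\rangle=\langle Y,\gamma_XZ\rangle$. For a local orthonormal frame $(E_i)$, $\mathrm{tr}_{\langle,\rangle}(\gamma)=\sum_i\gamma_{E_i}E_i$. *)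

theory Defs
  imports "HOL-Analysis.Analysis"
begin

section \<open>Smooth manifolds\<close>

text \<open>Only meant for open \<open>S\<close>: the derivatives are taken \<open>at x\<close>, not \<open>at x within S\<close>.\<close>

primrec Ck_on :: "nat \<Rightarrow> 'a::real_normed_vector set \<Rightarrow> ('a \<Rightarrow> 'b::real_normed_vector) \<Rightarrow> bool" where
  "Ck_on 0 S f \<longleftrightarrow> continuous_on S f"
| "Ck_on (Suc k) S f \<longleftrightarrow>
     (\<forall>x\<in>S. f differentiable at x) \<and>
     (\<forall>v. Ck_on k S (\<lambda>x. frechet_derivative f (at x) v))"

definition smooth_on :: "'a::real_normed_vector set \<Rightarrow> ('a \<Rightarrow> 'b::real_normed_vector) \<Rightarrow> bool" where
  "smooth_on S f \<longleftrightarrow> (\<forall>k. Ck_on k S f)"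

type_synonym ('m, 'n) chart = "'m set \<times> ('m \<Rightarrow> real ^ 'n)"

definition is_chart :: "'m topology \<Rightarrow> ('m, 'n::finite) chart \<Rightarrow> bool" where
  "is_chart M c \<longleftrightarrow> (case c of (U, \<phi>) \<Rightarrow>
     openin M U \<and> open (\<phi> ` U) \<and>
     homeomorphic_map (subtopology M U) (top_of_set (\<phi> ` U)) \<phi>)"

text \<open>\<open>chart_rep c f\<close> is \<open>f \<circ> \<phi>\<^sup>-\<^sup>1\<close>; it is meaningful on \<open>\<phi> ` U\<close> only.\<close>

definition chart_rep :: "('m, 'n) chart \<Rightarrow> ('m \<Rightarrow> 'b) \<Rightarrow> real ^ 'n \<Rightarrow> 'b" where
  "chart_rep c f = f \<circ> inv_into (fst c) (snd c)"

definition smooth_manifold :: "'m topology \<Rightarrow> ('m, 'n::finite) chart set \<Rightarrow> bool" where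
  "smooth_manifold M A \<longleftrightarrow>
     Hausdorff_space M \<and> second_countable M \<and>
     (\<forall>c\<in>A. is_chart M c) \<and>
     (\<Union>c\<in>A. fst c) = topspace M \<and>
     (\<forall>c\<in>A. \<forall>d\<in>A. smooth_on (snd c ` (fst c \<inter> fst d)) (chart_rep c (snd d)))"

definition smooth_fun :: "('m, 'n::finite) chart set \<Rightarrow> 'm set \<Rightarrow> ('m \<Rightarrow> real) \<Rightarrow> bool" where
  "smooth_fun A W f \<longleftrightarrow> (\<forall>c\<in>A. smooth_on (snd c ` (fst c \<inter> W)) (chart_rep c f))"

definition smooth_near ::
    "'m topology \<Rightarrow> ('m, 'n::finite) chart set \<Rightarrow> 'm \<Rightarrow> ('m \<Rightarrow> real) \<Rightarrow> bool" where
  "smooth_near M A p f \<longleftrightarrow> (\<exists>W. openin M W \<and> p \<in> W \<and> smooth_fun A W f)"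

section \<open>Tangent vectors and vector fields\<close>

text \<open>
  A tangent vector at \<open>p\<close> is the directional derivative functional on functions that are smooth
  near \<open>p\<close>.  The value \<open>0\<close> on all other functions is a normalisation, so that equality of
  functionals is equality of tangent vectors.
\<close>

type_synonym 'm tvec = "('m \<Rightarrow> real) \<Rightarrow> real"

type_synonym 'm vfield = "'m \<Rightarrow> 'm tvec"

definition chart_vec ::
    "'m topology \<Rightarrow> ('m, 'n::finite) chart set \<Rightarrow> ('m, 'n) chart \<Rightarrow> 'm \<Rightarrow> real ^ 'n \<Rightarrow> 'm tvec" where
  "chart_vec M A c p w =
     (\<lambda>f. if smooth_near M A p f
          then frechet_derivative (chart_rep c f) (at (snd c p)) w else 0)"

definition tangent_space ::
    "'m topology \<Rightarrow> ('m, 'n::finite) chart set \<Rightarrow> 'm \<Rightarrow> 'm tvec set" where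
  "tangent_space M A p = {chart_vec M A c p w | c w. c \<in> A \<and> p \<in> fst c}"

text \<open>
  Vector fields are total functions; \<open>smooth_vf M A W\<close> constrains their values on \<open>W\<close> only.
\<close>

definition smooth_vf ::
    "'m topology \<Rightarrow> ('m, 'n::finite) chart set \<Rightarrow> 'm set \<Rightarrow> 'm vfield set" where
  "smooth_vf M A W = {X.
     (\<forall>p\<in>W. X p \<in> tangent_space M A p) \<and>
     (\<forall>V f. openin M V \<and> V \<subseteq> W \<and> smooth_fun A V f \<longrightarrow> smooth_fun A V (\<lambda>p. X p f))}"

definition vf_add :: "'m vfield \<Rightarrow> 'm vfield \<Rightarrow> 'm vfield" where
  "vf_add X Y = (\<lambda>p f. X p f + Y p f)"

definition vf_diff :: "'m vfield \<Rightarrow> 'm vfield \<Rightarrow> 'm vfield" where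
  "vf_diff X Y = (\<lambda>p f. X p f - Y p f)"

definition vf_scale :: "('m \<Rightarrow> real) \<Rightarrow> 'm vfield \<Rightarrow> 'm vfield" where
  "vf_scale h X = (\<lambda>p f. h p * X p f)"

definition vf_zero :: "'m vfield" where
  "vf_zero = (\<lambda>p f. 0)"

definition vf_sum :: "('i::finite \<Rightarrow> 'm vfield) \<Rightarrow> 'm vfield" where
  "vf_sum X = (\<lambda>p f. \<Sum>i\<in>UNIV. X i p f)"

definition vf_apply :: "'m vfield \<Rightarrow> ('m \<Rightarrow> real) \<Rightarrow> 'm \<Rightarrow> real" where
  "vf_apply X f = (\<lambda>p. X p f)"

definition vf_eq_on :: "'m set \<Rightarrow> 'm vfield \<Rightarrow> 'm vfield \<Rightarrow> bool" where
  "vf_eq_on W X Y \<longleftrightarrow> (\<forall>p\<in>W. X p = Y p)"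

definition lie_bracket ::
    "'m topology \<Rightarrow> ('m, 'n::finite) chart set \<Rightarrow> 'm vfield \<Rightarrow> 'm vfield \<Rightarrow> 'm vfield" where
  "lie_bracket M A X Y =
     (\<lambda>p f. if smooth_near M A p f
            then X p (vf_apply Y f) - Y p (vf_apply X f) else 0)"

section \<open>Connections\<close>

text \<open>
  A connection acts on smooth vector fields over arbitrary open sets, compatibly with
  restriction: the value of \<open>nab X Y\<close> on an open set \<open>W\<close> on which \<open>X\<close> and \<open>Y\<close> are smooth only
  depends on \<open>X\<close> and \<open>Y\<close> on \<open>W\<close> (this is the clause that compares \<open>X, Y\<close> with \<open>X', Y'\<close>).
\<close>

type_synonym 'm connection = "'m vfield \<Rightarrow> 'm vfield \<Rightarrow> 'm vfield"

definition is_connection ::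
    "'m topology \<Rightarrow> ('m, 'n::finite) chart set \<Rightarrow> 'm connection \<Rightarrow> bool" where
  "is_connection M A nab \<longleftrightarrow> (\<forall>W. openin M W \<longrightarrow>
     (\<forall>X\<in>smooth_vf M A W. \<forall>Y\<in>smooth_vf M A W. nab X Y \<in> smooth_vf M A W) \<and>
     (\<forall>X\<in>smooth_vf M A W. \<forall>X'\<in>smooth_vf M A W. \<forall>Y\<in>smooth_vf M A W. \<forall>Y'\<in>smooth_vf M A W.
        vf_eq_on W X X' \<and> vf_eq_on W Y Y' \<longrightarrow> vf_eq_on W (nab X Y) (nab X' Y')) \<and>
     (\<forall>X\<in>smooth_vf M A W. \<forall>X'\<in>smooth_vf M A W. \<forall>Y\<in>smooth_vf M A W.
        vf_eq_on W (nab (vf_add X X') Y) (vf_add (nab X Y) (nab X' Y))) \<and>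
     (\<forall>X\<in>smooth_vf M A W. \<forall>Y\<in>smooth_vf M A W. \<forall>h. smooth_fun A W h \<longrightarrow>
        vf_eq_on W (nab (vf_scale h X) Y) (vf_scale h (nab X Y))) \<and>
     (\<forall>X\<in>smooth_vf M A W. \<forall>Y\<in>smooth_vf M A W. \<forall>Y'\<in>smooth_vf M A W.
        vf_eq_on W (nab X (vf_add Y Y')) (vf_add (nab X Y) (nab X Y'))) \<and>
     (\<forall>X\<in>smooth_vf M A W. \<forall>Y\<in>smooth_vf M A W. \<forall>h. smooth_fun A W h \<longrightarrow>
        vf_eq_on W (nab X (vf_scale h Y))
          (vf_add (vf_scale (vf_apply X h) Y) (vf_scale h (nab X Y)))))"

definition torsion ::
    "'m topology \<Rightarrow> ('m, 'n::finite) chart set \<Rightarrow> 'm connection \<Rightarrow> 'm vfield \<Rightarrow> 'm vfield \<Rightarrow> 'm vfield" where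
  "torsion M A nab X Y = vf_diff (vf_diff (nab X Y) (nab Y X)) (lie_bracket M A X Y)"

definition curvature ::
    "'m topology \<Rightarrow> ('m, 'n::finite) chart set \<Rightarrow> 'm connection \<Rightarrow>
     'm vfield \<Rightarrow> 'm vfield \<Rightarrow> 'm vfield \<Rightarrow> 'm vfield" where
  "curvature M A nab X Y Z =
     vf_diff (vf_diff (nab X (nab Y Z)) (nab Y (nab X Z))) (nab (lie_bracket M A X Y) Z)"

definition torsionless ::
    "'m topology \<Rightarrow> ('m, 'n::finite) chart set \<Rightarrow> 'm connection \<Rightarrow> bool" where
  "torsionless M A nab \<longleftrightarrow> (\<forall>W. openin M W \<longrightarrow>
     (\<forall>X\<in>smooth_vf M A W. \<forall>Y\<in>smooth_vf M A W. vf_eq_on W (torsion M A nab X Y) vf_zero))"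

definition flat ::
    "'m topology \<Rightarrow> ('m, 'n::finite) chart set \<Rightarrow> 'm connection \<Rightarrow> bool" where
  "flat M A nab \<longleftrightarrow> (\<forall>W. openin M W \<longrightarrow>
     (\<forall>X\<in>smooth_vf M A W. \<forall>Y\<in>smooth_vf M A W. \<forall>Z\<in>smooth_vf M A W.
        vf_eq_on W (curvature M A nab X Y Z) vf_zero))"

section \<open>Riemannian metrics\<close>

type_synonym 'm metric_tensor = "'m \<Rightarrow> 'm tvec \<Rightarrow> 'm tvec \<Rightarrow> real"

definition metric_pair :: "'m metric_tensor \<Rightarrow> 'm vfield \<Rightarrow> 'm vfield \<Rightarrow> 'm \<Rightarrow> real" where
  "metric_pair g X Y = (\<lambda>p. g p (X p) (Y p))"

definition riemannian_metric ::
    "'m topology \<Rightarrow> ('m, 'n::finite) chart set \<Rightarrow> 'm metric_tensor \<Rightarrow> bool" where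
  "riemannian_metric M A g \<longleftrightarrow>
     (\<forall>p\<in>topspace M.
        (\<forall>u\<in>tangent_space M A p. \<forall>v\<in>tangent_space M A p. g p u v = g p v u) \<and>
        (\<forall>u\<in>tangent_space M A p. \<forall>v\<in>tangent_space M A p. \<forall>w\<in>tangent_space M A p. \<forall>a b.
           g p (\<lambda>f. a * u f + b * v f) w = a * g p u w + b * g p v w) \<and>
        (\<forall>u\<in>tangent_space M A p. u \<noteq> (\<lambda>f. 0) \<longrightarrow> g p u u > 0)) \<and>
     (\<forall>W. openin M W \<longrightarrow>
        (\<forall>X\<in>smooth_vf M A W. \<forall>Y\<in>smooth_vf M A W. smooth_fun A W (metric_pair g X Y)))"

definition metric_connection ::
    "'m topology \<Rightarrow> ('m, 'n::finite) chart set \<Rightarrow> 'm metric_tensor \<Rightarrow> 'm connection \<Rightarrow> bool" where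
  "metric_connection M A g nab \<longleftrightarrow> (\<forall>W. openin M W \<longrightarrow>
     (\<forall>X\<in>smooth_vf M A W. \<forall>Y\<in>smooth_vf M A W. \<forall>Z\<in>smooth_vf M A W. \<forall>p\<in>W.
        vf_apply X (metric_pair g Y Z) p =
          metric_pair g (nab X Y) Z p + metric_pair g Y (nab X Z) p))"

definition levi_civita ::
    "'m topology \<Rightarrow> ('m, 'n::finite) chart set \<Rightarrow> 'm metric_tensor \<Rightarrow> 'm connection \<Rightarrow> bool" where
  "levi_civita M A g D \<longleftrightarrow>
     is_connection M A D \<and> torsionless M A D \<and> metric_connection M A g D"

definition orthonormal_frame ::
    "'m topology \<Rightarrow> ('m, 'n::finite) chart set \<Rightarrow> 'm metric_tensor \<Rightarrow> 'm set \<Rightarrow>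
     ('n \<Rightarrow> 'm vfield) \<Rightarrow> bool" where
  "orthonormal_frame M A g W E \<longleftrightarrow>
     (\<forall>i. E i \<in> smooth_vf M A W) \<and>
     (\<forall>p\<in>W. \<forall>i j. metric_pair g (E i) (E j) p = (if i = j then 1 else 0))"

text \<open>
  The Ricci tensor of a connection \<open>D\<close>, computed with an orthonormal frame \<open>E\<close>, as the trace of
  \<open>Z \<mapsto> R(Z, X) Y\<close>; with this sign the Ricci curvature of a round sphere is positive.
\<close>

definition ricci_in_frame ::
    "'m topology \<Rightarrow> ('m, 'n::finite) chart set \<Rightarrow> 'm metric_tensor \<Rightarrow> 'm connection \<Rightarrow>
     ('n \<Rightarrow> 'm vfield) \<Rightarrow> 'm vfield \<Rightarrow> 'm vfield \<Rightarrow> 'm \<Rightarrow> real" where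
  "ricci_in_frame M A g D E X Y p =
     (\<Sum>i\<in>UNIV. metric_pair g (curvature M A D (E i) X Y) (E i) p)"

definition ricci_nonneg ::
    "'m topology \<Rightarrow> ('m, 'n::finite) chart set \<Rightarrow> 'm metric_tensor \<Rightarrow> 'm connection \<Rightarrow> bool" where
  "ricci_nonneg M A g D \<longleftrightarrow> (\<forall>W E. openin M W \<and> orthonormal_frame M A g W E \<longrightarrow>
     (\<forall>X\<in>smooth_vf M A W. \<forall>p\<in>W. ricci_in_frame M A g D E X X p \<ge> 0))"

definition ricci_flat ::
    "'m topology \<Rightarrow> ('m, 'n::finite) chart set \<Rightarrow> 'm metric_tensor \<Rightarrow> 'm connection \<Rightarrow> bool" where
  "ricci_flat M A g D \<longleftrightarrow> (\<forall>W E. openin M W \<and> orthonormal_frame M A g W E \<longrightarrow>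
     (\<forall>X\<in>smooth_vf M A W. \<forall>Y\<in>smooth_vf M A W. \<forall>p\<in>W. ricci_in_frame M A g D E X Y p = 0))"

section \<open>Affine-Riemann manifolds\<close>

definition affine_riemann ::
    "'m topology \<Rightarrow> ('m, 'n::finite) chart set \<Rightarrow> 'm connection \<Rightarrow> 'm metric_tensor \<Rightarrow> bool" where
  "affine_riemann M A nab g \<longleftrightarrow>
     smooth_manifold M A \<and>
     is_connection M A nab \<and> flat M A nab \<and> torsionless M A nab \<and>
     riemannian_metric M A g"

type_synonym 'm tensor12 = "'m vfield \<Rightarrow> 'm vfield \<Rightarrow> 'm vfield"

definition difference_tensor :: "'m connection \<Rightarrow> 'm connection \<Rightarrow> 'm tensor12" where
  "difference_tensor D nab X Y = vf_diff (D X Y) (nab X Y)"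

definition is_metric_adjoint ::
    "'m topology \<Rightarrow> ('m, 'n::finite) chart set \<Rightarrow> 'm metric_tensor \<Rightarrow> 'm tensor12 \<Rightarrow> 'm tensor12 \<Rightarrow> bool" where
  "is_metric_adjoint M A g \<gamma> \<gamma>s \<longleftrightarrow> (\<forall>W. openin M W \<longrightarrow>
     (\<forall>X\<in>smooth_vf M A W. \<forall>Y\<in>smooth_vf M A W. \<gamma>s X Y \<in> smooth_vf M A W) \<and>
     (\<forall>X\<in>smooth_vf M A W. \<forall>Y\<in>smooth_vf M A W. \<forall>Z\<in>smooth_vf M A W. \<forall>p\<in>W.
        metric_pair g (\<gamma>s X Y) Z p = metric_pair g Y (\<gamma> X Z) p))"

definition tensor_eq ::
    "'m topology \<Rightarrow> ('m, 'n::finite) chart set \<Rightarrow> 'm tensor12 \<Rightarrow> 'm tensor12 \<Rightarrow> bool" where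
  "tensor_eq M A S T \<longleftrightarrow> (\<forall>W. openin M W \<longrightarrow>
     (\<forall>X\<in>smooth_vf M A W. \<forall>Y\<in>smooth_vf M A W. vf_eq_on W (S X Y) (T X Y)))"

definition tensor_zero :: "'m tensor12" where
  "tensor_zero = (\<lambda>X Y. vf_zero)"

definition metric_trace_zero ::
    "'m topology \<Rightarrow> ('m, 'n::finite) chart set \<Rightarrow> 'm metric_tensor \<Rightarrow> 'm tensor12 \<Rightarrow> bool" where
  "metric_trace_zero M A g \<gamma> \<longleftrightarrow> (\<forall>W E. openin M W \<and> orthonormal_frame M A g W E \<longrightarrow>
     vf_eq_on W (vf_sum (\<lambda>i. \<gamma> (E i) (E i))) vf_zero)"

end

theory Submission
  imports Defs
begin

text \<open>
  The tensor \<open>C(X,Y,Z) = \<langle>\<gamma>\<^sub>X Y, Z\<rangle>\<close> is totally symmetric: both connections are torsionless and \<open>\<gamma>\<close> is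
  self-adjoint. Since \<open>\<nabla> = D - \<gamma>\<close> is flat, the sum of the curvature \<open>R\<close> of \<open>D\<close> and the commutator
  \<open>[\<gamma>\<^sub>X, \<gamma>\<^sub>Y]\<close>, a skew endomorphism, equals the difference of \<open>D\<^sub>X \<gamma>\<^sub>Y\<close> and \<open>D\<^sub>Y \<gamma>\<^sub>X\<close>, a symmetric
  one. Hence \<open>R(X,Y) = -[\<gamma>\<^sub>X, \<gamma>\<^sub>Y]\<close>, and \<open>D C\<close> is totally symmetric. As \<open>\<gamma>\<close> has trace \<open>0\<close>, the Ricci
  curvature is \<open>Ric(X,X) = \<Sum>|\<gamma>\<^sub>X E\<^sub>i|\<^sup>2\<close>.

  For compact \<open>M\<close>, a Bochner argument applies to \<open>|C|\<^sup>2\<close>. By the symmetry of \<open>D C\<close> and the trace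
  condition, commuting derivatives turns the Laplacian of \<open>C\<close> into curvature terms, which gives
  \<open>\<Delta>|C|\<^sup>2 / 2 \<ge> |Ric|\<^sup>2\<close>. At a maximum of \<open>|C|\<^sup>2\<close> the Ricci tensor therefore vanishes, and so does its
  trace \<open>|C|\<^sup>2\<close>.
\<close>

section \<open>Calculus of \<open>C\<^sup>k\<close> functions\<close>

text \<open>A maximum principle stands in for integration over \<open>M\<close>. At a maximum all
  first derivatives vanish, so the correction along \<open>D (E l) (E l)\<close> that separates a
  second derivative from the Hessian drops out, and plain second derivatives along frame fields can
  be summed. The Laplacian estimate needs a sign for the curvature terms without any assumption on
  curvature. The Gauss equation supplies it: \<open>R\<close> is itself quadratic in
  \<open>C\<close>, up to sign a commutator of the symmetric matrices formed by the components of
  \<open>C\<close>, and the full contractions of the three curvature terms are minus sums of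
  squares. The trace condition enters twice: it removes half of the contracted curvature, and it
  kills the trace left over once the derivatives have been commuted. Orthonormal frames exist only
  locally and are in general not parallel. Contractions therefore produce derivatives of the frame;
  they cancel because \<open>gm (D V (E l)) (E m)\<close> is skew in \<open>l, m\<close> while the
  contracted tensors are symmetric. Likewise the squared norm of \<open>C\<close> is first a local
  expression, and its independence of the frame must be proved before a maximum over
  \<open>M\<close> makes sense.\<close>

lemma Ck_on_cong:
  assumes "open S" "\<And>x. x \<in> S \<Longrightarrow> f x = h x" "Ck_on k S f"
  shows "Ck_on k S h"
  using assms(2,3)
proof (induction k arbitrary: f h)
  case 0
  then show ?case by (simp cong: continuous_on_cong)
next
  case (Suc k)
  have D: "(h has_derivative frechet_derivative f (at x)) (at x)" if "x \<in> S" for x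
  proof (rule has_derivative_transform_within_open[OF _ assms(1) that])
    show "(f has_derivative frechet_derivative f (at x)) (at x)"
      using Suc.prems(2) that by (auto simp: frechet_derivative_works)
  qed (use Suc.prems in auto)
  have "Ck_on k S (\<lambda>x. frechet_derivative h (at x) v)" for v
    by (rule Suc.IH[where f="\<lambda>x. frechet_derivative f (at x) v"])
      (use frechet_derivative_at[OF D] Suc.prems in auto)
  then show ?case
    using D by (auto simp: differentiable_def)
qed

lemma Ck_on_subset: "Ck_on k T f \<Longrightarrow> S \<subseteq> T \<Longrightarrow> Ck_on k S f"
  by (induction k arbitrary: f) (auto intro: continuous_on_subset)

lemma Ck_on_Suc_imp: "Ck_on (Suc k) S f \<Longrightarrow> Ck_on k S f"
proof (induction k arbitrary: f)
  case 0
  then show ?case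
    by (auto intro!: continuous_at_imp_continuous_on differentiable_imp_continuous_within)
next
  case (Suc k)
  then show ?case by (metis Ck_on.simps(2))
qed

lemma Ck_on_SucI:
  assumes "open S" "\<And>x. x \<in> S \<Longrightarrow> (f has_derivative f' x) (at x)" "\<And>v. Ck_on k S (\<lambda>x. f' x v)"
  shows "Ck_on (Suc k) S f"
proof -
  have "Ck_on k S (\<lambda>x. frechet_derivative f (at x) v)" for v
    by (rule Ck_on_cong[OF assms(1) _ assms(3)[of v]]) (metis assms(2) frechet_derivative_at)
  then show ?thesis
    using assms(2) by (auto simp: differentiable_def)
qed

lemma Ck_on_SucD:
  assumes "Ck_on (Suc k) S f"
  shows "x \<in> S \<Longrightarrow> (f has_derivative frechet_derivative f (at x)) (at x)"
    and "Ck_on k S (\<lambda>x. frechet_derivative f (at x) v)"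
  using assms by (auto simp: frechet_derivative_works)

lemma Ck_on_const: "Ck_on k S (\<lambda>x. a)"
  by (induction k arbitrary: a) (auto simp: frechet_derivative_const)

lemma Ck_on_bounded_linear_comp:
  assumes "bounded_linear L" "open S" "Ck_on k S f"
  shows "Ck_on k S (\<lambda>x. L (f x))"
  using assms(3)
proof (induction k arbitrary: f)
  case 0
  then show ?case using assms(1) by (auto intro: bounded_linear.continuous_on)
next
  case (Suc k)
  show ?case
    by (rule Ck_on_SucI[OF assms(2)
          bounded_linear.has_derivative[OF assms(1) Ck_on_SucD(1)[OF Suc.prems]]
          Suc.IH[OF Ck_on_SucD(2)[OF Suc.prems]]])
qed

lemma Ck_on_add:
  assumes "open S" "Ck_on k S f" "Ck_on k S h"
  shows "Ck_on k S (\<lambda>x. f x + h x)"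
  using assms(2,3)
proof (induction k arbitrary: f h)
  case (Suc k)
  show ?case
    by (rule Ck_on_SucI[OF assms(1)
          has_derivative_add[OF Ck_on_SucD(1)[OF Suc.prems(1)] Ck_on_SucD(1)[OF Suc.prems(2)]]
          Suc.IH[OF Ck_on_SucD(2)[OF Suc.prems(1)] Ck_on_SucD(2)[OF Suc.prems(2)]]])
qed (auto intro: continuous_intros)

lemma Ck_on_mult:
  fixes f h :: "'a::real_normed_vector \<Rightarrow> real"
  assumes "open S" "Ck_on k S f" "Ck_on k S h"
  shows "Ck_on k S (\<lambda>x. f x * h x)"
  using assms(2,3)
proof (induction k arbitrary: f h)
  case (Suc k)
  have "Ck_on k S (\<lambda>x. f x * frechet_derivative h (at x) v + frechet_derivative f (at x) v * h x)" for v
    by (intro Ck_on_add assms(1) Suc.IH Ck_on_Suc_imp[OF Suc.prems(1)] Ck_on_Suc_imp[OF Suc.prems(2)]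
        Ck_on_SucD(2)[OF Suc.prems(1)] Ck_on_SucD(2)[OF Suc.prems(2)])
  then show ?case
    by (intro Ck_on_SucI[OF assms(1)
          has_derivative_mult[OF Ck_on_SucD(1)[OF Suc.prems(1)] Ck_on_SucD(1)[OF Suc.prems(2)]]])
qed (auto intro: continuous_intros)

lemma Ck_on_sum:
  assumes "open S" "\<And>i. i \<in> I \<Longrightarrow> Ck_on k S (f i)"
  shows "Ck_on k S (\<lambda>x. \<Sum>i\<in>I. f i x)"
  using assms(2)
  by (induction I rule: infinite_finite_induct) (auto intro: Ck_on_add[OF assms(1)] Ck_on_const)

text \<open>The exponent varies in the induction because differentiation lowers it by one. Real
  powers include the exponent -1/2, which normalises a field of positive length in the Gram-Schmidt
  process.\<close>

lemma Ck_on_powr: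
  fixes f :: "'a::real_normed_vector \<Rightarrow> real"
  assumes "open S" "Ck_on k S f" "\<And>x. x \<in> S \<Longrightarrow> f x > 0"
  shows "Ck_on k S (\<lambda>x. f x powr a)"
  using assms(2)
proof (induction k arbitrary: a)
  case 0
  show ?case using assms(3) 0 by (force intro!: continuous_on_powr)
next
  case (Suc k)
  have D: "((\<lambda>x. f x powr a) has_derivative (\<lambda>v. a * f x powr (a - 1) * frechet_derivative f (at x) v)) (at x)"
    if "x \<in> S" for x
    using assms(3)[OF that]
    by (auto intro!: derivative_eq_intros Ck_on_SucD(1)[OF Suc.prems] that simp: powr_diff field_simps)
  have "Ck_on k S (\<lambda>x. a * f x powr (a - 1) * frechet_derivative f (at x) v)" for v
    by (intro Ck_on_mult assms(1) Ck_on_const Suc.IH Ck_on_Suc_imp[OF Suc.prems]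
        Ck_on_SucD(2)[OF Suc.prems])
  then show ?case by (intro Ck_on_SucI[OF assms(1) D])
qed

text \<open>\<open>Ck_on\<close> controls derivatives in fixed directions only, but the chain rule
  evaluates the derivative of the outer function in a direction that moves with the base point.
  Expansion over \<open>axis j 1\<close> separates the two dependences.\<close>

lemma has_derivative_vec_expand:
  assumes "(f has_derivative f') F"
  shows "f' (v :: real ^ 'n::finite) = (\<Sum>j\<in>UNIV. v $ j *\<^sub>R f' (axis j 1))"
proof -
  interpret bounded_linear f' using assms by (rule has_derivative_bounded_linear)
  have "v = (\<Sum>j\<in>UNIV. v $ j *\<^sub>R axis j 1)"
    by (metis basis_expansion scalar_mult_eq_scaleR)
  then have "f' v = f' (\<Sum>j\<in>UNIV. v $ j *\<^sub>R axis j 1)" by simp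
  then show ?thesis by (simp add: sum scaleR)
qed

lemma Ck_on_compose:
  fixes F :: "real ^ 'n::finite \<Rightarrow> real" and h :: "'a::real_normed_vector \<Rightarrow> real ^ 'n"
  assumes "open S" "Ck_on k S h" "open T" "Ck_on k T F" "h ` S \<subseteq> T"
  shows "Ck_on k S (\<lambda>x. F (h x))"
  using assms(2,4)
proof (induction k arbitrary: F)
  case 0
  then show ?case using assms(5) by (auto intro: continuous_on_compose2)
next
  case (Suc k)
  have hk: "Ck_on k S h" by (rule Ck_on_Suc_imp[OF Suc.prems(1)])
  have D: "((\<lambda>x. F (h x)) has_derivative
      (\<lambda>v. \<Sum>j\<in>UNIV. frechet_derivative h (at x) v $ j * frechet_derivative F (at (h x)) (axis j 1))) (at x)"
    if "x \<in> S" for x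
  proof -
    have F: "(F has_derivative frechet_derivative F (at (h x))) (at (h x))"
      using Ck_on_SucD(1)[OF Suc.prems(2)] assms(5) that by auto
    show ?thesis
      using has_derivative_compose[OF Ck_on_SucD(1)[OF Suc.prems(1) that] F]
      by (subst (asm) has_derivative_vec_expand[OF F]) simp
  qed
  have "Ck_on k S (\<lambda>x. \<Sum>j\<in>UNIV. frechet_derivative h (at x) v $ j * frechet_derivative F (at (h x)) (axis j 1))" for v
    by (intro Ck_on_sum Ck_on_mult assms(1) Suc.IH[OF hk] Ck_on_SucD(2)[OF Suc.prems(2)]
        Ck_on_bounded_linear_comp[OF bounded_linear_vec_nth] Ck_on_SucD(2)[OF Suc.prems(1)])
  then show ?case by (intro Ck_on_SucI[OF assms(1) D])
qed

lemma smooth_on_cong: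
  "open S \<Longrightarrow> (\<And>x. x \<in> S \<Longrightarrow> f x = h x) \<Longrightarrow> smooth_on S f \<Longrightarrow> smooth_on S h"
  unfolding smooth_on_def using Ck_on_cong by blast

lemma smooth_on_subset: "smooth_on T f \<Longrightarrow> S \<subseteq> T \<Longrightarrow> smooth_on S f"
  unfolding smooth_on_def using Ck_on_subset by blast

lemma smooth_on_has_derivative:
  "smooth_on S f \<Longrightarrow> x \<in> S \<Longrightarrow> (f has_derivative frechet_derivative f (at x)) (at x)"
  unfolding smooth_on_def by (metis Ck_on_SucD(1))

lemma smooth_on_frechet_derivative:
  "smooth_on S f \<Longrightarrow> smooth_on S (\<lambda>x. frechet_derivative f (at x) v)"
  unfolding smooth_on_def by (metis Ck_on_SucD(2))

lemma smooth_on_imp_continuous_on: "smooth_on S f \<Longrightarrow> continuous_on S f"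
  unfolding smooth_on_def by (metis Ck_on.simps(1))

text \<open>A positive \<open>l\<close> would make \<open>h'\<close> increase through its zero at 0.
  Then \<open>h'\<close> is positive just to the right of 0, and the mean value theorem gives a
  point with \<open>h e > h 0\<close>.\<close>

lemma second_derivative_nonpos_at_max:
  fixes h h' :: "real \<Rightarrow> real"
  assumes "\<epsilon> > 0" "\<And>t. \<bar>t\<bar> < \<epsilon> \<Longrightarrow> (h has_real_derivative h' t) (at t)"
    "\<And>t. \<bar>t\<bar> < \<epsilon> \<Longrightarrow> h t \<le> h 0" "(h' has_real_derivative l) (at 0)"
  shows "l \<le> 0"
proof (rule ccontr)
  assume "\<not> l \<le> 0"
  then obtain d where d: "d > 0" "\<And>t. 0 < t \<Longrightarrow> t < d \<Longrightarrow> h' 0 < h' t"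
    using DERIV_pos_inc_right[OF assms(4)] by (metis add_0 not_le)
  have h0: "h' 0 = 0"
    by (rule DERIV_local_max[OF assms(2) assms(1)]) (use assms in auto)
  define e where "e = min d \<epsilon> / 2"
  have e: "0 < e" "e < d" "e < \<epsilon>" using d(1) assms(1) by (auto simp: e_def)
  have "\<exists>z>0. z < e \<and> h e - h 0 = (e - 0) * h' z"
    by (rule MVT2) (use e assms(2) in auto)
  then obtain z where "0 < z" "z < e" "h e - h 0 = e * h' z" by auto
  moreover have "e * h' z > 0" using calculation d(2)[of z] e h0 by simp
  ultimately show False using assms(3)[of e] e by auto
qed

lemma smooth_on_compose:
  fixes F :: "real ^ 'n::finite \<Rightarrow> real" and h :: "'a::real_normed_vector \<Rightarrow> real ^ 'n"
  assumes "open S" "smooth_on S h" "open T" "smooth_on T F" "h ` S \<subseteq> T"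
  shows "smooth_on S (\<lambda>x. F (h x))"
  using assms Ck_on_compose unfolding smooth_on_def by blast

lemma smooth_on_vec_nth: "open S \<Longrightarrow> smooth_on S (\<lambda>x::real^'n::finite. x $ i)"
  unfolding smooth_on_def
proof
  fix k assume "open S"
  have "bounded_linear (\<lambda>x::real^'n. x $ i)" by (rule bounded_linear_vec_nth)
  note L = this bounded_linear_imp_has_derivative[OF this]
  show "Ck_on k S (\<lambda>x::real^'n. x $ i)"
  proof (cases k)
    case 0
    then show ?thesis by (auto intro: continuous_intros)
  next
    case (Suc j)
    then show ?thesis
      by (auto intro!: Ck_on_SucI[OF \<open>open S\<close> L(2)] Ck_on_const simp del: Ck_on.simps)
  qed
qed

section \<open>Charts, tangent vectors and vector fields\<close>

lemma chart_rep_comp: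
  "chart_rep c (\<lambda>p. f p + h p) = (\<lambda>x. chart_rep c f x + chart_rep c h x)"
  "chart_rep c (\<lambda>p. f p * h p) = (\<lambda>x. chart_rep c f x * chart_rep c h x)"
  "chart_rep c (\<lambda>p. f p powr r) = (\<lambda>x. chart_rep c f x powr r)"
  "chart_rep c (\<lambda>p. a) = (\<lambda>x. a)"
  by (auto simp: chart_rep_def)

locale smooth_mfd =
  fixes M :: "'m topology" and A :: "('m, 'n::finite) chart set"
  assumes smooth_manifold: "smooth_manifold M A"
begin

lemma chart_openin: "c \<in> A \<Longrightarrow> openin M (fst c)"
  and chart_homeomorphic:
    "c \<in> A \<Longrightarrow> homeomorphic_map (subtopology M (fst c)) (top_of_set (snd c ` fst c)) (snd c)"
  and chart_range_open: "c \<in> A \<Longrightarrow> open (snd c ` fst c)"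
  and transition_smooth:
    "c \<in> A \<Longrightarrow> d \<in> A \<Longrightarrow> smooth_on (snd c ` (fst c \<inter> fst d)) (chart_rep c (snd d))"
  using smooth_manifold by (force simp: smooth_manifold_def is_chart_def)+

lemma chart_at:
  assumes "p \<in> topspace M"
  obtains c where "c \<in> A" "p \<in> fst c"
proof -
  have "topspace M = (\<Union>c\<in>A. fst c)" using smooth_manifold by (simp add: smooth_manifold_def)
  then show ?thesis using assms that by auto
qed

lemma topspace_chart: "c \<in> A \<Longrightarrow> topspace (subtopology M (fst c)) = fst c"
  using openin_subset[OF chart_openin[of c]] by (simp add: topspace_subtopology inf.absorb2)

lemma chart_inj: "c \<in> A \<Longrightarrow> inj_on (snd c) (fst c)"
  using homeomorphic_imp_injective_map[OF chart_homeomorphic[of c]] topspace_chart[of c] by metis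

lemma chart_image_open:
  assumes "c \<in> A" "openin M V"
  shows "open (snd c ` (fst c \<inter> V))"
proof -
  have "openin (subtopology M (fst c)) (fst c \<inter> V)"
    using assms openin_subtopology_Int2 by blast
  then have "openin (top_of_set (snd c ` fst c)) (snd c ` (fst c \<inter> V))"
    using homeomorphic_imp_open_map[OF chart_homeomorphic[OF assms(1)]] by (simp add: open_map_def)
  then show ?thesis using openin_open_eq[OF chart_range_open[OF assms(1)]] by auto
qed

lemma chart_image_open': "c \<in> A \<Longrightarrow> openin M V \<Longrightarrow> V \<subseteq> fst c \<Longrightarrow> open (snd c ` V)"
  using chart_image_open by (metis inf.absorb2)

lemma chart_rep_apply: "c \<in> A \<Longrightarrow> p \<in> fst c \<Longrightarrow> chart_rep c f (snd c p) = f p"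
  by (simp add: chart_rep_def chart_inj)

lemma smooth_funD:
  "smooth_fun A W f \<Longrightarrow> c \<in> A \<Longrightarrow> smooth_on (snd c ` (fst c \<inter> W)) (chart_rep c f)"
  by (simp add: smooth_fun_def)

text \<open>In any other chart the representative of \<open>f\<close> is the given one composed with
  a smooth transition map, so one chart covering \<open>V\<close> decides smoothness.\<close>

lemma smooth_fun_chartI:
  assumes c: "c \<in> A" and V: "openin M V" "V \<subseteq> fst c" and f: "smooth_on (snd c ` V) (chart_rep c f)"
  shows "smooth_fun A V f"
  unfolding smooth_fun_def
proof
  fix d assume d: "d \<in> A"
  let ?S = "snd d ` (fst d \<inter> V)"
  have S: "open ?S" by (rule chart_image_open[OF d V(1)])
  have "smooth_on ?S (\<lambda>x. chart_rep c f (chart_rep d (snd c) x))"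
  proof (rule smooth_on_compose[OF S _ chart_image_open'[OF c V] f])
    show "smooth_on ?S (chart_rep d (snd c))"
      using transition_smooth[OF d c] V by (rule_tac smooth_on_subset) auto
    show "chart_rep d (snd c) ` ?S \<subseteq> snd c ` V"
      by (auto simp: chart_rep_apply d)
  qed
  then show "smooth_on ?S (chart_rep d f)"
    by (rule smooth_on_cong[OF S, rotated]) (use c d V in \<open>auto simp: chart_rep_apply\<close>)
qed

lemma smooth_fun_subset: "smooth_fun A W f \<Longrightarrow> V \<subseteq> W \<Longrightarrow> smooth_fun A V f"
  unfolding smooth_fun_def by (meson Int_mono image_mono order_refl smooth_on_subset)

lemma smooth_fun_cong:
  assumes "openin M W" "\<And>p. p \<in> W \<Longrightarrow> f p = h p" "smooth_fun A W f"
  shows "smooth_fun A W h"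
  unfolding smooth_fun_def
proof
  fix c assume c: "c \<in> A"
  show "smooth_on (snd c ` (fst c \<inter> W)) (chart_rep c h)"
    by (rule smooth_on_cong[OF chart_image_open[OF c assms(1)] _ smooth_funD[OF assms(3) c]])
      (use assms(2) c in \<open>auto simp: chart_rep_apply\<close>)
qed

lemma smooth_fun_const: "smooth_fun A W (\<lambda>p. a)"
  by (auto simp: smooth_fun_def chart_rep_comp smooth_on_def Ck_on_const)

lemma smooth_fun_add:
  "openin M W \<Longrightarrow> smooth_fun A W f \<Longrightarrow> smooth_fun A W h \<Longrightarrow> smooth_fun A W (\<lambda>p. f p + h p)"
  by (auto simp: smooth_fun_def chart_rep_comp smooth_on_def intro!: Ck_on_add chart_image_open)

lemma smooth_fun_mult:
  "openin M W \<Longrightarrow> smooth_fun A W f \<Longrightarrow> smooth_fun A W h \<Longrightarrow> smooth_fun A W (\<lambda>p. f p * h p)"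
  by (auto simp: smooth_fun_def chart_rep_comp smooth_on_def intro!: Ck_on_mult chart_image_open)

lemma smooth_fun_diff:
  "openin M W \<Longrightarrow> smooth_fun A W f \<Longrightarrow> smooth_fun A W h \<Longrightarrow> smooth_fun A W (\<lambda>p. f p - h p)"
  using smooth_fun_add[of W f "\<lambda>p. -1 * h p"] smooth_fun_mult[of W "\<lambda>p. -1" h] smooth_fun_const[of W "-1"]
  by simp

lemma smooth_fun_sum:
  "openin M W \<Longrightarrow> (\<And>i. i \<in> I \<Longrightarrow> smooth_fun A W (f i)) \<Longrightarrow> smooth_fun A W (\<lambda>p. \<Sum>i\<in>I. f i p)"
  by (induction I rule: infinite_finite_induct) (auto intro: smooth_fun_const smooth_fun_add)

lemma smooth_fun_powr:
  assumes "openin M W" "smooth_fun A W f" "\<And>p. p \<in> W \<Longrightarrow> f p > 0"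
  shows "smooth_fun A W (\<lambda>p. f p powr r)"
  unfolding smooth_fun_def
proof
  fix c assume c: "c \<in> A"
  then have "\<And>x. x \<in> snd c ` (fst c \<inter> W) \<Longrightarrow> chart_rep c f x > 0"
    using assms(3) by (auto simp: chart_rep_apply)
  then show "smooth_on (snd c ` (fst c \<inter> W)) (chart_rep c (\<lambda>p. f p powr r))"
    using smooth_funD[OF assms(2) c] chart_image_open[OF c assms(1)]
    by (auto simp: chart_rep_comp smooth_on_def intro!: Ck_on_powr)
qed

section \<open>Tangent vectors as derivations: change of chart, linear structure, locality\<close>

lemma smooth_nearI: "openin M W \<Longrightarrow> p \<in> W \<Longrightarrow> smooth_fun A W f \<Longrightarrow> smooth_near M A p f"
  by (auto simp: smooth_near_def)

lemma smooth_near_has_derivative: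
  assumes "smooth_near M A p f" "c \<in> A" "p \<in> fst c"
  shows "(chart_rep c f has_derivative frechet_derivative (chart_rep c f) (at (snd c p))) (at (snd c p))"
proof -
  obtain W where "p \<in> W" "smooth_fun A W f" using assms(1) by (auto simp: smooth_near_def)
  then show ?thesis
    using smooth_on_has_derivative[OF smooth_funD[OF _ assms(2)], of W f "snd c p"] assms(3) by blast
qed

lemma smooth_near_op:
  assumes "smooth_near M A p f" "smooth_near M A p h"
  shows "smooth_near M A p (\<lambda>x. f x + h x)" "smooth_near M A p (\<lambda>x. f x * h x)"
proof -
  obtain V W where "openin M V" "p \<in> V" "smooth_fun A V f" "openin M W" "p \<in> W" "smooth_fun A W h"
    using assms by (auto simp: smooth_near_def)
  then have "openin M (V \<inter> W)" "p \<in> V \<inter> W" "smooth_fun A (V \<inter> W) f" "smooth_fun A (V \<inter> W) h"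
    by (auto intro: smooth_fun_subset)
  then show "smooth_near M A p (\<lambda>x. f x + h x)" "smooth_near M A p (\<lambda>x. f x * h x)"
    by (auto intro!: smooth_nearI smooth_fun_add smooth_fun_mult)
qed

lemma smooth_near_cong:
  assumes "openin M W" "p \<in> W" "\<And>q. q \<in> W \<Longrightarrow> f q = h q" "smooth_near M A p f"
  shows "smooth_near M A p h"
proof -
  obtain V where "openin M V" "p \<in> V" "smooth_fun A V f" using assms(4) by (auto simp: smooth_near_def)
  then have "openin M (V \<inter> W)" "p \<in> V \<inter> W" "smooth_fun A (V \<inter> W) h"
    using assms by (auto intro: smooth_fun_subset intro!: smooth_fun_cong[of _ f h])
  then show ?thesis by (auto intro: smooth_nearI)
qed

text \<open>Chain rule for the transition map on the overlap of the charts. The default value 0 on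
  functions that are not smooth near \<open>p\<close> does not refer to a chart, so the functionals
  agree on every \<open>f\<close>.\<close>

lemma chart_vec_change:
  assumes "c \<in> A" "d \<in> A" "p \<in> fst c" "p \<in> fst d"
  shows "chart_vec M A d p w =
    chart_vec M A c p (frechet_derivative (chart_rep d (snd c)) (at (snd d p)) w)"
proof
  fix f
  let ?t = "chart_rep d (snd c)"
  show "chart_vec M A d p w f = chart_vec M A c p (frechet_derivative ?t (at (snd d p)) w) f"
  proof (cases "smooth_near M A p f")
    case True
    have t: "(?t has_derivative frechet_derivative ?t (at (snd d p))) (at (snd d p))"
      by (rule smooth_on_has_derivative[OF transition_smooth]) (use assms in auto)
    have "(chart_rep c f has_derivative frechet_derivative (chart_rep c f) (at (snd c p))) (at (?t (snd d p)))"
      using smooth_near_has_derivative[OF True assms(1,3)] assms by (simp add: chart_rep_apply)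
    from has_derivative_compose[OF t this]
    have "(chart_rep d f has_derivative (\<lambda>w. frechet_derivative (chart_rep c f) (at (snd c p))
        (frechet_derivative ?t (at (snd d p)) w))) (at (snd d p))"
    proof (rule has_derivative_transform_within_open)
      show "open (snd d ` (fst d \<inter> fst c))" using assms by (intro chart_image_open chart_openin)
    qed (use assms in \<open>auto simp: chart_rep_apply\<close>)
    from frechet_derivative_at[OF this] show ?thesis
      using True by (simp add: chart_vec_def) metis
  qed (simp add: chart_vec_def)
qed

lemma tangent_space_eq:
  assumes "c \<in> A" "p \<in> fst c"
  shows "tangent_space M A p = range (chart_vec M A c p)"
proof
  show "tangent_space M A p \<subseteq> range (chart_vec M A c p)"
    using chart_vec_change[OF assms(1) _ assms(2)] by (auto simp: tangent_space_def)
  show "range (chart_vec M A c p) \<subseteq> tangent_space M A p"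
    unfolding tangent_space_def using assms by blast
qed

lemma chart_vec_linear:
  assumes "c \<in> A" "p \<in> fst c"
  shows "linear (\<lambda>w. chart_vec M A c p w f)"
  using has_derivative_linear[OF smooth_near_has_derivative[OF _ assms, of f]]
  by (cases "smooth_near M A p f") (auto simp: chart_vec_def linear_zero)

lemma chart_vec_tangent: "c \<in> A \<Longrightarrow> p \<in> fst c \<Longrightarrow> chart_vec M A c p w \<in> tangent_space M A p"
  unfolding tangent_space_def by blast

lemma tangent_cases:
  assumes "u \<in> tangent_space M A p"
  obtains c w where "c \<in> A" "p \<in> fst c" "u = chart_vec M A c p w"
  using assms unfolding tangent_space_def by blast

lemma tangent_lincomb:
  assumes "u \<in> tangent_space M A p" "v \<in> tangent_space M A p"
  shows "(\<lambda>f. a * u f + b * v f) \<in> tangent_space M A p"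
proof -
  obtain c w where c: "c \<in> A" "p \<in> fst c" "u = chart_vec M A c p w" using assms(1) by (rule tangent_cases)
  moreover obtain w' where "v = chart_vec M A c p w'" using assms(2) tangent_space_eq[OF c(1,2)] by auto
  moreover have "(\<lambda>f. a * chart_vec M A c p w f + b * chart_vec M A c p w' f)
      = chart_vec M A c p (a *\<^sub>R w + b *\<^sub>R w')"
    by (simp add: fun_eq_iff linear_add[OF chart_vec_linear[OF c(1,2)]] linear_scale[OF chart_vec_linear[OF c(1,2)]])
  ultimately show ?thesis using chart_vec_tangent by simp
qed

lemma tangent_zero:
  assumes "p \<in> topspace M"
  shows "(\<lambda>f. 0) \<in> tangent_space M A p"
proof -
  obtain c where "c \<in> A" "p \<in> fst c" using assms by (rule chart_at)
  then have "chart_vec M A c p 0 \<in> tangent_space M A p" by (rule chart_vec_tangent)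
  from tangent_lincomb[OF this this, of 0 0] show ?thesis by simp
qed

lemma tangent_sum:
  assumes "p \<in> topspace M" "\<And>i. i \<in> I \<Longrightarrow> u i \<in> tangent_space M A p"
  shows "(\<lambda>f. \<Sum>i\<in>I. a i * u i f) \<in> tangent_space M A p"
  using assms(2)
proof (induction I rule: infinite_finite_induct)
  case (insert i I)
  then show ?case
    using tangent_lincomb[of "u i" p "\<lambda>f. \<Sum>i\<in>I. a i * u i f" "a i" 1] by simp
qed (auto intro: tangent_zero assms)

lemma tangent_deriv:
  assumes "u \<in> tangent_space M A p" "smooth_near M A p f" "smooth_near M A p h"
  shows "u (\<lambda>x. f x + h x) = u f + u h" "u (\<lambda>x. f x * h x) = u f * h p + f p * u h"
proof -
  obtain c w where c: "c \<in> A" "p \<in> fst c" "u = chart_vec M A c p w" using assms(1) by (rule tangent_cases)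
  note D = smooth_near_has_derivative[OF assms(2) c(1,2)] smooth_near_has_derivative[OF assms(3) c(1,2)]
  note add = frechet_derivative_at[OF has_derivative_add[OF D], symmetric]
  note mult = frechet_derivative_at[OF has_derivative_mult[OF D], symmetric]
  show "u (\<lambda>x. f x + h x) = u f + u h"
    using c assms(2,3) smooth_near_op[OF assms(2,3)] by (simp add: chart_vec_def chart_rep_comp add)
  show "u (\<lambda>x. f x * h x) = u f * h p + f p * u h"
    using c assms(2,3) smooth_near_op[OF assms(2,3)]
    by (simp add: chart_vec_def chart_rep_comp mult chart_rep_apply)
qed

lemma tangent_const:
  assumes "u \<in> tangent_space M A p"
  shows "u (\<lambda>x. a) = 0"
  using assms by (elim tangent_cases) (simp add: chart_vec_def chart_rep_comp frechet_derivative_const)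

text \<open>Functions that agree on \<open>W\<close> are smooth near \<open>p\<close> together; if
  they are not, both values are the default 0. This locality is what allows identities known only on
  an open set to be differentiated.\<close>

lemma tangent_cong:
  assumes "u \<in> tangent_space M A p" "openin M W" "p \<in> W" "\<And>q. q \<in> W \<Longrightarrow> f q = h q"
  shows "u f = u h"
proof -
  obtain c w where c: "c \<in> A" "p \<in> fst c" "u = chart_vec M A c p w" using assms(1) by (rule tangent_cases)
  have near: "smooth_near M A p f \<longleftrightarrow> smooth_near M A p h"
    using smooth_near_cong[OF assms(2,3)] assms(4) by metis
  show ?thesis
  proof (cases "smooth_near M A p f")
    case True
    have "(chart_rep c h has_derivative frechet_derivative (chart_rep c f) (at (snd c p))) (at (snd c p))"
      by (rule has_derivative_transform_within_open[OF smooth_near_has_derivative[OF True c(1,2)]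
            chart_image_open[OF c(1) assms(2)]])
        (use assms c in \<open>auto simp: chart_rep_apply\<close>)
    from frechet_derivative_at[OF this] show ?thesis
      using near True c by (simp add: chart_vec_def)
  qed (use near c in \<open>simp add: chart_vec_def\<close>)
qed

lemma tangent_at_max:
  assumes u: "u \<in> tangent_space M A p" and W: "openin M W" "p \<in> W" "smooth_fun A W f"
    and max: "\<And>q. q \<in> W \<Longrightarrow> f q \<le> f p"
  shows "u f = 0"
proof -
  obtain c w where c: "c \<in> A" "p \<in> fst c" "u = chart_vec M A c p w" using u by (rule tangent_cases)
  have near: "smooth_near M A p f" using W by (rule smooth_nearI)
  have "frechet_derivative (chart_rep c f) (at (snd c p)) = (\<lambda>v. 0)"
  proof (rule has_derivative_local_max[OF smooth_near_has_derivative[OF near c(1,2)]])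
    have "chart_rep c f y \<le> chart_rep c f (snd c p)" if "y \<in> snd c ` (fst c \<inter> W)" for y
      using that max c by (auto simp: chart_rep_apply)
    then show "\<forall>\<^sub>F y in at (snd c p). chart_rep c f y \<le> chart_rep c f (snd c p)"
      using chart_image_open[OF c(1) W(1)] c(2) W(2) by (auto simp: eventually_at_topological)
  qed
  then show ?thesis using c(3) by (simp add: chart_vec_def)
qed

section \<open>Smooth vector fields and coordinate fields\<close>

lemma smooth_vf_tangent: "X \<in> smooth_vf M A W \<Longrightarrow> p \<in> W \<Longrightarrow> X p \<in> tangent_space M A p"
  by (simp add: smooth_vf_def)

lemma smooth_vf_apply:
  "X \<in> smooth_vf M A W \<Longrightarrow> openin M W \<Longrightarrow> smooth_fun A W f \<Longrightarrow> smooth_fun A W (\<lambda>p. X p f)"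
  by (simp add: smooth_vf_def)

lemma smooth_vf_subset: "X \<in> smooth_vf M A W \<Longrightarrow> V \<subseteq> W \<Longrightarrow> X \<in> smooth_vf M A V"
  by (auto simp: smooth_vf_def)

lemma smooth_vf_cong:
  assumes "openin M W" "X \<in> smooth_vf M A W" "\<And>p. p \<in> W \<Longrightarrow> X p = Y p"
  shows "Y \<in> smooth_vf M A W"
proof -
  have "smooth_fun A V (\<lambda>p. Y p f)" if "openin M V" "V \<subseteq> W" "smooth_fun A V f" for V f
  proof (rule smooth_fun_cong[OF that(1)])
    show "smooth_fun A V (\<lambda>p. X p f)"
      by (rule smooth_vf_apply[OF smooth_vf_subset[OF assms(2) that(2)] that(1,3)])
    show "X p f = Y p f" if "p \<in> V" for p using that \<open>V \<subseteq> W\<close> assms(3) by auto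
  qed
  moreover have "Y p \<in> tangent_space M A p" if "p \<in> W" for p
    using smooth_vf_tangent[OF assms(2) that] assms(3)[OF that] by simp
  ultimately show ?thesis by (simp add: smooth_vf_def)
qed

lemma smooth_vf_add:
  assumes "X \<in> smooth_vf M A W" "Y \<in> smooth_vf M A W"
  shows "vf_add X Y \<in> smooth_vf M A W"
proof -
  have "vf_add X Y p \<in> tangent_space M A p" if "p \<in> W" for p
    using assms[THEN smooth_vf_tangent, OF that] tangent_lincomb[of "X p" p "Y p" 1 1]
    by (simp add: vf_add_def)
  moreover have "smooth_fun A V (\<lambda>p. vf_add X Y p f)" if "openin M V" "V \<subseteq> W" "smooth_fun A V f" for V f
    unfolding vf_add_def
    by (rule smooth_fun_add[OF that(1)
          smooth_vf_apply[OF smooth_vf_subset[OF assms(1) that(2)] that(1,3)]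
          smooth_vf_apply[OF smooth_vf_subset[OF assms(2) that(2)] that(1,3)]])
  ultimately show ?thesis by (simp add: smooth_vf_def)
qed

lemma smooth_vf_scale:
  assumes "X \<in> smooth_vf M A W" "smooth_fun A W h"
  shows "vf_scale h X \<in> smooth_vf M A W"
proof -
  have "vf_scale h X p \<in> tangent_space M A p" if "p \<in> W" for p
    using smooth_vf_tangent[OF assms(1) that] tangent_lincomb[of "X p" p "X p" "h p" 0]
    by (simp add: vf_scale_def)
  moreover have "smooth_fun A V (\<lambda>p. vf_scale h X p f)" if "openin M V" "V \<subseteq> W" "smooth_fun A V f" for V f
    unfolding vf_scale_def
    by (rule smooth_fun_mult[OF that(1) smooth_fun_subset[OF assms(2) that(2)]
          smooth_vf_apply[OF smooth_vf_subset[OF assms(1) that(2)] that(1,3)]])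
  ultimately show ?thesis by (simp add: smooth_vf_def)
qed

lemma vf_diff_eq: "vf_diff X Y = vf_add X (vf_scale (\<lambda>p. -1) Y)"
  by (simp add: vf_diff_def vf_add_def vf_scale_def)

lemma smooth_vf_diff:
  "X \<in> smooth_vf M A W \<Longrightarrow> Y \<in> smooth_vf M A W \<Longrightarrow> vf_diff X Y \<in> smooth_vf M A W"
  by (simp add: vf_diff_eq smooth_vf_add smooth_vf_scale smooth_fun_const)

lemma smooth_vf_sum:
  assumes "openin M W" "\<And>i. i \<in> I \<Longrightarrow> X i \<in> smooth_vf M A W"
    "\<And>i. i \<in> I \<Longrightarrow> smooth_fun A W (h i)"
  shows "(\<lambda>p f. \<Sum>i\<in>I. h i p * X i p f) \<in> smooth_vf M A W"
proof -
  have "(\<lambda>f. \<Sum>i\<in>I. h i p * X i p f) \<in> tangent_space M A p" if "p \<in> W" for p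
    using that assms openin_subset[OF assms(1)] by (intro tangent_sum) (auto simp: smooth_vf_def)
  moreover have "smooth_fun A V (\<lambda>p. \<Sum>i\<in>I. h i p * X i p f)"
    if "openin M V" "V \<subseteq> W" "smooth_fun A V f" for V f
    by (rule smooth_fun_sum[OF that(1) smooth_fun_mult[OF that(1) smooth_fun_subset[OF assms(3) that(2)]
          smooth_vf_apply[OF smooth_vf_subset[OF assms(2) that(2)] that(1,3)]]])
  ultimately show ?thesis by (simp add: smooth_vf_def)
qed

definition coord :: "('m, 'n) chart \<Rightarrow> 'n \<Rightarrow> 'm \<Rightarrow> real" where
  "coord c i = (\<lambda>q. snd c q $ i)"

definition coord_vf :: "('m, 'n) chart \<Rightarrow> 'n \<Rightarrow> 'm vfield" where
  "coord_vf c i = (\<lambda>p. chart_vec M A c p (axis i 1))"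

lemma chart_rep_coord: "c \<in> A \<Longrightarrow> x \<in> snd c ` fst c \<Longrightarrow> chart_rep c (coord c i) x = x $ i"
  by (auto simp: chart_rep_apply coord_def)

lemma coord_smooth: "c \<in> A \<Longrightarrow> smooth_fun A (fst c) (coord c i)"
  by (rule smooth_fun_chartI[OF _ chart_openin order_refl])
    (auto intro!: smooth_on_cong[OF chart_range_open _ smooth_on_vec_nth[OF chart_range_open]]
      simp: chart_rep_coord)

lemma chart_vec_coord:
  assumes "c \<in> A" "p \<in> fst c"
  shows "chart_vec M A c p w (coord c i) = w $ i"
proof -
  have "(chart_rep c (coord c i) has_derivative (\<lambda>w. w $ i)) (at (snd c p))"
    by (rule has_derivative_transform_within_open[OF
          bounded_linear_imp_has_derivative[OF bounded_linear_vec_nth] chart_range_open[OF assms(1)]])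
      (use assms in \<open>auto simp: chart_rep_coord\<close>)
  from frechet_derivative_at[OF this] show ?thesis
    using smooth_nearI[OF chart_openin assms(2) coord_smooth] assms
    by (simp add: chart_vec_def) metis
qed

lemma coord_vf_coord:
  "c \<in> A \<Longrightarrow> p \<in> fst c \<Longrightarrow> coord_vf c j p (coord c i) = (if i = j then 1 else 0)"
  by (simp add: coord_vf_def chart_vec_coord axis_def)

lemma coord_vf_smooth:
  assumes "c \<in> A"
  shows "coord_vf c i \<in> smooth_vf M A (fst c)"
proof -
  have "smooth_fun A V (\<lambda>p. coord_vf c i p f)"
    if V: "openin M V" "V \<subseteq> fst c" "smooth_fun A V f" for V f
  proof (rule smooth_fun_chartI[OF assms V(1,2)])
    have o: "open (snd c ` V)" by (rule chart_image_open'[OF assms V(1,2)])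
    have "smooth_on (snd c ` V) (chart_rep c f)"
      using smooth_funD[OF V(3) assms] V(2) by (simp add: inf.absorb2)
    from smooth_on_frechet_derivative[OF this, of "axis i 1"]
    show "smooth_on (snd c ` V) (chart_rep c (\<lambda>p. coord_vf c i p f))"
    proof (rule smooth_on_cong[OF o, rotated])
      fix x assume "x \<in> snd c ` V"
      then obtain p where "p \<in> V" "x = snd c p" by auto
      then show "frechet_derivative (chart_rep c f) (at x) (axis i 1) = chart_rep c (\<lambda>p. coord_vf c i p f) x"
        using V assms smooth_nearI[OF V(1) _ V(3)]
        by (auto simp: chart_rep_apply coord_vf_def chart_vec_def)
    qed
  qed
  then show ?thesis
    using assms by (auto simp: smooth_vf_def coord_vf_def intro: chart_vec_tangent)
qed

lemma tangent_coord_expand: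
  assumes "c \<in> A" "p \<in> fst c" "u \<in> tangent_space M A p"
  shows "u f = (\<Sum>j\<in>UNIV. u (coord c j) * coord_vf c j p f)"
proof -
  obtain w where w: "u = chart_vec M A c p w" using assms tangent_space_eq[OF assms(1,2)] by auto
  have "w = (\<Sum>j\<in>UNIV. w $ j *\<^sub>R axis j 1)" by (metis basis_expansion scalar_mult_eq_scaleR)
  then have "chart_vec M A c p w f = chart_vec M A c p (\<Sum>j\<in>UNIV. w $ j *\<^sub>R axis j 1) f" by simp
  also have "\<dots> = (\<Sum>j\<in>UNIV. w $ j * chart_vec M A c p (axis j 1) f)"
    by (simp add: linear_sum[OF chart_vec_linear[OF assms(1,2), of f]]
        linear_scale[OF chart_vec_linear[OF assms(1,2), of f]])
  finally show ?thesis using assms by (simp add: w chart_vec_coord coord_vf_def)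
qed

lemma tangent_sum_fun:
  assumes "u \<in> tangent_space M A p" "openin M W" "p \<in> W" "\<And>i. i \<in> I \<Longrightarrow> smooth_fun A W (h i)"
  shows "u (\<lambda>x. \<Sum>i\<in>I. h i x) = (\<Sum>i\<in>I. u (h i))"
  using assms(4)
proof (induction I rule: infinite_finite_induct)
  case (insert i I)
  have "smooth_near M A p (h i)" "smooth_near M A p (\<lambda>x. \<Sum>i\<in>I. h i x)"
    using insert assms(2,3) by (auto intro!: smooth_nearI smooth_fun_sum)
  with insert show ?case by (simp add: tangent_deriv(1)[OF assms(1)])
qed (auto simp: tangent_const[OF assms(1)])

text \<open>Writing \<open>X f = \<Sum> (X x\<^sub>j) (\<partial>\<^sub>j f)\<close> in a chart, the terms with derivatives of \<open>X x\<^sub>j\<close> vanish at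
  the maximum, and what remains is the second derivative of \<open>f\<close> along a straight line.\<close>

lemma second_derivative_at_max:
  assumes X: "X \<in> smooth_vf M A W" and W: "openin M W" "p \<in> W" and f: "smooth_fun A W f"
    and max: "\<And>q. q \<in> W \<Longrightarrow> f q \<le> f p"
  shows "X p (vf_apply X f) \<le> 0"
proof -
  have "p \<in> topspace M" using openin_subset[OF W(1)] W(2) by auto
  then obtain c where c: "c \<in> A" "p \<in> fst c" by (rule chart_at)
  let ?V = "fst c \<inter> W"
  have V: "openin M ?V" "p \<in> ?V" using c W chart_openin[OF c(1)] by auto
  have XV: "X \<in> smooth_vf M A ?V" and fV: "smooth_fun A ?V f"
    by (rule smooth_vf_subset[OF X] smooth_fun_subset[OF f], simp)+
  have Xp: "X p \<in> tangent_space M A p" by (rule smooth_vf_tangent[OF X W(2)])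
  have dV: "coord_vf c j \<in> smooth_vf M A ?V" for j
    by (rule smooth_vf_subset[OF coord_vf_smooth[OF c(1)]]) simp
  have dmax: "coord_vf c j p f = 0" for j
    by (rule tangent_at_max[OF smooth_vf_tangent[OF dV V(2)] V fV]) (use max in auto)
  have xV: "smooth_fun A ?V (coord c j)" for j
    by (rule smooth_fun_subset[OF coord_smooth[OF c(1)]]) simp
  have s1: "smooth_fun A ?V (\<lambda>q. X q (coord c j))" for j by (rule smooth_vf_apply[OF XV V(1) xV])
  have s2: "smooth_fun A ?V (\<lambda>q. coord_vf c j q f)" for j by (rule smooth_vf_apply[OF dV V(1) fV])
  have "X p (vf_apply X f) = X p (\<lambda>q. \<Sum>j\<in>UNIV. X q (coord c j) * coord_vf c j q f)"
    using tangent_coord_expand[OF c(1) _ smooth_vf_tangent[OF XV]]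
    by (intro tangent_cong[OF Xp V]) (auto simp: vf_apply_def)
  also have "\<dots> = (\<Sum>j\<in>UNIV. X p (\<lambda>q. X q (coord c j) * coord_vf c j q f))"
    by (rule tangent_sum_fun[OF Xp V smooth_fun_mult[OF V(1) s1 s2]])
  also have "\<dots> = (\<Sum>j\<in>UNIV. X p (coord c j) * X p (\<lambda>q. coord_vf c j q f))"
    by (simp add: tangent_deriv(2)[OF Xp smooth_nearI[OF V s1] smooth_nearI[OF V s2]] dmax)
  finally have eq: "X p (vf_apply X f) = \<dots>" .
  obtain a where a: "X p = chart_vec M A c p a" using Xp tangent_space_eq[OF c] by auto
  let ?F = "chart_rep c f" and ?x = "snd c p"
  have o: "open (snd c ` ?V)" using chart_image_open[OF c(1) W(1)] .
  obtain e where e: "e > 0" "ball ?x e \<subseteq> snd c ` ?V"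
    using openE[OF o, of ?x] V(2) by auto
  \<comment> \<open>The summand 1 keeps the quotient meaningful when \<open>a = 0\<close>.\<close>
  define \<epsilon> where "\<epsilon> = e / (norm a + 1)"
  have eps: "\<epsilon> > 0" using e by (simp add: \<epsilon>_def add_nonneg_pos)
  have line: "?x + t *\<^sub>R a \<in> snd c ` ?V" if "\<bar>t\<bar> < \<epsilon>" for t
  proof -
    have "\<bar>t\<bar> * norm a \<le> \<bar>t\<bar> * (norm a + 1)" by (simp add: mult_left_mono)
    also have "\<dots> < e" using that by (simp add: \<epsilon>_def pos_less_divide_eq add_nonneg_pos)
    finally show ?thesis using e(2) by (auto simp: dist_norm)
  qed
  let ?G = "\<lambda>j x. frechet_derivative ?F (at x) (axis j 1)"
  have F: "smooth_on (snd c ` ?V) ?F" using smooth_funD[OF f c(1)] .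
  have G: "smooth_on (snd c ` ?V) (?G j)" for j by (rule smooth_on_frechet_derivative[OF F])
  \<comment> \<open>Near \<open>?x\<close>, the function \<open>coord_vf c j f\<close> is
    represented by the \<open>j\<close>-th partial derivative \<open>?G j\<close> of
    \<open>?F\<close>, so differentiating it once more yields a second derivative of
    \<open>?F\<close>.\<close>
  have rep: "frechet_derivative (chart_rep c (\<lambda>q. coord_vf c j q f)) (at ?x) a =
      frechet_derivative (?G j) (at ?x) a" for j
  proof -
    have "(chart_rep c (\<lambda>q. coord_vf c j q f) has_derivative frechet_derivative (?G j) (at ?x)) (at ?x)"
    proof (rule has_derivative_transform_within_open[OF smooth_on_has_derivative[OF G] o])
      fix x assume "x \<in> snd c ` ?V"
      then obtain q where "q \<in> ?V" "x = snd c q" by auto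
      then show "?G j x = chart_rep c (\<lambda>q. coord_vf c j q f) x"
        using c smooth_nearI[OF V(1) _ fV]
        by (auto simp: chart_rep_apply coord_vf_def chart_vec_def)
    qed (use V in auto)
    from frechet_derivative_at[OF this] show ?thesis by simp
  qed
  have lined: "((\<lambda>t. ?x + t *\<^sub>R a) has_derivative (\<lambda>s. s *\<^sub>R a)) (at t)" for t
    by (auto intro!: derivative_eq_intros)
  have "(\<Sum>j\<in>UNIV. a $ j * frechet_derivative (?G j) (at ?x) a) \<le> 0"
  proof (rule second_derivative_nonpos_at_max[OF eps, where h = "\<lambda>t. ?F (?x + t *\<^sub>R a)"
        and h' = "\<lambda>t. \<Sum>j\<in>UNIV. a $ j * ?G j (?x + t *\<^sub>R a)"])
    fix t assume t: "\<bar>t\<bar> < \<epsilon>"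
    have D: "(?F has_derivative frechet_derivative ?F (at (?x + t *\<^sub>R a))) (at (?x + t *\<^sub>R a))"
      by (rule smooth_on_has_derivative[OF F line[OF t]])
    have "frechet_derivative ?F (at (?x + t *\<^sub>R a)) (s *\<^sub>R a) = (\<Sum>j\<in>UNIV. a $ j * ?G j (?x + t *\<^sub>R a)) * s" for s
      by (subst has_derivative_vec_expand[OF D]) (simp add: sum_distrib_left mult_ac)
    then show "((\<lambda>t. ?F (?x + t *\<^sub>R a)) has_real_derivative (\<Sum>j\<in>UNIV. a $ j * ?G j (?x + t *\<^sub>R a))) (at t)"
      using has_derivative_compose[OF lined D] by (simp add: has_field_derivative_def)
    show "?F (?x + t *\<^sub>R a) \<le> ?F (?x + 0 *\<^sub>R a)"
      using line[OF t] c max by (auto simp: chart_rep_apply)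
  next
    have D: "(?G j has_derivative frechet_derivative (?G j) (at ?x)) (at (?x + 0 *\<^sub>R a))" for j
      using smooth_on_has_derivative[OF G, of ?x] V by simp
    have "((\<lambda>t. ?G j (?x + t *\<^sub>R a)) has_real_derivative frechet_derivative (?G j) (at ?x) a) (at 0)" for j
      using has_derivative_compose[OF lined D[of j]]
        linear_scale[OF has_derivative_linear[OF D[of j]]]
      by (simp add: has_field_derivative_def mult_commute_abs)
    then show "((\<lambda>t. \<Sum>j\<in>UNIV. a $ j * ?G j (?x + t *\<^sub>R a)) has_real_derivative
        (\<Sum>j\<in>UNIV. a $ j * frechet_derivative (?G j) (at ?x) a)) (at 0)"
      by (intro DERIV_sum DERIV_cmult)
  qed
  also have "(\<Sum>j\<in>UNIV. a $ j * frechet_derivative (?G j) (at ?x) a) = X p (vf_apply X f)"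
  proof -
    have "chart_vec M A c p a (\<lambda>q. coord_vf c j q f) = frechet_derivative (?G j) (at ?x) a" for j
      using rep[of j] smooth_nearI[OF V s2[of j]] by (simp add: chart_vec_def)
    then show ?thesis using c eq by (simp add: a chart_vec_coord)
  qed
  finally show ?thesis .
qed

end

section \<open>Local orthonormal frames\<close>

locale riemannian_mfd = smooth_mfd M A
  for M :: "'m topology" and A :: "('m, 'n::finite) chart set" +
  fixes g :: "'m metric_tensor"
  assumes riemannian: "riemannian_metric M A g"
begin

context
  fixes p assumes p: "p \<in> topspace M"
begin

lemma g_sym: "u \<in> tangent_space M A p \<Longrightarrow> v \<in> tangent_space M A p \<Longrightarrow> g p u v = g p v u"
  and g_lincomb: "u \<in> tangent_space M A p \<Longrightarrow> v \<in> tangent_space M A p \<Longrightarrow> w \<in> tangent_space M A p \<Longrightarrow>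
    g p (\<lambda>f. a * u f + b * v f) w = a * g p u w + b * g p v w"
  and g_pos: "u \<in> tangent_space M A p \<Longrightarrow> u \<noteq> (\<lambda>f. 0) \<Longrightarrow> g p u u > 0"
  using riemannian p by (simp_all add: riemannian_metric_def)

lemma g_zero: "w \<in> tangent_space M A p \<Longrightarrow> g p (\<lambda>f. 0) w = 0"
  using g_lincomb[of w w w 0 0] by simp

lemma g_sum:
  assumes "\<And>i. i \<in> I \<Longrightarrow> u i \<in> tangent_space M A p" "w \<in> tangent_space M A p"
  shows "g p (\<lambda>f. \<Sum>i\<in>I. a i * u i f) w = (\<Sum>i\<in>I. a i * g p (u i) w)"
  using assms(1)
proof (induction I rule: infinite_finite_induct)
  case (insert i I)
  have "(\<lambda>f. \<Sum>i\<in>I. a i * u i f) \<in> tangent_space M A p"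
    by (rule tangent_sum[OF p]) (use insert in auto)
  with insert show ?case
    using g_lincomb[of "u i" "\<lambda>f. \<Sum>i\<in>I. a i * u i f" w "a i" 1] assms(2) by simp
qed (use g_zero assms(2) in auto)

text \<open>The vectors are indexed by the coordinate type \<open>'n\<close>, so there are as many
  of them as the dimension. Orthonormality makes the coefficient map \<open>T\<close> injective on
  \<open>real ^ 'n\<close>, hence surjective; pairing with \<open>e j\<close> then reads off the
  coefficients.\<close>

lemma orthonormal_expand:
  fixes e :: "'n \<Rightarrow> 'm tvec"
  assumes e: "\<And>i. e i \<in> tangent_space M A p" "\<And>i j. g p (e i) (e j) = (if i = j then 1 else 0)"
    and v: "v \<in> tangent_space M A p"
  shows "v = (\<lambda>f. \<Sum>i\<in>UNIV. g p v (e i) * e i f)"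
proof -
  obtain c where c: "c \<in> A" "p \<in> fst c" using p by (rule chart_at)
  let ?L = "chart_vec M A c p"
  have "\<forall>i. \<exists>w. e i = ?L w" using e(1) unfolding tangent_space_eq[OF c] by auto
  from choice[OF this] obtain w where w: "\<And>i. e i = ?L (w i)" by blast
  define T where "T x = (\<Sum>i\<in>UNIV. x $ i *\<^sub>R w i)" for x :: "real ^ 'n"
  have LT: "?L (T x) = (\<lambda>f. \<Sum>i\<in>UNIV. x $ i * e i f)" for x
    by (rule ext) (simp add: T_def w linear_sum[OF chart_vec_linear[OF c]] linear_scale[OF chart_vec_linear[OF c]])
  have coeff: "g p (\<lambda>f. \<Sum>i\<in>UNIV. x $ i * e i f) (e j) = x $ j" for x :: "real ^ 'n" and j
    by (simp add: g_sum e if_distrib cong: if_cong)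
  have linT: "linear T"
    by (auto simp: T_def linear_iff scaleR_add_left sum.distrib scaleR_sum_right)
  have "inj T"
  proof (rule linear_injective_0[OF linT, THEN iffD2], intro allI impI)
    fix x assume "T x = 0"
    then have z: "(\<lambda>f. \<Sum>i\<in>UNIV. x $ i * e i f) = (\<lambda>f. 0)"
      using LT[of x] by (simp add: fun_eq_iff linear_0[OF chart_vec_linear[OF c]])
    have "x $ j = 0" for j using coeff[of x j] unfolding z by (simp add: g_zero e)
    then show "x = 0" by (simp add: vec_eq_iff)
  qed
  then have T: "surj T" using linT linear_injective_imp_surjective by blast
  obtain y where "v = ?L y" using v tangent_space_eq[OF c] by auto
  moreover obtain x where "y = T x" using T by (rule surjE)
  ultimately have "v = ?L (T x)" by simp
  then have "v = (\<lambda>f. \<Sum>i\<in>UNIV. x $ i * e i f)" by (simp only: LT)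
  then show ?thesis using coeff by simp
qed

end

lemma metric_pair_smooth:
  "openin M W \<Longrightarrow> X \<in> smooth_vf M A W \<Longrightarrow> Y \<in> smooth_vf M A W \<Longrightarrow> smooth_fun A W (metric_pair g X Y)"
  using riemannian by (simp add: riemannian_metric_def)

text \<open>Gram-Schmidt applied to the coordinate fields. The condition \<open>E\<^sub>j x\<^sub>k = 0\<close> for \<open>k \<notin> S\<close> expresses
  that the \<open>E\<^sub>j\<close> lie in the span of the first coordinate fields, and keeps the next vector nonzero.\<close>

lemma gram_schmidt:
  assumes c: "c \<in> A" and "finite S"
  shows "\<exists>E :: 'n \<Rightarrow> 'm vfield. (\<forall>i\<in>S. E i \<in> smooth_vf M A (fst c)) \<and>
    (\<forall>p\<in>fst c. \<forall>i\<in>S. \<forall>j\<in>S. metric_pair g (E i) (E j) p = (if i = j then 1 else 0)) \<and>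
    (\<forall>p\<in>fst c. \<forall>j\<in>S. \<forall>k\<in>-S. E j p (coord c k) = 0)"
  using assms(2)
proof induction
  case empty
  show ?case by simp
next
  case (insert i S)
  let ?U = "fst c"
  have U: "openin M ?U" by (rule chart_openin[OF c])
  have mem_topspace: "p \<in> topspace M" if "p \<in> ?U" for p using that openin_subset[OF U] by auto
  from insert.IH obtain E :: "'n \<Rightarrow> 'm vfield" where IH: "\<forall>j\<in>S. E j \<in> smooth_vf M A ?U"
    "\<forall>p\<in>?U. \<forall>j\<in>S. \<forall>k\<in>S. metric_pair g (E j) (E k) p = (if j = k then 1 else 0)"
    "\<forall>p\<in>?U. \<forall>j\<in>S. \<forall>k\<in>-S. E j p (coord c k) = 0"
    by blast
  have E: "\<And>j. j \<in> S \<Longrightarrow> E j \<in> smooth_vf M A ?U"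
    "\<And>p j k. p \<in> ?U \<Longrightarrow> j \<in> S \<Longrightarrow> k \<in> S \<Longrightarrow> metric_pair g (E j) (E k) p = (if j = k then 1 else 0)"
    "\<And>p j k. p \<in> ?U \<Longrightarrow> j \<in> S \<Longrightarrow> k \<notin> S \<Longrightarrow> E j p (coord c k) = 0"
    using IH by simp_all
  define h where "h j = metric_pair g (coord_vf c i) (E j)" for j
  define Z where "Z = (\<lambda>p f. \<Sum>j\<in>S. h j p * E j p f)"
  define V where "V = vf_diff (coord_vf c i) Z"
  have d: "coord_vf c i \<in> smooth_vf M A ?U" by (rule coord_vf_smooth[OF c])
  have hs: "smooth_fun A ?U (h j)" if "j \<in> S" for j
    unfolding h_def by (rule metric_pair_smooth[OF U d E(1)[OF that]])
  have Z: "Z \<in> smooth_vf M A ?U" unfolding Z_def by (rule smooth_vf_sum[OF U E(1) hs])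
  have V: "V \<in> smooth_vf M A ?U" unfolding V_def by (rule smooth_vf_diff[OF d Z])
  have Vg: "g p (V p) w = g p (coord_vf c i p) w - g p (Z p) w"
    if "p \<in> ?U" "w \<in> tangent_space M A p" for p w
    using g_lincomb[OF mem_topspace[OF that(1)] smooth_vf_tangent[OF d that(1)] smooth_vf_tangent[OF Z that(1)] that(2), of 1 "-1"]
    by (simp add: V_def vf_diff_def)
  have VE: "g p (V p) (E k p) = 0" if "p \<in> ?U" "k \<in> S" for p k
  proof -
    have "g p (Z p) (E k p) = (\<Sum>j\<in>S. h j p * g p (E j p) (E k p))"
      unfolding Z_def
      by (rule g_sum[OF mem_topspace[OF that(1)]]) (use that E(1) smooth_vf_tangent in blast)+
    also have "\<dots> = (\<Sum>j\<in>S. if j = k then h j p else 0)"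
      using E(2)[OF that(1) _ that(2)] by (intro sum.cong) (auto simp: metric_pair_def)
    also have "\<dots> = h k p" using insert.hyps(1) that(2) by simp
    finally show ?thesis
      using Vg[OF that(1) smooth_vf_tangent[OF E(1)[OF that(2)] that(1)]] by (simp add: h_def metric_pair_def)
  qed
  \<comment> \<open>The projection \<open>Z\<close> has no component outside \<open>S\<close>, so
    \<open>V\<close> keeps the component 1 of the coordinate field in direction \<open>i\<close>.
    This excludes \<open>V p = 0\<close> at every point of the chart.\<close>
  have Vx: "V p (coord c k) = (if k = i then 1 else 0)" if "p \<in> ?U" "k \<notin> S" for p k
    using that c E(3)[OF that(1) _ that(2)] by (simp add: V_def vf_diff_def Z_def coord_vf_coord)
  have VV: "g p (V p) (V p) > 0" if "p \<in> ?U" for p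
  proof (rule g_pos[OF mem_topspace[OF that] smooth_vf_tangent[OF V that]])
    show "V p \<noteq> (\<lambda>f. 0)"
      using Vx[OF that insert.hyps(2)] by auto
  qed
  define r where "r = (\<lambda>p. (metric_pair g V V p) powr (-1/2))"
  have r: "smooth_fun A ?U r"
    unfolding r_def using VV by (intro smooth_fun_powr U metric_pair_smooth V) (auto simp: metric_pair_def)
  have rr: "r p * (r p * g p (V p) (V p)) = 1" if "p \<in> ?U" for p
    using VV[OF that] by (simp add: r_def metric_pair_def mult.assoc[symmetric] powr_add[symmetric] powr_minus_divide)
  define N where "N = vf_scale r V"
  have N: "N \<in> smooth_vf M A ?U" unfolding N_def by (rule smooth_vf_scale[OF V r])
  have Ng: "g p (N p) w = r p * g p (V p) w" if "p \<in> ?U" "w \<in> tangent_space M A p" for p w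
    using g_lincomb[OF mem_topspace[OF that(1)] smooth_vf_tangent[OF V that(1)] smooth_vf_tangent[OF V that(1)] that(2), of "r p" 0]
    by (simp add: N_def vf_scale_def)
  have NE: "g p (N p) (E k p) = 0" "g p (E k p) (N p) = 0" if "p \<in> ?U" "k \<in> S" for p k
  proof -
    have Ek: "E k p \<in> tangent_space M A p" by (rule smooth_vf_tangent[OF E(1)[OF that(2)] that(1)])
    show "g p (N p) (E k p) = 0" using Ng[OF that(1) Ek] VE[OF that] by simp
    then show "g p (E k p) (N p) = 0" using g_sym[OF mem_topspace[OF that(1)] Ek smooth_vf_tangent[OF N that(1)]] by simp
  qed
  have NN: "g p (N p) (N p) = 1" if "p \<in> ?U" for p
    using Ng[OF that smooth_vf_tangent[OF N that]] Ng[OF that smooth_vf_tangent[OF V that]]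
      g_sym[OF mem_topspace[OF that] smooth_vf_tangent[OF V that] smooth_vf_tangent[OF N that]] rr[OF that]
    by simp
  let ?E = "E(i := N)"
  have "\<forall>j\<in>insert i S. ?E j \<in> smooth_vf M A ?U" using E(1) N by auto
  moreover have "\<forall>p\<in>?U. \<forall>j\<in>insert i S. \<forall>k\<in>insert i S. metric_pair g (?E j) (?E k) p = (if j = k then 1 else 0)"
    using E(2) NE NN insert.hyps(2) by (auto simp: metric_pair_def)
  moreover have "\<forall>p\<in>?U. \<forall>j\<in>insert i S. \<forall>k\<in>-insert i S. ?E j p (coord c k) = 0"
    using E(3) Vx by (auto simp: N_def vf_scale_def)
  ultimately show ?case by blast
qed

lemma orthonormal_frame_exists:
  assumes "p \<in> topspace M"
  obtains W E where "openin M W" "p \<in> W" "orthonormal_frame M A g W E"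
proof -
  obtain c where c: "c \<in> A" "p \<in> fst c" using assms by (rule chart_at)
  show ?thesis
    using gram_schmidt[OF c(1), of UNIV] that[OF chart_openin[OF c(1)] c(2)]
    by (auto simp: orthonormal_frame_def)
qed

lemma orthonormal_frame_subset:
  "orthonormal_frame M A g W E \<Longrightarrow> V \<subseteq> W \<Longrightarrow> orthonormal_frame M A g V E"
  by (auto simp: orthonormal_frame_def intro: smooth_vf_subset)

end

section \<open>The cubic form and the Gauss-Codazzi equations\<close>

text \<open>The equality of \<gamma> with its adjoint is built into the adjointness relation itself:
  \<gamma> occurs on both sides of \<open>is_metric_adjoint\<close>.\<close>

locale affine_riemann_mfd = riemannian_mfd M A g
  for M :: "'m topology" and A :: "('m, 'n::finite) chart set" and g :: "'m metric_tensor" +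
  fixes nab D :: "'m connection" and \<gamma> :: "'m tensor12"
  assumes conn_nab: "is_connection M A nab" and flat_nab: "flat M A nab"
    and torsionless_nab: "torsionless M A nab"
    and levi_civita: "levi_civita M A g D"
    and \<gamma>_def: "\<gamma> = difference_tensor D nab"
    and \<gamma>_self_adjoint: "is_metric_adjoint M A g \<gamma> \<gamma>"
    and trace_zero: "metric_trace_zero M A g \<gamma>"

text \<open>Frames and coordinate fields exist only locally and are not extended by cut-off
  functions. All fields live on one fixed open set \<open>U\<close>, and passing to a smaller
  \<open>U\<close> takes the place of extending them.\<close>

locale patch = affine_riemann_mfd M A g nab D \<gamma>
  for M :: "'m topology" and A :: "('m, 'n::finite) chart set" and g nab D \<gamma> +
  fixes U :: "'m set"
  assumes U: "openin M U"
begin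

abbreviation vfs :: "'m vfield set" where "vfs \<equiv> smooth_vf M A U"
abbreviation smf :: "('m \<Rightarrow> real) \<Rightarrow> bool" where "smf \<equiv> smooth_fun A U"
abbreviation gm :: "'m vfield \<Rightarrow> 'm vfield \<Rightarrow> 'm \<Rightarrow> real" where "gm \<equiv> metric_pair g"

section \<open>Differential calculus on a patch\<close>

lemma mem_topspace: "p \<in> U \<Longrightarrow> p \<in> topspace M"
  using openin_subset[OF U] by auto

lemma vf_tangent: "X \<in> vfs \<Longrightarrow> p \<in> U \<Longrightarrow> X p \<in> tangent_space M A p"
  by (rule smooth_vf_tangent)

lemma der_smooth: "X \<in> vfs \<Longrightarrow> smf f \<Longrightarrow> smf (\<lambda>p. X p f)"
  by (rule smooth_vf_apply[OF _ U])

lemma der_cong: "X \<in> vfs \<Longrightarrow> p \<in> U \<Longrightarrow> (\<And>q. q \<in> U \<Longrightarrow> f q = h q) \<Longrightarrow> X p f = X p h"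
  by (rule tangent_cong[OF vf_tangent U])

lemma der_add:
  assumes "X \<in> vfs" "p \<in> U" "smf f" "smf h"
  shows "X p (\<lambda>q. f q + h q) = X p f + X p h"
  by (rule tangent_deriv(1)[OF vf_tangent[OF assms(1,2)] smooth_nearI[OF U assms(2,3)] smooth_nearI[OF U assms(2,4)]])

lemma der_mult:
  assumes "X \<in> vfs" "p \<in> U" "smf f" "smf h"
  shows "X p (\<lambda>q. f q * h q) = X p f * h p + f p * X p h"
  by (rule tangent_deriv(2)[OF vf_tangent[OF assms(1,2)] smooth_nearI[OF U assms(2,3)] smooth_nearI[OF U assms(2,4)]])

lemma der_const: "X \<in> vfs \<Longrightarrow> p \<in> U \<Longrightarrow> X p (\<lambda>q. a) = 0"
  by (rule tangent_const[OF vf_tangent])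

lemma der_diff:
  assumes "X \<in> vfs" "p \<in> U" "smf f" "smf h"
  shows "X p (\<lambda>q. f q - h q) = X p f - X p h"
proof -
  have "X p (\<lambda>q. f q + -1 * h q) = X p f + X p (\<lambda>q. -1 * h q)"
    by (rule der_add[OF assms(1-3) smooth_fun_mult[OF U smooth_fun_const assms(4)]])
  also have "X p (\<lambda>q. -1 * h q) = - X p h"
    using der_mult[OF assms(1,2) smooth_fun_const[of U "-1"] assms(4)] der_const[OF assms(1,2)] by simp
  finally show ?thesis by simp
qed

lemma der_sum:
  assumes "X \<in> vfs" "p \<in> U" "\<And>i. i \<in> I \<Longrightarrow> smf (f i)"
  shows "X p (\<lambda>q. \<Sum>i\<in>I. f i q) = (\<Sum>i\<in>I. X p (f i))"
  by (rule tangent_sum_fun[OF vf_tangent[OF assms(1,2)] U assms(2,3)])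

lemma gm_smooth: "X \<in> vfs \<Longrightarrow> Y \<in> vfs \<Longrightarrow> smf (gm X Y)"
  by (rule metric_pair_smooth[OF U])

lemma gm_sym: "X \<in> vfs \<Longrightarrow> Y \<in> vfs \<Longrightarrow> p \<in> U \<Longrightarrow> gm X Y p = gm Y X p"
  by (simp add: metric_pair_def g_sym mem_topspace vf_tangent)

lemma gm_add:
  "X \<in> vfs \<Longrightarrow> Y \<in> vfs \<Longrightarrow> Z \<in> vfs \<Longrightarrow> p \<in> U \<Longrightarrow> gm (vf_add X Y) Z p = gm X Z p + gm Y Z p"
  using g_lincomb[of p "X p" "Y p" "Z p" 1 1] by (simp add: metric_pair_def vf_add_def mem_topspace vf_tangent)

lemma gm_diff:
  "X \<in> vfs \<Longrightarrow> Y \<in> vfs \<Longrightarrow> Z \<in> vfs \<Longrightarrow> p \<in> U \<Longrightarrow> gm (vf_diff X Y) Z p = gm X Z p - gm Y Z p"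
  using g_lincomb[of p "X p" "Y p" "Z p" 1 "-1"] by (simp add: metric_pair_def vf_diff_def mem_topspace vf_tangent)

lemma gm_scale:
  "X \<in> vfs \<Longrightarrow> Z \<in> vfs \<Longrightarrow> p \<in> U \<Longrightarrow> gm (vf_scale h X) Z p = h p * gm X Z p"
  using g_lincomb[of p "X p" "X p" "Z p" "h p" 0] by (simp add: metric_pair_def vf_scale_def mem_topspace vf_tangent)

context
  fixes K :: "'m connection"
  assumes K: "is_connection M A K"
begin

lemmas KU = K[unfolded is_connection_def vf_eq_on_def, THEN spec, THEN mp, OF U]
lemmas KU1 = KU[THEN conjunct1]
  and KU2 = KU[THEN conjunct2, THEN conjunct1]
  and KU3 = KU[THEN conjunct2, THEN conjunct2, THEN conjunct1]
  and KU4 = KU[THEN conjunct2, THEN conjunct2, THEN conjunct2, THEN conjunct1]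
  and KU5 = KU[THEN conjunct2, THEN conjunct2, THEN conjunct2, THEN conjunct2, THEN conjunct1]
  and KU6 = KU[THEN conjunct2, THEN conjunct2, THEN conjunct2, THEN conjunct2, THEN conjunct2]

lemma conn_smooth: "X \<in> vfs \<Longrightarrow> Y \<in> vfs \<Longrightarrow> K X Y \<in> vfs"
  using KU1 by blast

lemma conn_cong:
  "X \<in> vfs \<Longrightarrow> X' \<in> vfs \<Longrightarrow> Y \<in> vfs \<Longrightarrow> Y' \<in> vfs \<Longrightarrow> vf_eq_on U X X' \<Longrightarrow> vf_eq_on U Y Y' \<Longrightarrow>
    p \<in> U \<Longrightarrow> K X Y p = K X' Y' p"
  unfolding vf_eq_on_def using KU2 by blast

lemma conn_add1:
  "X \<in> vfs \<Longrightarrow> X' \<in> vfs \<Longrightarrow> Y \<in> vfs \<Longrightarrow> p \<in> U \<Longrightarrow> K (vf_add X X') Y p = vf_add (K X Y) (K X' Y) p"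
  using KU3 by blast

lemma conn_scale1:
  "X \<in> vfs \<Longrightarrow> Y \<in> vfs \<Longrightarrow> smf h \<Longrightarrow> p \<in> U \<Longrightarrow> K (vf_scale h X) Y p = vf_scale h (K X Y) p"
  using KU4 by blast

lemma conn_add2:
  "X \<in> vfs \<Longrightarrow> Y \<in> vfs \<Longrightarrow> Y' \<in> vfs \<Longrightarrow> p \<in> U \<Longrightarrow> K X (vf_add Y Y') p = vf_add (K X Y) (K X Y') p"
  using KU5 by blast

lemma conn_scale2:
  "X \<in> vfs \<Longrightarrow> Y \<in> vfs \<Longrightarrow> smf h \<Longrightarrow> p \<in> U \<Longrightarrow>
    K X (vf_scale h Y) p = vf_add (vf_scale (vf_apply X h) Y) (vf_scale h (K X Y)) p"
  using KU6 by blast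

lemma conn_diff1:
  assumes "X \<in> vfs" "X' \<in> vfs" "Y \<in> vfs" "p \<in> U"
  shows "K (vf_diff X X') Y p = vf_diff (K X Y) (K X' Y) p"
  using conn_add1[OF assms(1) smooth_vf_scale[OF assms(2) smooth_fun_const] assms(3,4), of "-1"]
    conn_scale1[OF assms(2,3) smooth_fun_const assms(4), of "-1"]
  by (simp add: vf_diff_eq vf_add_def)

lemma conn_diff2:
  assumes "X \<in> vfs" "Y \<in> vfs" "Y' \<in> vfs" "p \<in> U"
  shows "K X (vf_diff Y Y') p = vf_diff (K X Y) (K X Y') p"
  using conn_add2[OF assms(1,2) smooth_vf_scale[OF assms(3) smooth_fun_const] assms(4), of "-1"]
    conn_scale2[OF assms(1,3) smooth_fun_const assms(4), of "-1"] der_const[OF assms(1,4)]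
  by (simp add: vf_diff_eq vf_add_def vf_scale_def vf_apply_def)

end

lemma conn_D: "is_connection M A D" and torsionless_D: "torsionless M A D"
  and metric_D: "metric_connection M A g D"
  using levi_civita by (simp_all add: levi_civita_def)

lemmas D_smooth = conn_smooth[OF conn_D]

lemma D_metric:
  "X \<in> vfs \<Longrightarrow> Y \<in> vfs \<Longrightarrow> Z \<in> vfs \<Longrightarrow> p \<in> U \<Longrightarrow> X p (gm Y Z) = gm (D X Y) Z p + gm Y (D X Z) p"
  using metric_D U unfolding metric_connection_def vf_apply_def by blast

text \<open>Used for both connections: it removes the bracket from curvature computations, and
  comparing the two expressions for one bracket makes \<gamma> symmetric.\<close>

lemma bracket_eq:
  assumes "torsionless M A K" "X \<in> vfs" "Y \<in> vfs" "p \<in> U"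
  shows "lie_bracket M A X Y p = vf_diff (K X Y) (K Y X) p"
proof -
  have "torsion M A K X Y p = vf_zero p"
    using assms U unfolding torsionless_def vf_eq_on_def by blast
  then show ?thesis by (simp add: torsion_def vf_diff_def vf_zero_def fun_eq_iff)
qed

text \<open>Tangency and smoothness of the bracket are read off from its expression through
  \<open>D\<close>, which avoids computing with second derivatives in a chart.\<close>

lemma bracket_smooth: "X \<in> vfs \<Longrightarrow> Y \<in> vfs \<Longrightarrow> lie_bracket M A X Y \<in> vfs"
  by (rule smooth_vf_cong[OF U smooth_vf_diff[OF D_smooth D_smooth]])
    (simp_all add: bracket_eq[OF torsionless_D])

lemma bracket_apply:
  assumes "X \<in> vfs" "Y \<in> vfs" "p \<in> U" "smf f"
  shows "D X Y p f - D Y X p f = X p (\<lambda>q. Y q f) - Y p (\<lambda>q. X q f)"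
  using fun_cong[OF bracket_eq[OF torsionless_D assms(1-3)], of f] smooth_nearI[OF U assms(3,4)]
  by (simp add: lie_bracket_def vf_diff_def vf_apply_def)

lemma \<gamma>_apply: "\<gamma> X Y p f = D X Y p f - nab X Y p f"
  by (simp add: \<gamma>_def difference_tensor_def vf_diff_def)

lemma \<gamma>_smooth: "X \<in> vfs \<Longrightarrow> Y \<in> vfs \<Longrightarrow> \<gamma> X Y \<in> vfs"
  by (simp add: \<gamma>_def difference_tensor_def smooth_vf_diff conn_smooth conn_D conn_nab)

lemma \<gamma>_sym:
  assumes "X \<in> vfs" "Y \<in> vfs" "p \<in> U"
  shows "\<gamma> X Y p = \<gamma> Y X p"
proof
  fix f
  show "\<gamma> X Y p f = \<gamma> Y X p f"
    using fun_cong[OF bracket_eq[OF torsionless_D assms], of f]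
      fun_cong[OF bracket_eq[OF torsionless_nab assms], of f]
    by (simp add: \<gamma>_apply vf_diff_def)
qed

lemma \<gamma>_add1:
  assumes "X \<in> vfs" "X' \<in> vfs" "Y \<in> vfs" "p \<in> U"
  shows "\<gamma> (vf_add X X') Y p = vf_add (\<gamma> X Y) (\<gamma> X' Y) p"
  by (rule ext) (simp add: \<gamma>_apply vf_add_def conn_add1[OF conn_D assms, unfolded vf_add_def]
      conn_add1[OF conn_nab assms, unfolded vf_add_def])

lemma \<gamma>_scale1:
  assumes "X \<in> vfs" "Y \<in> vfs" "smf h" "p \<in> U"
  shows "\<gamma> (vf_scale h X) Y p = vf_scale h (\<gamma> X Y) p"
  by (rule ext) (simp add: \<gamma>_apply vf_scale_def conn_scale1[OF conn_D assms, unfolded vf_scale_def]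
      conn_scale1[OF conn_nab assms, unfolded vf_scale_def] algebra_simps)

lemma \<gamma>_cong:
  assumes "X \<in> vfs" "X' \<in> vfs" "Y \<in> vfs" "vf_eq_on U X X'" "p \<in> U"
  shows "\<gamma> X Y p = \<gamma> X' Y p"
proof -
  have "vf_eq_on U Y Y" by (simp add: vf_eq_on_def)
  then show ?thesis
    using conn_cong[OF conn_D assms(1-3,3,4) _ assms(5)] conn_cong[OF conn_nab assms(1-3,3,4) _ assms(5)]
    by (simp add: \<gamma>_apply fun_eq_iff)
qed

definition C :: "'m vfield \<Rightarrow> 'm vfield \<Rightarrow> 'm vfield \<Rightarrow> 'm \<Rightarrow> real" where
  "C X Y Z = gm (\<gamma> X Y) Z"

lemma C_smooth: "X \<in> vfs \<Longrightarrow> Y \<in> vfs \<Longrightarrow> Z \<in> vfs \<Longrightarrow> smf (C X Y Z)"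
  unfolding C_def by (intro gm_smooth \<gamma>_smooth)

lemma C_sym12: "X \<in> vfs \<Longrightarrow> Y \<in> vfs \<Longrightarrow> Z \<in> vfs \<Longrightarrow> p \<in> U \<Longrightarrow> C X Y Z p = C Y X Z p"
  by (simp add: C_def metric_pair_def \<gamma>_sym[of X Y])

lemma C_sym23:
  assumes "X \<in> vfs" "Y \<in> vfs" "Z \<in> vfs" "p \<in> U"
  shows "C X Y Z p = C X Z Y p"
proof -
  have "gm (\<gamma> X Y) Z p = gm Y (\<gamma> X Z) p"
    using \<gamma>_self_adjoint[unfolded is_metric_adjoint_def, THEN spec, THEN mp, OF U, THEN conjunct2] assms
    by blast
  then show ?thesis using assms by (simp add: C_def gm_sym[of Y] \<gamma>_smooth)
qed

lemma C_sym13: "X \<in> vfs \<Longrightarrow> Y \<in> vfs \<Longrightarrow> Z \<in> vfs \<Longrightarrow> p \<in> U \<Longrightarrow> C X Y Z p = C Z Y X p"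
  by (metis C_sym12 C_sym23)

text \<open>Linearity over the smooth functions on \<open>U\<close> characterises tensors. Since
  vector fields are total functions, a third clause is added: only the values of the field on
  \<open>U\<close> count.\<close>

definition tensorial :: "('m vfield \<Rightarrow> 'm \<Rightarrow> real) \<Rightarrow> bool" where
  "tensorial \<phi> \<longleftrightarrow>
    (\<forall>X\<in>vfs. \<forall>Y\<in>vfs. \<forall>p\<in>U. \<phi> (vf_add X Y) p = \<phi> X p + \<phi> Y p) \<and>
    (\<forall>X\<in>vfs. \<forall>h. smf h \<longrightarrow> (\<forall>p\<in>U. \<phi> (vf_scale h X) p = h p * \<phi> X p)) \<and>
    (\<forall>X\<in>vfs. \<forall>Y\<in>vfs. vf_eq_on U X Y \<longrightarrow> (\<forall>p\<in>U. \<phi> X p = \<phi> Y p))"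

lemma tensorialD:
  assumes "tensorial \<phi>"
  shows "X \<in> vfs \<Longrightarrow> Y \<in> vfs \<Longrightarrow> p \<in> U \<Longrightarrow> \<phi> (vf_add X Y) p = \<phi> X p + \<phi> Y p"
    and "X \<in> vfs \<Longrightarrow> smf h \<Longrightarrow> p \<in> U \<Longrightarrow> \<phi> (vf_scale h X) p = h p * \<phi> X p"
    and "X \<in> vfs \<Longrightarrow> Y \<in> vfs \<Longrightarrow> vf_eq_on U X Y \<Longrightarrow> p \<in> U \<Longrightarrow> \<phi> X p = \<phi> Y p"
  using assms unfolding tensorial_def by blast+

lemma tensorial_diff:
  assumes "tensorial \<phi>" "X \<in> vfs" "Y \<in> vfs" "p \<in> U"
  shows "\<phi> (vf_diff X Y) p = \<phi> X p - \<phi> Y p"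
  using tensorialD(1)[OF assms(1,2) smooth_vf_scale[OF assms(3) smooth_fun_const] assms(4), of "-1"]
    tensorialD(2)[OF assms(1,3) smooth_fun_const assms(4), of "-1"]
  by (simp add: vf_diff_eq)

lemma tensorial_diff_cong:
  assumes "tensorial \<phi>" "X \<in> vfs" "Y \<in> vfs" "Z \<in> vfs" "\<And>q. q \<in> U \<Longrightarrow> Z q = vf_diff X Y q" "p \<in> U"
  shows "\<phi> Z p = \<phi> X p - \<phi> Y p"
  using tensorialD(3)[OF assms(1,4) smooth_vf_diff[OF assms(2,3)] _ assms(6)] assms(5)
    tensorial_diff[OF assms(1-3,6)] by (simp add: vf_eq_on_def)

lemma tensorial_lincomb:
  assumes \<phi>: "tensorial \<phi>" and p: "p \<in> U" and "finite I"
    and X: "\<And>i. i \<in> I \<Longrightarrow> X i \<in> vfs" and h: "\<And>i. i \<in> I \<Longrightarrow> smf (h i)" and ne: "I \<noteq> {}"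
  shows "\<phi> (\<lambda>p f. \<Sum>i\<in>I. h i p * X i p f) p = (\<Sum>i\<in>I. h i p * \<phi> (X i) p)"
  using assms(3) ne X h
proof (induction I rule: finite_ne_induct)
  case (singleton i)
  then show ?case using tensorialD(2)[OF \<phi>, of "X i" "h i" p] p by (simp add: vf_scale_def)
next
  case (insert i I)
  let ?Y = "\<lambda>p f. \<Sum>i\<in>I. h i p * X i p f"
  have Y: "?Y \<in> vfs" by (rule smooth_vf_sum[OF U]) (use insert in auto)
  have "(\<lambda>p f. \<Sum>i\<in>insert i I. h i p * X i p f) = vf_add (vf_scale (h i) (X i)) ?Y"
    using insert by (simp add: vf_add_def vf_scale_def)
  then show ?case
    using insert Y tensorialD(1)[OF \<phi> smooth_vf_scale Y p, of "X i" "h i"] tensorialD(2)[OF \<phi>, of "X i" "h i" p] p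
    by simp
qed

lemma frame_expand:
  assumes "orthonormal_frame M A g U E" "Y \<in> vfs" "p \<in> U"
  shows "Y p = (\<lambda>f. \<Sum>i\<in>UNIV. gm Y (E i) p * E i p f)"
  using orthonormal_expand[OF mem_topspace[OF assms(3)], of "\<lambda>i. E i p" "Y p"] assms
  by (simp add: orthonormal_frame_def metric_pair_def vf_tangent)

text \<open>Turns linearity over functions into a pointwise statement: at \<open>p\<close>, the
  value depends on \<open>Y\<close> only through its frame components at \<open>p\<close>.\<close>

lemma tensorial_expand:
  assumes E: "orthonormal_frame M A g U E" and \<phi>: "tensorial \<phi>" and Y: "Y \<in> vfs" and p: "p \<in> U"
  shows "\<phi> Y p = (\<Sum>i\<in>UNIV. gm Y (E i) p * \<phi> (E i) p)"
proof -
  let ?Y = "\<lambda>p f. \<Sum>i\<in>UNIV. gm Y (E i) p * E i p f"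
  have Ei: "\<And>i. E i \<in> vfs" using E by (simp add: orthonormal_frame_def)
  have Y': "?Y \<in> vfs" by (rule smooth_vf_sum[OF U Ei gm_smooth[OF Y Ei]])
  have "\<phi> Y p = \<phi> ?Y p"
    by (rule tensorialD(3)[OF \<phi> Y Y' _ p]) (simp add: vf_eq_on_def frame_expand[OF E Y, symmetric])
  also have "\<dots> = (\<Sum>i\<in>UNIV. gm Y (E i) p * \<phi> (E i) p)"
    by (rule tensorial_lincomb[OF \<phi> p _ Ei gm_smooth[OF Y Ei]]) auto
  finally show ?thesis .
qed

lemma gm_tensorial: "Z \<in> vfs \<Longrightarrow> tensorial (\<lambda>X. gm X Z)"
  unfolding tensorial_def
  by (intro conjI ballI allI impI) (simp_all add: gm_add gm_scale vf_eq_on_def, simp add: metric_pair_def)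

text \<open>The sum is the squared norm of a covector at \<open>p\<close>. Expanding
  \<open>E j\<close> in the frame \<open>E'\<close> shows that the transition matrix
  \<open>a\<close> is orthogonal.\<close>

lemma parseval:
  assumes E: "orthonormal_frame M A g U E" and E': "orthonormal_frame M A g U E'"
    and \<phi>: "tensorial \<phi>" and p: "p \<in> U"
  shows "(\<Sum>i\<in>UNIV. (\<phi> (E' i) p)\<^sup>2) = (\<Sum>i\<in>UNIV. (\<phi> (E i) p)\<^sup>2)"
proof -
  have Ei: "\<And>i. E i \<in> vfs" "\<And>i. E' i \<in> vfs" using E E' by (simp_all add: orthonormal_frame_def)
  define a where "a i j = gm (E' i) (E j) p" for i j
  have orth: "(\<Sum>i\<in>UNIV. a i j * a i k) = (if j = k then 1 else 0)" for j k
  proof -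
    have "gm (E j) (E k) p = (\<Sum>i\<in>UNIV. gm (E j) (E' i) p * gm (E' i) (E k) p)"
      by (rule tensorial_expand[OF E' gm_tensorial[OF Ei(1)] Ei(1) p])
    then show ?thesis using E p gm_sym[OF Ei p] by (simp add: a_def orthonormal_frame_def)
  qed
  have ex: "\<phi> (E' i) p = (\<Sum>j\<in>UNIV. a i j * \<phi> (E j) p)" for i
    unfolding a_def by (rule tensorial_expand[OF E \<phi> Ei(2) p])
  have "(\<Sum>i\<in>UNIV. (\<phi> (E' i) p)\<^sup>2) =
      (\<Sum>i\<in>UNIV. \<Sum>j\<in>UNIV. \<Sum>k\<in>UNIV. (a i j * a i k) * (\<phi> (E j) p * \<phi> (E k) p))"
    unfolding ex power2_eq_square sum_product by (simp add: mult_ac)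
  also have "\<dots> = (\<Sum>j\<in>UNIV. \<Sum>k\<in>UNIV. \<Sum>i\<in>UNIV. (a i j * a i k) * (\<phi> (E j) p * \<phi> (E k) p))"
    by (subst sum.swap, rule sum.cong[OF refl], rule sum.swap)
  also have "\<dots> = (\<Sum>j\<in>UNIV. (\<phi> (E j) p)\<^sup>2)"
    by (simp add: sum_distrib_right[symmetric] orth if_distrib[of "\<lambda>x. x * _"] power2_eq_square cong: if_cong)
  finally show ?thesis .
qed

lemma C_tensorial:
  assumes Y: "Y \<in> vfs" and Z: "Z \<in> vfs"
  shows "tensorial (\<lambda>X. C X Y Z)"
  unfolding tensorial_def C_def
proof (intro conjI ballI allI impI)
  fix X X' p h assume X: "X \<in> vfs" and p: "p \<in> U"
  note \<gamma>X = \<gamma>_smooth[OF X Y]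
  show "gm (\<gamma> (vf_add X X') Y) Z p = gm (\<gamma> X Y) Z p + gm (\<gamma> X' Y) Z p" if "X' \<in> vfs"
    using gm_add[OF \<gamma>X \<gamma>_smooth[OF that Y] Z p] by (simp add: metric_pair_def \<gamma>_add1[OF X that Y p])
  show "gm (\<gamma> (vf_scale h X) Y) Z p = h p * gm (\<gamma> X Y) Z p" if "smf h"
    using gm_scale[OF \<gamma>X Z p] by (simp add: metric_pair_def \<gamma>_scale1[OF X Y that p])
  show "gm (\<gamma> X Y) Z p = gm (\<gamma> X' Y) Z p" if "X' \<in> vfs" "vf_eq_on U X X'"
    by (simp add: metric_pair_def \<gamma>_cong[OF X that(1) Y that(2) p])
qed

section \<open>The curvature of the Levi-Civita connection\<close>

definition R :: "'m vfield \<Rightarrow> 'm vfield \<Rightarrow> 'm vfield \<Rightarrow> 'm vfield" where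
  "R = curvature M A D"

lemma R_smooth: "X \<in> vfs \<Longrightarrow> Y \<in> vfs \<Longrightarrow> Z \<in> vfs \<Longrightarrow> R X Y Z \<in> vfs"
  unfolding R_def curvature_def by (intro smooth_vf_diff D_smooth bracket_smooth)

lemma D_bracket:
  assumes "is_connection M A K" "torsionless M A K'" "is_connection M A K'"
    "X \<in> vfs" "Y \<in> vfs" "Z \<in> vfs" "p \<in> U"
  shows "K (lie_bracket M A X Y) Z p = vf_diff (K (K' X Y) Z) (K (K' Y X) Z) p"
proof -
  have K': "K' X Y \<in> vfs" "K' Y X \<in> vfs" using assms by (simp_all add: conn_smooth[OF assms(3)])
  have "K (lie_bracket M A X Y) Z p = K (vf_diff (K' X Y) (K' Y X)) Z p"
    by (rule conn_cong[OF assms(1) bracket_smooth[OF assms(4,5)] smooth_vf_diff[OF K'] assms(6,6) _ _ assms(7)])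
      (simp_all add: vf_eq_on_def bracket_eq[OF assms(2,4,5)])
  then show ?thesis using conn_diff1[OF assms(1) K' assms(6,7)] by simp
qed

text \<open>The bracket is replaced by \<open>D X Y\<close> and \<open>D Y X\<close>, so that
  curvature identities become linear identities between iterated covariant derivatives. \<phi> will
  be a pairing with a fixed field or a slot of \<open>C\<close>.\<close>

lemma R_tensorial_apply:
  assumes \<phi>: "tensorial \<phi>" and XYZ: "X \<in> vfs" "Y \<in> vfs" "Z \<in> vfs" and p: "p \<in> U"
  shows "\<phi> (R X Y Z) p =
    \<phi> (D X (D Y Z)) p - \<phi> (D Y (D X Z)) p - (\<phi> (D (D X Y) Z) p - \<phi> (D (D Y X) Z) p)"
proof -
  note s = D_smooth smooth_vf_diff bracket_smooth XYZ
  have "\<phi> (D (lie_bracket M A X Y) Z) p = \<phi> (D (D X Y) Z) p - \<phi> (D (D Y X) Z) p"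
    by (rule tensorial_diff_cong[OF \<phi> _ _ _ D_bracket[OF conn_D torsionless_D conn_D XYZ] p]) (intro s)+
  moreover have "\<phi> (R X Y Z) p = \<phi> (vf_diff (D X (D Y Z)) (D Y (D X Z))) p - \<phi> (D (lie_bracket M A X Y) Z) p"
    unfolding R_def curvature_def by (rule tensorial_diff[OF \<phi> _ _ p]) (intro s)+
  moreover have "\<phi> (vf_diff (D X (D Y Z)) (D Y (D X Z))) p = \<phi> (D X (D Y Z)) p - \<phi> (D Y (D X Z)) p"
    by (rule tensorial_diff[OF \<phi> _ _ p]) (intro s)+
  ultimately show ?thesis by simp
qed

end

section \<open>Covariant derivatives of the cubic form; Gauss, Codazzi and Ricci identities\<close>

context patch
begin

text \<open>The covariant derivatives \<open>D C\<close> and \<open>D\<^sup>2 C\<close>; the differentiating fields come first.\<close>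

definition cov_C :: "'m vfield \<Rightarrow> 'm vfield \<Rightarrow> 'm vfield \<Rightarrow> 'm vfield \<Rightarrow> 'm \<Rightarrow> real" where
  "cov_C W X Y Z = (\<lambda>p. W p (C X Y Z) - C (D W X) Y Z p - C X (D W Y) Z p - C X Y (D W Z) p)"

definition cov2_C :: "'m vfield \<Rightarrow> 'm vfield \<Rightarrow> 'm vfield \<Rightarrow> 'm vfield \<Rightarrow> 'm vfield \<Rightarrow> 'm \<Rightarrow> real" where
  "cov2_C V W X Y Z = (\<lambda>p. V p (cov_C W X Y Z) - cov_C (D V W) X Y Z p
     - cov_C W (D V X) Y Z p - cov_C W X (D V Y) Z p - cov_C W X Y (D V Z) p)"

lemma cov_C_smooth:
  assumes "W \<in> vfs" "X \<in> vfs" "Y \<in> vfs" "Z \<in> vfs"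
  shows "smf (cov_C W X Y Z)"
  unfolding cov_C_def
  by (intro smooth_fun_diff[OF U] der_smooth[OF assms(1)] C_smooth D_smooth assms)

lemma cov_C_sym23:
  assumes "W \<in> vfs" "X \<in> vfs" "Y \<in> vfs" "Z \<in> vfs" "p \<in> U"
  shows "cov_C W X Y Z p = cov_C W Y X Z p"
proof -
  have "W p (C X Y Z) = W p (C Y X Z)"
    by (rule der_cong[OF assms(1,5) C_sym12[OF assms(2-4)]])
  then show ?thesis
    using C_sym12[OF D_smooth[OF assms(1,2)] assms(3,4,5)] C_sym12[OF assms(2) D_smooth[OF assms(1,3)] assms(4,5)]
      C_sym12[OF assms(2,3) D_smooth[OF assms(1,4)] assms(5)]
    by (simp add: cov_C_def)
qed

lemma cov_C_sym34:
  assumes "W \<in> vfs" "X \<in> vfs" "Y \<in> vfs" "Z \<in> vfs" "p \<in> U"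
  shows "cov_C W X Y Z p = cov_C W X Z Y p"
proof -
  have "W p (C X Y Z) = W p (C X Z Y)"
    by (rule der_cong[OF assms(1,5) C_sym23[OF assms(2-4)]])
  then show ?thesis
    using C_sym23[OF D_smooth[OF assms(1,2)] assms(3,4,5)] C_sym23[OF assms(2) D_smooth[OF assms(1,3)] assms(4,5)]
      C_sym23[OF assms(2,3) D_smooth[OF assms(1,4)] assms(5)]
    by (simp add: cov_C_def)
qed

text \<open>Differentiate the function \<open>gm Z V\<close> along \<open>Y\<close> and then
  \<open>X\<close>, and antisymmetrise. The mixed terms with one derivative on each factor are
  symmetric in \<open>X, Y\<close> and cancel; the bracket derivative absorbs the terms with
  \<open>D X Y\<close> and \<open>D Y X\<close>.\<close>

lemma R_skew:
  assumes "X \<in> vfs" "Y \<in> vfs" "Z \<in> vfs" "V \<in> vfs" "p \<in> U"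
  shows "gm (R X Y Z) V p = - gm (R X Y V) Z p"
proof -
  have DD: "X p (\<lambda>q. Y q (gm Z V)) = gm (D X (D Y Z)) V p + gm (D Y Z) (D X V) p
      + gm (D X Z) (D Y V) p + gm Z (D X (D Y V)) p"
    if X: "X \<in> vfs" and Y: "Y \<in> vfs" for X Y
  proof -
    have "X p (\<lambda>q. Y q (gm Z V)) = X p (\<lambda>q. gm (D Y Z) V q + gm Z (D Y V) q)"
      by (rule der_cong[OF X assms(5)]) (simp add: D_metric[OF Y assms(3,4)])
    also have "\<dots> = X p (gm (D Y Z) V) + X p (gm Z (D Y V))"
      by (rule der_add[OF X assms(5)]) (intro gm_smooth D_smooth assms Y)+
    finally show ?thesis
      using D_metric[OF X D_smooth[OF Y assms(3)] assms(4,5)] D_metric[OF X assms(3) D_smooth[OF Y assms(4)] assms(5)]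
      by simp
  qed
  note s = D_smooth assms(1-4)
  have LB: "D X Y p (gm Z V) - D Y X p (gm Z V) = X p (\<lambda>q. Y q (gm Z V)) - Y p (\<lambda>q. X q (gm Z V))"
    by (rule bracket_apply[OF assms(1,2,5) gm_smooth[OF assms(3,4)]])
  have mZ: "gm Z (D X (D Y V)) p = gm (D X (D Y V)) Z p" "gm Z (D Y (D X V)) p = gm (D Y (D X V)) Z p"
    "gm Z (D (D X Y) V) p = gm (D (D X Y) V) Z p" "gm Z (D (D Y X) V) p = gm (D (D Y X) V) Z p"
    by (rule gm_sym[OF assms(3) _ assms(5)], intro s)+
  show ?thesis
    using DD[OF assms(1,2)] DD[OF assms(2,1)] LB mZ
      D_metric[OF D_smooth[OF assms(1,2)] assms(3,4,5)] D_metric[OF D_smooth[OF assms(2,1)] assms(3,4,5)]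
      R_tensorial_apply[OF gm_tensorial[OF assms(4)] assms(1-3,5)]
      R_tensorial_apply[OF gm_tensorial[OF assms(3)] assms(1,2,4,5)]
    by linarith
qed

text \<open>Both sides are the pairing of \<open>\<gamma> Y Z\<close> with
  \<open>\<gamma> X V\<close>. Exchanging \<open>Z\<close> and \<open>V\<close> thus exchanges the
  two products in the commutator of \<open>\<gamma> X\<close> and \<open>\<gamma> Y\<close>, which
  is why the commutator is skew.\<close>

lemma C_\<gamma>_swap:
  assumes "X \<in> vfs" "Y \<in> vfs" "Z \<in> vfs" "V \<in> vfs" "p \<in> U"
  shows "C X (\<gamma> Y Z) V p = C Y (\<gamma> X V) Z p"
proof -
  note s = \<gamma>_smooth assms(1-4)
  have "C X (\<gamma> Y Z) V p = C X V (\<gamma> Y Z) p" by (rule C_sym23[OF _ _ _ assms(5)]) (intro s)+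
  also have "\<dots> = gm (\<gamma> Y Z) (\<gamma> X V) p" unfolding C_def by (rule gm_sym[OF _ _ assms(5)]) (intro s)+
  also have "\<dots> = C Y (\<gamma> X V) Z p" unfolding C_def[symmetric] by (rule C_sym23[OF _ _ _ assms(5)]) (intro s)+
  finally show ?thesis .
qed

lemma nab_tensorial:
  assumes "tensorial \<phi>" "X \<in> vfs" "Y \<in> vfs" "p \<in> U"
  shows "\<phi> (nab X Y) p = \<phi> (D X Y) p - \<phi> (\<gamma> X Y) p"
  by (rule tensorial_diff_cong[OF assms(1) D_smooth[OF assms(2,3)] \<gamma>_smooth[OF assms(2,3)]
        conn_smooth[OF conn_nab assms(2,3)] _ assms(4)])
    (simp add: vf_diff_def \<gamma>_apply)

text \<open>Expansion of \<open>nab = D - \<gamma>\<close> in both places. Metric compatibility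
  rewrites the pairing of \<open>D X (\<gamma> Y Z)\<close> with \<open>V\<close> as a derivative of
  \<open>C\<close>, so that \<open>cov_C\<close> can be assembled after antisymmetrising in
  \<open>X, Y\<close>.\<close>

lemma gm_nab_nab:
  assumes "X \<in> vfs" "Y \<in> vfs" "Z \<in> vfs" "V \<in> vfs" "p \<in> U"
  shows "gm (nab X (nab Y Z)) V p = gm (D X (D Y Z)) V p - (X p (C Y Z V) - C Y Z (D X V) p)
    - C X (D Y Z) V p + C X (\<gamma> Y Z) V p"
proof -
  note s = conn_smooth[OF conn_nab] D_smooth \<gamma>_smooth assms(1-4)
  note t = gm_tensorial[OF assms(4)]
  have 1: "gm (nab X (nab Y Z)) V p = gm (D X (nab Y Z)) V p - gm (\<gamma> X (nab Y Z)) V p"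
    by (rule nab_tensorial[OF t _ _ assms(5)]) (intro s)+
  have "D X (nab Y Z) q = vf_diff (D X (D Y Z)) (D X (\<gamma> Y Z)) q" if q: "q \<in> U" for q
  proof -
    have "D X (nab Y Z) q = D X (vf_diff (D Y Z) (\<gamma> Y Z)) q"
      by (rule conn_cong[OF conn_D _ _ _ _ _ _ q]) (auto intro!: s smooth_vf_diff simp: vf_eq_on_def vf_diff_def \<gamma>_apply)
    then show ?thesis using conn_diff2[OF conn_D assms(1) D_smooth[OF assms(2,3)] \<gamma>_smooth[OF assms(2,3)] q] by simp
  qed
  then have 2: "gm (D X (nab Y Z)) V p = gm (D X (D Y Z)) V p - gm (D X (\<gamma> Y Z)) V p"
    by (intro tensorial_diff_cong[OF t _ _ _ _ assms(5)] s)
  have 3: "X p (C Y Z V) = gm (D X (\<gamma> Y Z)) V p + C Y Z (D X V) p"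
    unfolding C_def by (rule D_metric[OF assms(1) _ assms(4,5)]) (intro s)
  have 4: "C (nab Y Z) X V p = C (D Y Z) X V p - C (\<gamma> Y Z) X V p"
    by (rule nab_tensorial[OF C_tensorial[OF assms(1,4)] assms(2,3,5)])
  have 5: "C X (nab Y Z) V p = C (nab Y Z) X V p" "C X (D Y Z) V p = C (D Y Z) X V p"
    "C X (\<gamma> Y Z) V p = C (\<gamma> Y Z) X V p"
    by (rule C_sym12[OF assms(1) _ assms(4,5)], intro s)+
  show ?thesis using 1 2 3 4 5 by (simp add: C_def[of X "nab Y Z"])
qed

lemma flatness:
  assumes "X \<in> vfs" "Y \<in> vfs" "Z \<in> vfs" "V \<in> vfs" "p \<in> U"
  shows "gm (R X Y Z) V p + (C X (\<gamma> Y Z) V p - C Y (\<gamma> X Z) V p) = cov_C X Y Z V p - cov_C Y X Z V p"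
proof -
  note s = conn_smooth[OF conn_nab] D_smooth \<gamma>_smooth bracket_smooth smooth_vf_diff assms(1-4)
  note t = gm_tensorial[OF assms(4)]
  let ?L = "lie_bracket M A X Y"
  have "curvature M A nab X Y Z p = vf_zero p"
    using flat_nab[unfolded flat_def vf_eq_on_def, THEN spec, THEN mp, OF U] assms by blast
  then have "gm (curvature M A nab X Y Z) V p = 0"
    using g_zero[OF mem_topspace[OF assms(5)] vf_tangent[OF assms(4,5)]] by (simp add: metric_pair_def vf_zero_def)
  moreover have "gm (curvature M A nab X Y Z) V p
      = gm (vf_diff (nab X (nab Y Z)) (nab Y (nab X Z))) V p - gm (nab ?L Z) V p"
    unfolding curvature_def by (rule gm_diff[OF _ _ assms(4,5)]) (intro s)+
  moreover have "gm (vf_diff (nab X (nab Y Z)) (nab Y (nab X Z))) V p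
      = gm (nab X (nab Y Z)) V p - gm (nab Y (nab X Z)) V p"
    by (rule gm_diff[OF _ _ assms(4,5)]) (intro s)+
  moreover have "gm (nab ?L Z) V p = gm (D ?L Z) V p - C ?L Z V p"
    unfolding C_def by (rule nab_tensorial[OF t _ assms(3,5)]) (intro s)
  \<comment> \<open>These are the terms of \<open>cov_C X Y Z V\<close> and
    \<open>cov_C Y X Z V\<close> in which the first argument of \<open>C\<close> is differentiated;
    they come from the bracket term of the curvature.\<close>
  moreover have "C ?L Z V p = C (D X Y) Z V p - C (D Y X) Z V p"
    by (rule tensorial_diff_cong[OF C_tensorial[OF assms(3,4)] _ _ _ bracket_eq[OF torsionless_D assms(1,2)] assms(5)])
      (intro s)+
  moreover have "gm (D ?L Z) V p = gm (D (D X Y) Z) V p - gm (D (D Y X) Z) V p"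
    by (rule tensorial_diff_cong[OF t _ _ _ D_bracket[OF conn_D torsionless_D conn_D assms(1-3)] assms(5)]) (intro s)+
  ultimately show ?thesis
    using gm_nab_nab[OF assms] gm_nab_nab[OF assms(2,1,3-5)] R_tensorial_apply[OF t assms(1-3,5)]
    by (simp add: cov_C_def)
qed

text \<open>Both sides of \<open>flatness\<close> vanish: the left one is skew in \<open>Z, V\<close>, the right one symmetric.\<close>

lemma gauss_codazzi:
  assumes "X \<in> vfs" "Y \<in> vfs" "Z \<in> vfs" "V \<in> vfs" "p \<in> U"
  shows "gm (R X Y Z) V p = C Y (\<gamma> X Z) V p - C X (\<gamma> Y Z) V p"
    and "cov_C X Y Z V p = cov_C Y X Z V p"
  using flatness[OF assms] flatness[OF assms(1,2,4,3,5)] R_skew[OF assms]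
    C_\<gamma>_swap[OF assms] C_\<gamma>_swap[OF assms(2,1,3,4,5)]
    cov_C_sym34[OF assms] cov_C_sym34[OF assms(2,1,3,4,5)]
  by linarith+

lemma cov_C_tensorial1:
  assumes XYZ: "X \<in> vfs" "Y \<in> vfs" "Z \<in> vfs"
  shows "tensorial (\<lambda>W. cov_C W X Y Z)"
proof -
  \<comment> \<open>Total symmetry of \<open>C\<close> moves the differentiated argument to the
    front, so tensoriality of \<open>C\<close> in its first slot serves all three correction
    terms.\<close>
  have slots: "C X (D W Y) Z p = C (D W Y) X Z p" "C X Y (D W Z) p = C (D W Z) Y X p"
    if "W \<in> vfs" "p \<in> U" for W p
    by (rule C_sym12[OF XYZ(1) D_smooth[OF that(1) XYZ(2)] XYZ(3) that(2)]
        C_sym13[OF XYZ(1,2) D_smooth[OF that(1) XYZ(3)] that(2)])+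
  have add: "C (D (vf_add V W) X) Y Z p = C (D V X) Y Z p + C (D W X) Y Z p"
    if "V \<in> vfs" "W \<in> vfs" "p \<in> U" "X \<in> vfs" "Y \<in> vfs" "Z \<in> vfs" for V W X Y Z p
  proof -
    note s = D_smooth smooth_vf_add that
    have "C (D (vf_add V W) X) Y Z p = C (vf_add (D V X) (D W X)) Y Z p"
      by (rule tensorialD(3)[OF C_tensorial[OF that(5,6)] _ _ _ that(3)])
        (auto simp: vf_eq_on_def conn_add1[OF conn_D that(1,2,4)] intro!: s)
    then show ?thesis
      using tensorialD(1)[OF C_tensorial[OF that(5,6)] D_smooth[OF that(1,4)] D_smooth[OF that(2,4)] that(3)] by simp
  qed
  have scale: "C (D (vf_scale h W) X) Y Z p = h p * C (D W X) Y Z p"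
    if "W \<in> vfs" "smf h" "p \<in> U" "X \<in> vfs" "Y \<in> vfs" "Z \<in> vfs" for h W X Y Z p
  proof -
    note s = D_smooth smooth_vf_scale that
    have "C (D (vf_scale h W) X) Y Z p = C (vf_scale h (D W X)) Y Z p"
      by (rule tensorialD(3)[OF C_tensorial[OF that(5,6)] _ _ _ that(3)])
        (auto simp: vf_eq_on_def conn_scale1[OF conn_D that(1,4,2)] intro!: s)
    then show ?thesis
      using tensorialD(2)[OF C_tensorial[OF that(5,6)] D_smooth[OF that(1,4)] that(2,3)] by simp
  qed
  have cong: "C (D V X) Y Z p = C (D W X) Y Z p"
    if "V \<in> vfs" "W \<in> vfs" "p \<in> U" "X \<in> vfs" "Y \<in> vfs" "Z \<in> vfs" "vf_eq_on U V W" for V W X Y Z p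
  proof (rule tensorialD(3)[OF C_tensorial[OF that(5,6)] D_smooth[OF that(1,4)] D_smooth[OF that(2,4)] _ that(3)])
    have "vf_eq_on U X X" by (simp add: vf_eq_on_def)
    then show "vf_eq_on U (D V X) (D W X)"
      using conn_cong[OF conn_D that(1,2,4,4,7)] by (simp add: vf_eq_on_def)
  qed
  show ?thesis
    unfolding tensorial_def
  proof (intro conjI ballI allI impI)
    fix V W p assume V: "V \<in> vfs" and W: "W \<in> vfs" and p: "p \<in> U"
    show "cov_C (vf_add V W) X Y Z p = cov_C V X Y Z p + cov_C W X Y Z p"
      using V W p XYZ by (simp add: cov_C_def slots smooth_vf_add add) (simp add: vf_add_def)
    show "cov_C V X Y Z p = cov_C W X Y Z p" if "vf_eq_on U V W"
    proof -
      have "V p = W p" using that p by (simp add: vf_eq_on_def)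
      then show ?thesis
        using cong[OF V W p XYZ that] cong[OF V W p XYZ(2,1,3) that] cong[OF V W p XYZ(3,2,1) that]
          slots[OF V p] slots[OF W p] by (simp add: cov_C_def)
    qed
  next
    fix W h p assume "W \<in> vfs" "smf h" "p \<in> U"
    then show "cov_C (vf_scale h W) X Y Z p = h p * cov_C W X Y Z p"
      using XYZ by (simp add: cov_C_def slots smooth_vf_scale scale) (simp add: vf_scale_def algebra_simps)
  qed
qed

lemma tensorial_transfer:
  assumes "tensorial \<phi>" "\<And>X p. X \<in> vfs \<Longrightarrow> p \<in> U \<Longrightarrow> \<psi> X p = \<phi> X p"
  shows "tensorial \<psi>"
  unfolding tensorial_def
  using tensorialD[OF assms(1)] assms(2) smooth_vf_add smooth_vf_scale by simp

text \<open>The Codazzi equation exchanges this slot with the differentiating one, where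
  tensoriality is already known. The cancellation of derivatives of coefficients need not be
  computed.\<close>

lemma cov_C_tensorial2:
  assumes "W \<in> vfs" "Y \<in> vfs" "Z \<in> vfs"
  shows "tensorial (\<lambda>X. cov_C W X Y Z)"
  by (rule tensorial_transfer[OF cov_C_tensorial1[OF assms]])
    (use assms in \<open>simp add: gauss_codazzi(2)\<close>)

lemma cov2_C_sym23:
  assumes "V \<in> vfs" "W \<in> vfs" "X \<in> vfs" "Y \<in> vfs" "Z \<in> vfs" "p \<in> U"
  shows "cov2_C V W X Y Z p = cov2_C V X W Y Z p"
proof -
  have "V p (cov_C W X Y Z) = V p (cov_C X W Y Z)"
    by (rule der_cong[OF assms(1,6) gauss_codazzi(2)[OF assms(2-5)]])
  then show ?thesis
    using gauss_codazzi(2)[of "D V W" X Y Z p] gauss_codazzi(2)[of W "D V X" Y Z p]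
      gauss_codazzi(2)[of W X "D V Y" Z p] gauss_codazzi(2)[of W X Y "D V Z" p] assms
    by (simp add: cov2_C_def D_smooth)
qed

lemma cov2_C_sym34:
  assumes "V \<in> vfs" "W \<in> vfs" "X \<in> vfs" "Y \<in> vfs" "Z \<in> vfs" "p \<in> U"
  shows "cov2_C V W X Y Z p = cov2_C V W Y X Z p"
proof -
  have "V p (cov_C W X Y Z) = V p (cov_C W Y X Z)"
    by (rule der_cong[OF assms(1,6) cov_C_sym23[OF assms(2-5)]])
  then show ?thesis
    using cov_C_sym23[of "D V W" X Y Z p] cov_C_sym23[of W "D V X" Y Z p]
      cov_C_sym23[of W X "D V Y" Z p] cov_C_sym23[of W X Y "D V Z" p] assms
    by (simp add: cov2_C_def D_smooth)
qed

text \<open>Ricci identity: the curvature acts as a derivation on the three slots. Terms with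
  derivatives on two different arguments, and those with one derivative on \<open>C\<close> and one
  on an argument, are symmetric in \<open>V, W\<close> and cancel. The remaining derivatives of the
  function \<open>C X Y Z\<close> are absorbed by the bracket.\<close>

lemma cov2_C_commute:
  assumes V: "V \<in> vfs" and W: "W \<in> vfs" and X: "X \<in> vfs" and Y: "Y \<in> vfs" and Z: "Z \<in> vfs" and p: "p \<in> U"
  shows "cov2_C V W X Y Z p - cov2_C W V X Y Z p =
    - (C (R V W X) Y Z p + C X (R V W Y) Z p + C X Y (R V W Z) p)"
proof -
  have der: "V p (cov_C W X Y Z) = V p (\<lambda>q. W q (C X Y Z)) - V p (C (D W X) Y Z)
      - V p (C X (D W Y) Z) - V p (C X Y (D W Z))" if V: "V \<in> vfs" and W: "W \<in> vfs" for V W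
  proof -
    note s = C_smooth D_smooth V W X Y Z
    have s0: "smf (\<lambda>q. W q (C X Y Z))" by (rule der_smooth[OF W C_smooth[OF X Y Z]])
    have s1: "smf (C (D W X) Y Z)" "smf (C X (D W Y) Z)" "smf (C X Y (D W Z))" by (intro s)+
    show ?thesis
      unfolding cov_C_def
      by (simp add: der_diff[OF V p] s0 s1 smooth_fun_diff[OF U])
  qed
  have R1: "C (R V W X') Y' Z' p = C (D V (D W X')) Y' Z' p - C (D W (D V X')) Y' Z' p
      - (C (D (D V W) X') Y' Z' p - C (D (D W V) X') Y' Z' p)"
    if "X' \<in> vfs" "Y' \<in> vfs" "Z' \<in> vfs" for X' Y' Z'
    by (rule R_tensorial_apply[OF C_tensorial[OF that(2,3)] V W that(1) p])
  note s = D_smooth V W X Y Z R_smooth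
  have sl2: "C X Q Z p = C Q X Z p" and sl3: "C X Y Q p = C Q X Y p" if "Q \<in> vfs" for Q
    using that X Y Z p by (metis C_sym12 C_sym23)+
  have R2: "C X (R V W Y) Z p = C X (D V (D W Y)) Z p - C X (D W (D V Y)) Z p
      - (C X (D (D V W) Y) Z p - C X (D (D W V) Y) Z p)"
    using R1[OF Y X Z] by (simp add: sl2 s)
  have R3: "C X Y (R V W Z) p = C X Y (D V (D W Z)) p - C X Y (D W (D V Z)) p
      - (C X Y (D (D V W) Z) p - C X Y (D (D W V) Z) p)"
    using R1[OF Z X Y] by (simp add: sl3 s)
  have LB: "D V W p (C X Y Z) - D W V p (C X Y Z) = V p (\<lambda>q. W q (C X Y Z)) - W p (\<lambda>q. V q (C X Y Z))"
    by (rule bracket_apply[OF V W p C_smooth[OF X Y Z]])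
  show ?thesis
    unfolding cov2_C_def der[OF V W] der[OF W V] R1[OF X Y Z] R2 R3
    using LB by (simp add: cov_C_def)
qed

end

section \<open>The Bochner argument\<close>

lemma sum_mult_swap:
  fixes a :: "'a \<Rightarrow> real"
  shows "(\<Sum>k\<in>K. a k * (\<Sum>l\<in>L. \<Sum>m\<in>N. b l m k)) = (\<Sum>l\<in>L. \<Sum>m\<in>N. \<Sum>k\<in>K. a k * b l m k)"
proof -
  have "(\<Sum>k\<in>K. a k * (\<Sum>l\<in>L. \<Sum>m\<in>N. b l m k)) = (\<Sum>k\<in>K. \<Sum>l\<in>L. \<Sum>m\<in>N. a k * b l m k)"
    by (simp add: sum_distrib_left)
  also have "\<dots> = (\<Sum>l\<in>L. \<Sum>k\<in>K. \<Sum>m\<in>N. a k * b l m k)" by (rule sum.swap)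
  also have "\<dots> = (\<Sum>l\<in>L. \<Sum>m\<in>N. \<Sum>k\<in>K. a k * b l m k)" by (intro sum.cong refl sum.swap)
  finally show ?thesis .
qed

text \<open>With the symmetric matrices \<open>G\<^sub>i = (c i j k)\<^sub>j\<^sub>k\<close>, the first curvature term contributes \<open>|\<Sum>G\<^sub>l\<^sup>2|\<^sup>2\<close> and
  each of the other two contributes \<open>\<Sum>|[G\<^sub>i, G\<^sub>l]|\<^sup>2 / 2\<close>.\<close>

lemma cubic_form_curvature_bound:
  fixes c :: "'n::finite \<Rightarrow> 'n \<Rightarrow> 'n \<Rightarrow> real" and \<rho> :: "'n \<Rightarrow> 'n \<Rightarrow> 'n \<Rightarrow> 'n \<Rightarrow> real"
  assumes s12: "\<And>i j k. c i j k = c j i k" and s23: "\<And>i j k. c i j k = c i k j"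
    and tr: "\<And>k. (\<Sum>l\<in>UNIV. c l l k) = 0"
    and \<rho>: "\<And>l i j m. \<rho> l i j m = (\<Sum>n\<in>UNIV. c l j n * c i n m) - (\<Sum>n\<in>UNIV. c i j n * c l n m)"
  shows "(\<Sum>a\<in>UNIV. \<Sum>b\<in>UNIV. (\<Sum>l\<in>UNIV. \<Sum>m\<in>UNIV. c a l m * c b l m)\<^sup>2) \<le>
    - (\<Sum>i\<in>UNIV. \<Sum>j\<in>UNIV. \<Sum>k\<in>UNIV. c i j k * (\<Sum>l\<in>UNIV. (\<Sum>m\<in>UNIV. \<rho> l i l m * c m j k)
        + (\<Sum>m\<in>UNIV. \<rho> l i j m * c m l k) + (\<Sum>m\<in>UNIV. \<rho> l i k m * c m l j)))"
proof -
  define P where "P a b = (\<Sum>l\<in>UNIV. \<Sum>m\<in>UNIV. c a l m * c b l m)" for a b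
  \<comment> \<open>\<open>q i l\<close> is the matrix product of \<open>G\<^sub>i\<close> and
    \<open>G\<^sub>l\<close>, so \<open>\<rho> l i\<close> is the commutator of
    \<open>G\<^sub>l\<close> and \<open>G\<^sub>i\<close>. The matrix \<open>P\<close> above plays
    the role of the Ricci tensor.\<close>
  define q where "q i l j m = (\<Sum>k\<in>UNIV. c i j k * c l m k)" for i l j m
  define A1 where "A1 = (\<Sum>i\<in>UNIV. \<Sum>j\<in>UNIV. \<Sum>k\<in>UNIV. c i j k * (\<Sum>l\<in>UNIV. \<Sum>m\<in>UNIV. \<rho> l i l m * c m j k))"
  define A2 where "A2 = (\<Sum>i\<in>UNIV. \<Sum>j\<in>UNIV. \<Sum>k\<in>UNIV. c i j k * (\<Sum>l\<in>UNIV. \<Sum>m\<in>UNIV. \<rho> l i j m * c m l k))"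
  define A3 where "A3 = (\<Sum>i\<in>UNIV. \<Sum>j\<in>UNIV. \<Sum>k\<in>UNIV. c i j k * (\<Sum>l\<in>UNIV. \<Sum>m\<in>UNIV. \<rho> l i k m * c m l j))"
  \<comment> \<open>The contraction of a curvature operator gives minus Ricci: the first product in
    \<rho> contains the trace of \<open>c\<close> and vanishes, the second is
    \<open>P\<close>.\<close>
  have \<rho>P: "(\<Sum>l\<in>UNIV. \<rho> l i l m) = - P i m" for i m
  proof -
    have "(\<Sum>l\<in>UNIV. \<Sum>n\<in>UNIV. c l l n * c i n m) = (\<Sum>n\<in>UNIV. (\<Sum>l\<in>UNIV. c l l n) * c i n m)"
      by (subst sum.swap) (simp add: sum_distrib_right)
    then have "(\<Sum>l\<in>UNIV. \<Sum>n\<in>UNIV. c l l n * c i n m) = 0" by (simp add: tr)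
    moreover have "c l n m = c m l n" for l n by (metis s12 s23)
    ultimately show ?thesis by (simp add: \<rho> sum_subtractf P_def)
  qed
  have A1: "A1 = - (\<Sum>i\<in>UNIV. \<Sum>m\<in>UNIV. (P i m)\<^sup>2)"
  proof -
    have "(\<Sum>l\<in>UNIV. \<Sum>m\<in>UNIV. \<rho> l i l m * c m j k) = (\<Sum>m\<in>UNIV. - P i m * c m j k)" for i j k
      by (subst sum.swap) (simp add: sum_distrib_right[symmetric] \<rho>P)
    then have "A1 = (\<Sum>i\<in>UNIV. \<Sum>j\<in>UNIV. \<Sum>k\<in>UNIV. \<Sum>m\<in>UNIV. - P i m * (c i j k * c m j k))"
      unfolding A1_def by (simp add: sum_distrib_left mult_ac)
    also have "\<dots> = (\<Sum>i\<in>UNIV. \<Sum>m\<in>UNIV. - P i m * P i m)"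
    proof (rule sum.cong[OF refl])
      fix i
      have "(\<Sum>j\<in>UNIV. \<Sum>k\<in>UNIV. \<Sum>m\<in>UNIV. - P i m * (c i j k * c m j k))
          = (\<Sum>j\<in>UNIV. \<Sum>m\<in>UNIV. \<Sum>k\<in>UNIV. - P i m * (c i j k * c m j k))"
        by (intro sum.cong refl sum.swap)
      also have "\<dots> = (\<Sum>m\<in>UNIV. \<Sum>j\<in>UNIV. \<Sum>k\<in>UNIV. - P i m * (c i j k * c m j k))" by (rule sum.swap)
      also have "\<dots> = (\<Sum>m\<in>UNIV. - P i m * P i m)"
        by (simp add: P_def[of i] sum_distrib_left)
      finally show "(\<Sum>j\<in>UNIV. \<Sum>k\<in>UNIV. \<Sum>m\<in>UNIV. - P i m * (c i j k * c m j k)) = \<dots>" .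
    qed
    finally show ?thesis by (simp add: power2_eq_square sum_negf)
  qed
  have "A2 = (\<Sum>i\<in>UNIV. \<Sum>j\<in>UNIV. \<Sum>l\<in>UNIV. \<Sum>m\<in>UNIV. (q l i j m - q i l j m) * q i l j m)"
  proof -
    have "\<rho> l i j m = q l i j m - q i l j m" for l i j m
      unfolding \<rho> q_def using s23 by presburger
    moreover have "(\<Sum>k\<in>UNIV. c i j k * (r * c m l k)) = r * q i l j m" for i j l m r
      unfolding q_def sum_distrib_left using s12[of m l] by (simp add: mult_ac)
    ultimately show ?thesis unfolding A2_def sum_mult_swap by simp
  qed
  also have "\<dots> = (\<Sum>j\<in>UNIV. \<Sum>m\<in>UNIV. \<Sum>i\<in>UNIV. \<Sum>l\<in>UNIV. (q l i j m - q i l j m) * q i l j m)"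
    (is "?L = ?R")
  proof -
    have "?L = (\<Sum>j\<in>UNIV. \<Sum>i\<in>UNIV. \<Sum>l\<in>UNIV. \<Sum>m\<in>UNIV. (q l i j m - q i l j m) * q i l j m)"
      by (rule sum.swap)
    also have "\<dots> = (\<Sum>j\<in>UNIV. \<Sum>i\<in>UNIV. \<Sum>m\<in>UNIV. \<Sum>l\<in>UNIV. (q l i j m - q i l j m) * q i l j m)"
      by (intro sum.cong refl sum.swap)
    also have "\<dots> = ?R" by (intro sum.cong refl sum.swap)
    finally show ?thesis .
  qed
  also have "\<dots> \<le> 0"
  proof (rule sum_nonpos, rule sum_nonpos)
    fix j m
    let ?S = "\<Sum>i\<in>UNIV. \<Sum>l\<in>UNIV. (q l i j m - q i l j m) * q i l j m"
    \<comment> \<open>Averaging the sum with its copy under the exchange of \<open>i\<close> and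
      \<open>l\<close> turns the product into minus half the square of a commutator entry.\<close>
    have "?S = (\<Sum>i\<in>UNIV. \<Sum>l\<in>UNIV. (q i l j m - q l i j m) * q l i j m)" by (rule sum.swap)
    then have "2 * ?S = (\<Sum>i\<in>UNIV. \<Sum>l\<in>UNIV. (q l i j m - q i l j m) * q i l j m + (q i l j m - q l i j m) * q l i j m)"
      by (simp add: sum.distrib)
    also have "\<dots> = (\<Sum>i\<in>UNIV. \<Sum>l\<in>UNIV. - ((q l i j m - q i l j m)\<^sup>2))"
      by (intro sum.cong refl) (simp add: power2_eq_square algebra_simps)
    also have "\<dots> \<le> 0" by (intro sum_nonpos) simp
    finally show "?S \<le> 0" by simp
  qed
  finally have A2: "A2 \<le> 0" .
  have "A3 = (\<Sum>i\<in>UNIV. \<Sum>k\<in>UNIV. \<Sum>j\<in>UNIV. c i j k * (\<Sum>l\<in>UNIV. \<Sum>m\<in>UNIV. \<rho> l i k m * c m l j))"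
    unfolding A3_def by (intro sum.cong refl sum.swap)
  also have "\<dots> = A2" unfolding A2_def using s23 by presburger
  finally have "A3 = A2" .
  have "(\<Sum>i\<in>UNIV. \<Sum>j\<in>UNIV. \<Sum>k\<in>UNIV. c i j k * (\<Sum>l\<in>UNIV. (\<Sum>m\<in>UNIV. \<rho> l i l m * c m j k)
        + (\<Sum>m\<in>UNIV. \<rho> l i j m * c m l k) + (\<Sum>m\<in>UNIV. \<rho> l i k m * c m l j))) = A1 + A2 + A3"
    unfolding A1_def A2_def A3_def by (simp add: sum.distrib distrib_left)
  then show ?thesis using A1 A2 \<open>A3 = A2\<close> by (simp add: P_def)
qed

section \<open>Contractions in an orthonormal frame\<close>

locale framed_patch = patch M A g nab D \<gamma> U
  for M :: "'m topology" and A :: "('m, 'n::finite) chart set" and g nab D \<gamma> U +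
  fixes E :: "'n \<Rightarrow> 'm vfield"
  assumes E: "orthonormal_frame M A g U E"
begin

lemma E_smooth: "E i \<in> vfs"
  using E by (simp add: orthonormal_frame_def)

lemma E_orthonormal: "p \<in> U \<Longrightarrow> gm (E i) (E j) p = (if i = j then 1 else 0)"
  using E by (simp add: orthonormal_frame_def)

text \<open>Differentiating orthonormality shows that the connection matrix \<open>w\<close> of the
  frame is skew, and a skew matrix contracts to zero with a symmetric one. This does the work
  usually done by a frame that is parallel at \<open>p\<close>.\<close>

lemma frame_skew:
  assumes V: "V \<in> vfs" and p: "p \<in> U" and B: "\<And>l. tensorial (\<lambda>X. B X (E l))"
    and sym: "\<And>i j. B (E i) (E j) p = B (E j) (E i) p"
  shows "(\<Sum>l\<in>UNIV. B (D V (E l)) (E l) p) = 0"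
proof -
  define w where "w l m = gm (D V (E l)) (E m) p" for l m
  have skew: "w l m = - w m l" for l m
  proof -
    have "V p (gm (E l) (E m)) = V p (\<lambda>q. if l = m then 1 else 0)"
      by (rule der_cong[OF V p]) (simp add: E_orthonormal)
    then have "gm (D V (E l)) (E m) p + gm (E l) (D V (E m)) p = 0"
      using D_metric[OF V E_smooth E_smooth p, of l m] der_const[OF V p] by simp
    then show ?thesis
      using gm_sym[OF E_smooth D_smooth[OF V E_smooth] p, of l m] by (simp add: w_def)
  qed
  let ?S = "\<Sum>l\<in>UNIV. \<Sum>m\<in>UNIV. w l m * B (E m) (E l) p"
  have "?S = (\<Sum>l\<in>UNIV. \<Sum>m\<in>UNIV. w m l * B (E l) (E m) p)" by (rule sum.swap)
  also have "\<dots> = (\<Sum>l\<in>UNIV. \<Sum>m\<in>UNIV. - (w l m * B (E m) (E l) p))"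
  proof (intro sum.cong refl)
    fix l m show "w m l * B (E l) (E m) p = - (w l m * B (E m) (E l) p)"
      using skew[of m l] sym[of l m] by simp
  qed
  finally have "?S = 0" by (simp add: sum_negf)
  moreover have "B (D V (E l)) (E l) p = (\<Sum>m\<in>UNIV. w l m * B (E m) (E l) p)" for l
    unfolding w_def by (rule tensorial_expand[OF E B D_smooth[OF V E_smooth] p])
  ultimately show ?thesis by simp
qed

lemma trace_C:
  assumes Z: "Z \<in> vfs" and p: "p \<in> U"
  shows "(\<Sum>l\<in>UNIV. C (E l) (E l) Z p) = 0"
proof -
  \<comment> \<open>The factor 1 puts the trace into the form of the linear combinations in
    \<open>g_sum\<close>.\<close>
  have "(\<lambda>f. \<Sum>l\<in>UNIV. 1 * \<gamma> (E l) (E l) p f) = (\<lambda>f. 0)"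
    using trace_zero U E p by (simp add: metric_trace_zero_def vf_eq_on_def vf_sum_def vf_zero_def)
  then have "g p (\<lambda>f. \<Sum>l\<in>UNIV. 1 * \<gamma> (E l) (E l) p f) (Z p) = 0"
    using g_zero[OF mem_topspace[OF p] vf_tangent[OF Z p]] by simp
  then show ?thesis
    using g_sum[OF mem_topspace[OF p] _ vf_tangent[OF Z p], of UNIV "\<lambda>l. \<gamma> (E l) (E l) p" "\<lambda>l. 1"]
    by (simp add: C_def metric_pair_def vf_tangent[OF \<gamma>_smooth[OF E_smooth E_smooth] p])
qed

text \<open>Contraction commutes with covariant differentiation: the derivative of the trace
  identity for \<open>C\<close> differs from the trace of \<open>cov_C\<close> by derivatives of the
  frame, which \<open>frame_skew\<close> removes. The same argument, once more, treats
  \<open>cov2_C\<close>.\<close>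

lemma trace_cov_C:
  assumes V: "V \<in> vfs" and Z: "Z \<in> vfs" and p: "p \<in> U"
  shows "(\<Sum>l\<in>UNIV. cov_C V (E l) (E l) Z p) = 0"
proof -
  have "V p (\<lambda>q. \<Sum>l\<in>UNIV. C (E l) (E l) Z q) = V p (\<lambda>q. 0)"
    by (rule der_cong[OF V p trace_C[OF Z]])
  then have 1: "(\<Sum>l\<in>UNIV. V p (C (E l) (E l) Z)) = 0"
    using der_sum[OF V p, of UNIV "\<lambda>l. C (E l) (E l) Z"] C_smooth[OF E_smooth E_smooth Z] der_const[OF V p]
    by simp
  have 2: "(\<Sum>l\<in>UNIV. C (D V (E l)) (E l) Z p) = 0"
    by (rule frame_skew[OF V p C_tensorial[OF E_smooth Z] C_sym12[OF E_smooth E_smooth Z p]])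
  have 3: "C (E l) (D V (E l)) Z p = C (D V (E l)) (E l) Z p" for l
    by (rule C_sym12[OF E_smooth D_smooth[OF V E_smooth] Z p])
  show ?thesis
    unfolding cov_C_def 3 sum_subtractf 1 2 trace_C[OF D_smooth[OF V Z] p] by simp
qed

lemma trace_cov2_C:
  assumes V: "V \<in> vfs" and W: "W \<in> vfs" and Z: "Z \<in> vfs" and p: "p \<in> U"
  shows "(\<Sum>l\<in>UNIV. cov2_C V W (E l) (E l) Z p) = 0"
proof -
  have "V p (\<lambda>q. \<Sum>l\<in>UNIV. cov_C W (E l) (E l) Z q) = V p (\<lambda>q. 0)"
    by (rule der_cong[OF V p trace_cov_C[OF W Z]])
  then have 1: "(\<Sum>l\<in>UNIV. V p (cov_C W (E l) (E l) Z)) = 0"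
    using der_sum[OF V p, of UNIV "\<lambda>l. cov_C W (E l) (E l) Z"] cov_C_smooth[OF W E_smooth E_smooth Z] der_const[OF V p]
    by simp
  have 2: "(\<Sum>l\<in>UNIV. cov_C W (D V (E l)) (E l) Z p) = 0"
    by (rule frame_skew[OF V p cov_C_tensorial2[OF W E_smooth Z] cov_C_sym23[OF W E_smooth E_smooth Z p]])
  have 3: "cov_C W (E l) (D V (E l)) Z p = cov_C W (D V (E l)) (E l) Z p" for l
    by (rule cov_C_sym23[OF W E_smooth D_smooth[OF V E_smooth] Z p])
  show ?thesis
    unfolding cov2_C_def 3 sum_subtractf 1 2 trace_cov_C[OF D_smooth[OF V W] Z p] trace_cov_C[OF W D_smooth[OF V Z] p] by simp
qed

lemma C_\<gamma>_expand:
  assumes "X \<in> vfs" "Y \<in> vfs" "Z \<in> vfs" "V \<in> vfs" "p \<in> U"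
  shows "C X (\<gamma> Y Z) V p = (\<Sum>n\<in>UNIV. C Y Z (E n) p * C X (E n) V p)"
proof -
  have "C X (\<gamma> Y Z) V p = C (\<gamma> Y Z) X V p"
    by (rule C_sym12[OF assms(1) \<gamma>_smooth[OF assms(2,3)] assms(4,5)])
  also have "\<dots> = (\<Sum>n\<in>UNIV. gm (\<gamma> Y Z) (E n) p * C (E n) X V p)"
    by (rule tensorial_expand[OF E C_tensorial[OF assms(1,4)] \<gamma>_smooth[OF assms(2,3)] assms(5)])
  also have "\<dots> = (\<Sum>n\<in>UNIV. C Y Z (E n) p * C X (E n) V p)"
    by (intro sum.cong refl) (simp add: C_def[symmetric] C_sym12[OF E_smooth assms(1,4,5)])
  finally show ?thesis .
qed

text \<open>In the Gauss equation one product is the square of \<open>\<gamma> (E i) X\<close>; the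
  other sums to the pairing of the trace of \<gamma> with \<open>\<gamma> X X\<close>, which is
  zero.\<close>

lemma ricci_formula:
  assumes X: "X \<in> vfs" and p: "p \<in> U"
  shows "ricci_in_frame M A g D E X X p = (\<Sum>i\<in>UNIV. gm (\<gamma> (E i) X) (\<gamma> (E i) X) p)"
proof -
  have "(\<Sum>i\<in>UNIV. C (E i) (\<gamma> X X) (E i) p) = 0"
    using trace_C[OF \<gamma>_smooth[OF X X] p] C_sym23[OF E_smooth E_smooth \<gamma>_smooth[OF X X] p] by simp
  moreover have "gm (R (E i) X X) (E i) p = gm (\<gamma> (E i) X) (\<gamma> (E i) X) p - C (E i) (\<gamma> X X) (E i) p" for i
  proof -
    have "C X (\<gamma> (E i) X) (E i) p = C X (E i) (\<gamma> (E i) X) p"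
      by (rule C_sym23[OF X \<gamma>_smooth[OF E_smooth X] E_smooth p])
    also have "\<dots> = gm (\<gamma> (E i) X) (\<gamma> (E i) X) p"
      by (simp add: C_def metric_pair_def \<gamma>_sym[OF X E_smooth p])
    finally show ?thesis using gauss_codazzi(1)[OF E_smooth X X E_smooth p, of i i] by simp
  qed
  ultimately show ?thesis
    by (simp add: ricci_in_frame_def R_def[symmetric] sum_subtractf)
qed

section \<open>The squared norm of the cubic form and its derivatives\<close>

definition normC :: "'m \<Rightarrow> real" where
  "normC = (\<lambda>p. \<Sum>i\<in>UNIV. \<Sum>j\<in>UNIV. \<Sum>k\<in>UNIV. (C (E i) (E j) (E k) p)\<^sup>2)"

lemma normC_smooth: "smf normC"
  unfolding normC_def power2_eq_square
  by (intro smooth_fun_sum[OF U] smooth_fun_mult[OF U] C_smooth E_smooth)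

lemma tensorial_mult: "tensorial \<phi> \<Longrightarrow> tensorial (\<lambda>X p. \<phi> X p * h p)"
  by (simp add: tensorial_def algebra_simps)

lemma tensorial_plus: "tensorial \<phi> \<Longrightarrow> tensorial \<psi> \<Longrightarrow> tensorial (\<lambda>X p. \<phi> X p + \<psi> X p)"
  by (simp add: tensorial_def algebra_simps)

lemma contraction_skew:
  assumes V: "V \<in> vfs" and p: "p \<in> U" and \<phi>: "tensorial \<phi>" and \<psi>: "tensorial \<psi>"
  shows "(\<Sum>i\<in>UNIV. \<phi> (D V (E i)) p * \<psi> (E i) p + \<psi> (D V (E i)) p * \<phi> (E i) p) = 0"
  by (rule frame_skew[OF V p, where B = "\<lambda>X Y p. \<phi> X p * \<psi> Y p + \<psi> X p * \<phi> Y p"])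
    (auto intro!: tensorial_plus tensorial_mult \<phi> \<psi>)

text \<open>The derivatives of the frame contribute nothing to the full contraction of two totally
  symmetric tensors. Symmetry brings the differentiated field to the first slot, and each index is
  then handled separately by \<open>contraction_skew\<close>. Two different tensors are allowed
  because the second derivative of the norm contracts \<open>C\<close> with
  \<open>cov_C W\<close>.\<close>

lemma contraction3_skew:
  assumes V: "V \<in> vfs" and p: "p \<in> U"
    and S: "\<And>Y Z. Y \<in> vfs \<Longrightarrow> Z \<in> vfs \<Longrightarrow> tensorial (\<lambda>X. S X Y Z)"
      "\<And>X Y Z. X \<in> vfs \<Longrightarrow> Y \<in> vfs \<Longrightarrow> Z \<in> vfs \<Longrightarrow> S X Y Z p = S Y X Z p"
      "\<And>X Y Z. X \<in> vfs \<Longrightarrow> Y \<in> vfs \<Longrightarrow> Z \<in> vfs \<Longrightarrow> S X Y Z p = S X Z Y p"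
    and T: "\<And>Y Z. Y \<in> vfs \<Longrightarrow> Z \<in> vfs \<Longrightarrow> tensorial (\<lambda>X. T X Y Z)"
      "\<And>X Y Z. X \<in> vfs \<Longrightarrow> Y \<in> vfs \<Longrightarrow> Z \<in> vfs \<Longrightarrow> T X Y Z p = T Y X Z p"
      "\<And>X Y Z. X \<in> vfs \<Longrightarrow> Y \<in> vfs \<Longrightarrow> Z \<in> vfs \<Longrightarrow> T X Y Z p = T X Z Y p"
  shows "(\<Sum>i\<in>UNIV. \<Sum>j\<in>UNIV. \<Sum>k\<in>UNIV.
      (S (D V (E i)) (E j) (E k) p + S (E i) (D V (E j)) (E k) p + S (E i) (E j) (D V (E k)) p) * T (E i) (E j) (E k) p
    + S (E i) (E j) (E k) p * (T (D V (E i)) (E j) (E k) p + T (E i) (D V (E j)) (E k) p + T (E i) (E j) (D V (E k)) p)) = 0"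
proof -
  define s where "s i j k = S (D V (E i)) (E j) (E k) p * T (E i) (E j) (E k) p
    + T (D V (E i)) (E j) (E k) p * S (E i) (E j) (E k) p" for i j k
  have s0: "(\<Sum>i\<in>UNIV. s i j k) = 0" for j k
    unfolding s_def by (rule contraction_skew[OF V p S(1) T(1)]) (rule E_smooth)+
  have rot: "S X Y Z p = S Y X Z p" "T X Y Z p = T Y X Z p" "S X Y Z p = S Z X Y p" "T X Y Z p = T Z X Y p"
    if "X \<in> vfs" "Y \<in> vfs" "Z \<in> vfs" for X Y Z
    using S(2)[OF that] S(3)[OF that] S(2)[OF that(1,3,2)] T(2)[OF that] T(3)[OF that] T(2)[OF that(1,3,2)]
    by simp_all
  note a = rot(1,2)[OF E_smooth D_smooth[OF V E_smooth] E_smooth] rot(3,4)[OF E_smooth E_smooth D_smooth[OF V E_smooth]]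
  note b = rot[OF E_smooth E_smooth E_smooth]
  have "(S (D V (E i)) (E j) (E k) p + S (E i) (D V (E j)) (E k) p + S (E i) (E j) (D V (E k)) p) * T (E i) (E j) (E k) p
    + S (E i) (E j) (E k) p * (T (D V (E i)) (E j) (E k) p + T (E i) (D V (E j)) (E k) p + T (E i) (E j) (D V (E k)) p)
    = s i j k + s j i k + s k i j" for i j k
    unfolding s_def a b(1)[of j i k] b(2)[of j i k] b(3)[of i j k, symmetric] b(4)[of i j k, symmetric]
    by (simp add: algebra_simps)
  moreover have "(\<Sum>i\<in>UNIV. \<Sum>j\<in>UNIV. \<Sum>k\<in>UNIV. s i j k) = 0"
  proof -
    have "(\<Sum>i\<in>UNIV. \<Sum>j\<in>UNIV. \<Sum>k\<in>UNIV. s i j k) = (\<Sum>j\<in>UNIV. \<Sum>i\<in>UNIV. \<Sum>k\<in>UNIV. s i j k)" by (rule sum.swap)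
    also have "\<dots> = (\<Sum>j\<in>UNIV. \<Sum>k\<in>UNIV. \<Sum>i\<in>UNIV. s i j k)" by (intro sum.cong refl sum.swap)
    finally show ?thesis by (simp add: s0)
  qed
  moreover have "(\<Sum>i\<in>UNIV. \<Sum>j\<in>UNIV. \<Sum>k\<in>UNIV. s j i k) = 0"
  proof -
    have "(\<Sum>i\<in>UNIV. \<Sum>j\<in>UNIV. \<Sum>k\<in>UNIV. s j i k) = (\<Sum>i\<in>UNIV. \<Sum>k\<in>UNIV. \<Sum>j\<in>UNIV. s j i k)"
      by (intro sum.cong refl sum.swap)
    then show ?thesis by (simp add: s0)
  qed
  ultimately show ?thesis by (simp add: sum.distrib s0)
qed

lemma cov_C_frame: "V p (C (E i) (E j) (E k)) = cov_C V (E i) (E j) (E k) p + (C (D V (E i)) (E j) (E k) p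
    + C (E i) (D V (E j)) (E k) p + C (E i) (E j) (D V (E k)) p)"
  by (simp add: cov_C_def)

lemma cov2_C_frame: "V p (cov_C W (E i) (E j) (E k)) = cov2_C V W (E i) (E j) (E k) p + cov_C (D V W) (E i) (E j) (E k) p
    + (cov_C W (D V (E i)) (E j) (E k) p + cov_C W (E i) (D V (E j)) (E k) p + cov_C W (E i) (E j) (D V (E k)) p)"
  by (simp add: cov2_C_def)

lemma normC_deriv:
  assumes V: "V \<in> vfs" and p: "p \<in> U"
  shows "V p normC = 2 * (\<Sum>i\<in>UNIV. \<Sum>j\<in>UNIV. \<Sum>k\<in>UNIV. C (E i) (E j) (E k) p * cov_C V (E i) (E j) (E k) p)"
proof -
  note s = smooth_fun_sum[OF U] smooth_fun_mult[OF U] C_smooth E_smooth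
  have "V p normC = (\<Sum>i\<in>UNIV. \<Sum>j\<in>UNIV. \<Sum>k\<in>UNIV. V p (C (E i) (E j) (E k)) * C (E i) (E j) (E k) p
      + C (E i) (E j) (E k) p * V p (C (E i) (E j) (E k)))"
    unfolding normC_def power2_eq_square
    apply (subst der_sum[OF V p], (intro s)[1])
    apply (subst der_sum[OF V p], (intro s)[1])
    apply (subst der_sum[OF V p], (intro s)[1])
    apply (subst der_mult[OF V p C_smooth[OF E_smooth E_smooth E_smooth] C_smooth[OF E_smooth E_smooth E_smooth]])
    apply (rule refl)
    done
  also have "\<dots> = (\<Sum>i\<in>UNIV. \<Sum>j\<in>UNIV. \<Sum>k\<in>UNIV. 2 * (C (E i) (E j) (E k) p * cov_C V (E i) (E j) (E k) p))
    + (\<Sum>i\<in>UNIV. \<Sum>j\<in>UNIV. \<Sum>k\<in>UNIV.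
      (C (D V (E i)) (E j) (E k) p + C (E i) (D V (E j)) (E k) p + C (E i) (E j) (D V (E k)) p) * C (E i) (E j) (E k) p
    + C (E i) (E j) (E k) p * (C (D V (E i)) (E j) (E k) p + C (E i) (D V (E j)) (E k) p + C (E i) (E j) (D V (E k)) p))"
    unfolding sum.distrib[symmetric] cov_C_frame by (intro sum.cong refl) (simp add: algebra_simps)
  also have "\<dots> = 2 * (\<Sum>i\<in>UNIV. \<Sum>j\<in>UNIV. \<Sum>k\<in>UNIV. C (E i) (E j) (E k) p * cov_C V (E i) (E j) (E k) p)"
    using contraction3_skew[where S = C and T = C, OF V p C_tensorial C_sym12[OF _ _ _ p] C_sym23[OF _ _ _ p]
        C_tensorial C_sym12[OF _ _ _ p] C_sym23[OF _ _ _ p]]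
    by (simp only: sum_distrib_left add_0_right)
  finally show ?thesis .
qed

text \<open>Polarised Bochner formula. The last term is the difference between the iterated
  derivative and the Hessian; it vanishes at a critical point.\<close>

lemma normC_deriv2:
  assumes V: "V \<in> vfs" and W: "W \<in> vfs" and p: "p \<in> U"
  shows "V p (\<lambda>q. W q normC) = 2 * (\<Sum>i\<in>UNIV. \<Sum>j\<in>UNIV. \<Sum>k\<in>UNIV.
      cov_C V (E i) (E j) (E k) p * cov_C W (E i) (E j) (E k) p + C (E i) (E j) (E k) p * cov2_C V W (E i) (E j) (E k) p)
    + D V W p normC"
proof -
  note s = smooth_fun_sum[OF U] smooth_fun_mult[OF U] C_smooth E_smooth cov_C_smooth W
  let ?F = "\<lambda>q. \<Sum>i\<in>UNIV. \<Sum>j\<in>UNIV. \<Sum>k\<in>UNIV. C (E i) (E j) (E k) q * cov_C W (E i) (E j) (E k) q"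
  have F: "smf ?F" by (intro s)
  have "V p (\<lambda>q. W q normC) = V p (\<lambda>q. 2 * ?F q)"
    by (rule der_cong[OF V p normC_deriv[OF W]])
  also have "\<dots> = 2 * V p ?F"
    using der_mult[OF V p smooth_fun_const F] der_const[OF V p] by simp
  finally have 1: "V p (\<lambda>q. W q normC) = 2 * V p ?F" .
  have "V p ?F = (\<Sum>i\<in>UNIV. \<Sum>j\<in>UNIV. \<Sum>k\<in>UNIV. V p (C (E i) (E j) (E k)) * cov_C W (E i) (E j) (E k) p
      + C (E i) (E j) (E k) p * V p (cov_C W (E i) (E j) (E k)))"
    apply (subst der_sum[OF V p], (intro s)[1])
    apply (subst der_sum[OF V p], (intro s)[1])
    apply (subst der_sum[OF V p], (intro s)[1])
    apply (subst der_mult[OF V p C_smooth[OF E_smooth E_smooth E_smooth] cov_C_smooth[OF W E_smooth E_smooth E_smooth]])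
    apply (rule refl)
    done
  also have "\<dots> = (\<Sum>i\<in>UNIV. \<Sum>j\<in>UNIV. \<Sum>k\<in>UNIV.
      cov_C V (E i) (E j) (E k) p * cov_C W (E i) (E j) (E k) p + C (E i) (E j) (E k) p * cov2_C V W (E i) (E j) (E k) p)
    + (\<Sum>i\<in>UNIV. \<Sum>j\<in>UNIV. \<Sum>k\<in>UNIV. C (E i) (E j) (E k) p * cov_C (D V W) (E i) (E j) (E k) p)
    + (\<Sum>i\<in>UNIV. \<Sum>j\<in>UNIV. \<Sum>k\<in>UNIV.
      (C (D V (E i)) (E j) (E k) p + C (E i) (D V (E j)) (E k) p + C (E i) (E j) (D V (E k)) p) * cov_C W (E i) (E j) (E k) p
    + C (E i) (E j) (E k) p * (cov_C W (D V (E i)) (E j) (E k) p + cov_C W (E i) (D V (E j)) (E k) p + cov_C W (E i) (E j) (D V (E k)) p))"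
    unfolding sum.distrib[symmetric] cov_C_frame cov2_C_frame by (intro sum.cong refl) (simp add: algebra_simps)
  finally have 2: "V p ?F = \<dots>" .
  have 3: "(\<Sum>i\<in>UNIV. \<Sum>j\<in>UNIV. \<Sum>k\<in>UNIV.
      (C (D V (E i)) (E j) (E k) p + C (E i) (D V (E j)) (E k) p + C (E i) (E j) (D V (E k)) p) * cov_C W (E i) (E j) (E k) p
    + C (E i) (E j) (E k) p * (cov_C W (D V (E i)) (E j) (E k) p + cov_C W (E i) (D V (E j)) (E k) p + cov_C W (E i) (E j) (D V (E k)) p)) = 0"
    by (rule contraction3_skew[where S = C and T = "cov_C W", OF V p C_tensorial C_sym12[OF _ _ _ p] C_sym23[OF _ _ _ p]
        cov_C_tensorial2[OF W] cov_C_sym23[OF W _ _ _ p] cov_C_sym34[OF W _ _ _ p]])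
  show ?thesis
    unfolding 1 2 3 normC_deriv[OF D_smooth[OF V W] p] by (simp only: distrib_left[of 2] add_0_right)
qed

lemma R_frame:
  assumes "p \<in> U"
  shows "gm (R (E l) (E i) (E j)) (E m) p =
    (\<Sum>n\<in>UNIV. C (E l) (E j) (E n) p * C (E i) (E n) (E m) p)
    - (\<Sum>n\<in>UNIV. C (E i) (E j) (E n) p * C (E l) (E n) (E m) p)"
  using gauss_codazzi(1)[OF E_smooth E_smooth E_smooth E_smooth assms, of l i j m]
    C_\<gamma>_expand[OF E_smooth E_smooth E_smooth E_smooth assms] by simp

lemma simons:
  assumes p: "p \<in> U"
  defines "\<rho> \<equiv> \<lambda>l i j m. gm (R (E l) (E i) (E j)) (E m) p"
  shows "(\<Sum>l\<in>UNIV. cov2_C (E l) (E l) (E i) (E j) (E k) p) =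
    - (\<Sum>l\<in>UNIV. (\<Sum>m\<in>UNIV. \<rho> l i l m * C (E m) (E j) (E k) p)
        + (\<Sum>m\<in>UNIV. \<rho> l i j m * C (E m) (E l) (E k) p) + (\<Sum>m\<in>UNIV. \<rho> l i k m * C (E m) (E l) (E j) p))"
proof -
  note e = E_smooth
  have R: "C (R (E l) (E i) (E j')) (E a) (E b) p = (\<Sum>m\<in>UNIV. \<rho> l i j' m * C (E m) (E a) (E b) p)" for l j' a b
    unfolding \<rho>_def by (rule tensorial_expand[OF E C_tensorial[OF e e] R_smooth[OF e e e] p])
  have "cov2_C (E l) (E l) (E i) (E j) (E k) p = cov2_C (E i) (E j) (E l) (E l) (E k) p
      - ((\<Sum>m\<in>UNIV. \<rho> l i l m * C (E m) (E j) (E k) p)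
        + (\<Sum>m\<in>UNIV. \<rho> l i j m * C (E m) (E l) (E k) p) + (\<Sum>m\<in>UNIV. \<rho> l i k m * C (E m) (E l) (E j) p))" for l
  proof -
    \<comment> \<open>Codazzi makes \<open>i\<close> a differentiation index and leaves one
      \<open>l\<close> as an argument, ready for the exchange of the two derivatives.\<close>
    have "cov2_C (E l) (E l) (E i) (E j) (E k) p = cov2_C (E l) (E i) (E l) (E j) (E k) p"
      by (rule cov2_C_sym23[OF e e e e e p])
    \<comment> \<open>After the exchange, symmetry and Codazzi trade the differentiating
      \<open>l\<close> for \<open>j\<close>. Both copies of \<open>l\<close> are then arguments of
      \<open>C\<close>, so the sum over \<open>l\<close> is a trace and vanishes.\<close>
    moreover have "cov2_C (E i) (E l) (E l) (E j) (E k) p = cov2_C (E i) (E j) (E l) (E l) (E k) p"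
      using cov2_C_sym34[OF e e e e e p, of i l l j k] cov2_C_sym23[OF e e e e e p, of i l j l k] by simp
    moreover have "C (E l) (R (E l) (E i) (E j)) (E k) p = C (R (E l) (E i) (E j)) (E l) (E k) p"
      by (rule C_sym12[OF e R_smooth[OF e e e] e p])
    moreover have "C (E l) (E j) (R (E l) (E i) (E k)) p = C (R (E l) (E i) (E k)) (E l) (E j) p"
      using C_sym23[OF e e R_smooth[OF e e e] p, of l j l i k] C_sym12[OF e R_smooth[OF e e e] e p, of l l i k j] by simp
    ultimately show ?thesis
      using cov2_C_commute[OF e e e e e p, of l i l j k] R by simp
  qed
  then show ?thesis
    using trace_cov2_C[OF e e e p, of i j k] by (simp add: sum_subtractf sum_negf)
qed

lemma normC_max:
  assumes p: "p \<in> U" and max: "\<And>q. q \<in> U \<Longrightarrow> normC q \<le> normC p"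
  shows "normC p = 0"
proof -
  let ?c = "\<lambda>i j k. C (E i) (E j) (E k) p"
  let ?\<rho> = "\<lambda>l i j m. gm (R (E l) (E i) (E j)) (E m) p"
  let ?P = "\<lambda>a b. \<Sum>l\<in>UNIV. \<Sum>m\<in>UNIV. ?c a l m * ?c b l m"
  have d0: "V p normC = 0" if "V \<in> vfs" for V
    by (rule tangent_at_max[OF vf_tangent[OF that p] U p normC_smooth max])
  have l: "(\<Sum>i\<in>UNIV. \<Sum>j\<in>UNIV. \<Sum>k\<in>UNIV. ?c i j k * cov2_C (E l) (E l) (E i) (E j) (E k) p) \<le> 0" for l
  proof -
    have "E l p (vf_apply (E l) normC) \<le> 0"
      by (rule second_derivative_at_max[OF E_smooth U p normC_smooth max])
    \<comment> \<open>The derivative along \<open>D (E l) (E l)\<close> vanishes at the maximum by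
      \<open>d0\<close>. What is left is a sum of squares, to be discarded by its sign, plus the
      pairing of \<open>C\<close> with its second derivative.\<close>
    then have "(\<Sum>i\<in>UNIV. \<Sum>j\<in>UNIV. \<Sum>k\<in>UNIV. cov_C (E l) (E i) (E j) (E k) p * cov_C (E l) (E i) (E j) (E k) p
        + ?c i j k * cov2_C (E l) (E l) (E i) (E j) (E k) p) \<le> 0"
      using normC_deriv2[OF E_smooth E_smooth p, of l l] d0[OF D_smooth[OF E_smooth E_smooth]]
      by (simp add: vf_apply_def)
    moreover have "0 \<le> (\<Sum>i\<in>UNIV. \<Sum>j\<in>UNIV. \<Sum>k\<in>UNIV. cov_C (E l) (E i) (E j) (E k) p * cov_C (E l) (E i) (E j) (E k) p)"
      by (intro sum_nonneg) simp
    ultimately show ?thesis by (simp add: sum.distrib)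
  qed
  have "(\<Sum>a\<in>UNIV. \<Sum>b\<in>UNIV. (?P a b)\<^sup>2) \<le>
    - (\<Sum>i\<in>UNIV. \<Sum>j\<in>UNIV. \<Sum>k\<in>UNIV. ?c i j k * (\<Sum>l\<in>UNIV. (\<Sum>m\<in>UNIV. ?\<rho> l i l m * ?c m j k)
        + (\<Sum>m\<in>UNIV. ?\<rho> l i j m * ?c m l k) + (\<Sum>m\<in>UNIV. ?\<rho> l i k m * ?c m l j)))"
    by (rule cubic_form_curvature_bound[OF C_sym12[OF E_smooth E_smooth E_smooth p]
          C_sym23[OF E_smooth E_smooth E_smooth p] trace_C[OF E_smooth p] R_frame[OF p]])
  also have "\<dots> = (\<Sum>i\<in>UNIV. \<Sum>j\<in>UNIV. \<Sum>k\<in>UNIV. ?c i j k * (\<Sum>l\<in>UNIV. cov2_C (E l) (E l) (E i) (E j) (E k) p))"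
    unfolding simons[OF p] by (simp add: sum_negf)
  also have "\<dots> = (\<Sum>i\<in>UNIV. \<Sum>j\<in>UNIV. \<Sum>l\<in>UNIV. \<Sum>k\<in>UNIV. ?c i j k * cov2_C (E l) (E l) (E i) (E j) (E k) p)"
    unfolding sum_distrib_left by (intro sum.cong refl sum.swap)
  also have "\<dots> = (\<Sum>i\<in>UNIV. \<Sum>l\<in>UNIV. \<Sum>j\<in>UNIV. \<Sum>k\<in>UNIV. ?c i j k * cov2_C (E l) (E l) (E i) (E j) (E k) p)"
    by (intro sum.cong refl sum.swap)
  also have "\<dots> = (\<Sum>l\<in>UNIV. \<Sum>i\<in>UNIV. \<Sum>j\<in>UNIV. \<Sum>k\<in>UNIV. ?c i j k * cov2_C (E l) (E l) (E i) (E j) (E k) p)"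
    by (rule sum.swap)
  also have "\<dots> \<le> 0" by (rule sum_nonpos) (rule l)
  finally have le: "(\<Sum>a\<in>UNIV. \<Sum>b\<in>UNIV. (?P a b)\<^sup>2) \<le> 0" .
  \<comment> \<open>The diagonal entries add up to \<open>normC p\<close>, the scalar curvature, so
    their vanishing is all that is required of \<open>?P\<close>.\<close>
  have "?P a a = 0" for a
  proof -
    have "(?P a a)\<^sup>2 \<le> (\<Sum>b\<in>UNIV. (?P a b)\<^sup>2)" by (rule member_le_sum) auto
    also have "\<dots> \<le> (\<Sum>a\<in>UNIV. \<Sum>b\<in>UNIV. (?P a b)\<^sup>2)"
      by (rule member_le_sum[of a UNIV "\<lambda>a. \<Sum>b\<in>UNIV. (?P a b)\<^sup>2"]) (auto intro: sum_nonneg)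
    also note le
    finally show ?thesis by (simp only: power2_less_eq_zero_iff)
  qed
  then show ?thesis by (simp add: normC_def power2_eq_square)
qed

lemma normC_nonneg: "normC p \<ge> 0"
  unfolding normC_def by (intro sum_nonneg) simp

lemma gm_self_zero:
  assumes "X \<in> vfs" "p \<in> U" "gm X X p \<le> 0"
  shows "X p = (\<lambda>f. 0)"
  using g_pos[OF mem_topspace[OF assms(2)] vf_tangent[OF assms(1,2)]] assms(3) by (force simp: metric_pair_def)

text \<open>\<open>C X Y (\<gamma> X Y)\<close> is the squared length of
  \<open>\<gamma> X Y\<close>. It is linear in \<open>Y\<close>, so expanding \<open>Y\<close> in
  the frame shows that it vanishes, and positivity of the metric finishes.\<close>

lemma \<gamma>_zero_if_frame:
  assumes X: "X \<in> vfs" and Y: "Y \<in> vfs" and p: "p \<in> U" and zero: "\<And>i. \<gamma> (E i) X p = (\<lambda>f. 0)"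
  shows "\<gamma> X Y p = (\<lambda>f. 0)"
proof -
  have 0: "C (E i) X Z p = 0" if "Z \<in> vfs" for Z i
    using g_zero[OF mem_topspace[OF p] vf_tangent[OF that p]] by (simp add: C_def metric_pair_def zero)
  have "C Y X (\<gamma> X Y) p = (\<Sum>i\<in>UNIV. gm Y (E i) p * C (E i) X (\<gamma> X Y) p)"
    by (rule tensorial_expand[OF E C_tensorial[OF X \<gamma>_smooth[OF X Y]] Y p])
  then have "C X Y (\<gamma> X Y) p = 0"
    using 0[OF \<gamma>_smooth[OF X Y]] C_sym12[OF X Y \<gamma>_smooth[OF X Y] p] by simp
  then show ?thesis
    by (intro gm_self_zero[OF \<gamma>_smooth[OF X Y] p]) (simp add: C_def)
qed

lemma \<gamma>_zero_if_normC:
  assumes X: "X \<in> vfs" and Y: "Y \<in> vfs" and p: "p \<in> U" and zero: "normC p = 0"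
  shows "\<gamma> X Y p = (\<lambda>f. 0)"
proof (rule \<gamma>_zero_if_frame[OF X Y p])
  have c: "C (E i) (E j) (E k) p = 0" for i j k
  proof -
    have "(C (E i) (E j) (E k) p)\<^sup>2 \<le> (\<Sum>k\<in>UNIV. (C (E i) (E j) (E k) p)\<^sup>2)"
      by (rule member_le_sum) auto
    also have "\<dots> \<le> (\<Sum>j\<in>UNIV. \<Sum>k\<in>UNIV. (C (E i) (E j) (E k) p)\<^sup>2)"
      by (rule member_le_sum[of j UNIV "\<lambda>j. \<Sum>k\<in>UNIV. (C (E i) (E j) (E k) p)\<^sup>2"]) (auto intro: sum_nonneg)
    also have "\<dots> \<le> normC p"
      unfolding normC_def
      by (rule member_le_sum[of i UNIV "\<lambda>i. \<Sum>j\<in>UNIV. \<Sum>k\<in>UNIV. (C (E i) (E j) (E k) p)\<^sup>2"]) (auto intro!: sum_nonneg)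
    finally show ?thesis using zero by simp
  qed
  fix i
  have Ei: "\<gamma> (E i) (E j) p = (\<lambda>f. 0)" for j
    using frame_expand[OF E \<gamma>_smooth[OF E_smooth E_smooth] p, of i j] c[of i j]
    by (simp add: C_def)
  \<comment> \<open>The passage from frame fields to arbitrary fields is made twice: here for one
    argument, and in the opening rule of the proof for the other.\<close>
  then show "\<gamma> (E i) X p = (\<lambda>f. 0)"
    by (intro \<gamma>_zero_if_frame[OF E_smooth X p]) (simp add: \<gamma>_sym[OF E_smooth E_smooth p])
qed

text \<open>The frame is exchanged one index at a time by \<open>parseval\<close>; total symmetry of
  \<open>C\<close> makes every slot available to it.\<close>

lemma normC_frame_independent:
  assumes E': "orthonormal_frame M A g U E'" and p: "p \<in> U"
  shows "(\<Sum>i\<in>UNIV. \<Sum>j\<in>UNIV. \<Sum>k\<in>UNIV. (C (E' i) (E' j) (E' k) p)\<^sup>2) = normC p"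
proof -
  note e = E_smooth
  have e': "E' i \<in> vfs" for i using E' by (simp add: orthonormal_frame_def)
  have 3: "(\<Sum>k\<in>UNIV. (C X Y (E' k) p)\<^sup>2) = (\<Sum>k\<in>UNIV. (C X Y (E k) p)\<^sup>2)" if "X \<in> vfs" "Y \<in> vfs" for X Y
    using parseval[OF E E' C_tensorial[OF that(2,1)] p]
    by (simp add: C_sym13[OF that(1,2) e' p] C_sym13[OF that(1,2) e p])
  have 1: "(\<Sum>i\<in>UNIV. (C (E' i) Y Z p)\<^sup>2) = (\<Sum>i\<in>UNIV. (C (E i) Y Z p)\<^sup>2)" if "Y \<in> vfs" "Z \<in> vfs" for Y Z
    by (rule parseval[OF E E' C_tensorial[OF that] p])
  have 2: "(\<Sum>j\<in>UNIV. (C X (E' j) Z p)\<^sup>2) = (\<Sum>j\<in>UNIV. (C X (E j) Z p)\<^sup>2)" if "X \<in> vfs" "Z \<in> vfs" for X Z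
    using 1[OF that] by (simp add: C_sym12[OF that(1) e' that(2) p] C_sym12[OF that(1) e that(2) p])
  have "(\<Sum>i\<in>UNIV. \<Sum>j\<in>UNIV. \<Sum>k\<in>UNIV. (C (E' i) (E' j) (E' k) p)\<^sup>2)
      = (\<Sum>i\<in>UNIV. \<Sum>j\<in>UNIV. \<Sum>k\<in>UNIV. (C (E' i) (E' j) (E k) p)\<^sup>2)"
    by (simp add: 3 e')
  also have "\<dots> = (\<Sum>i\<in>UNIV. \<Sum>k\<in>UNIV. \<Sum>j\<in>UNIV. (C (E' i) (E' j) (E k) p)\<^sup>2)"
    by (intro sum.cong refl sum.swap)
  also have "\<dots> = (\<Sum>i\<in>UNIV. \<Sum>k\<in>UNIV. \<Sum>j\<in>UNIV. (C (E' i) (E j) (E k) p)\<^sup>2)"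
    by (simp add: 2 e e')
  also have "\<dots> = (\<Sum>k\<in>UNIV. \<Sum>i\<in>UNIV. \<Sum>j\<in>UNIV. (C (E' i) (E j) (E k) p)\<^sup>2)" by (rule sum.swap)
  also have "\<dots> = (\<Sum>k\<in>UNIV. \<Sum>j\<in>UNIV. \<Sum>i\<in>UNIV. (C (E' i) (E j) (E k) p)\<^sup>2)"
    by (intro sum.cong refl sum.swap)
  also have "\<dots> = (\<Sum>k\<in>UNIV. \<Sum>j\<in>UNIV. \<Sum>i\<in>UNIV. (C (E i) (E j) (E k) p)\<^sup>2)" by (simp add: 1 e)
  also have "\<dots> = (\<Sum>k\<in>UNIV. \<Sum>i\<in>UNIV. \<Sum>j\<in>UNIV. (C (E i) (E j) (E k) p)\<^sup>2)"
    by (intro sum.cong refl sum.swap)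
  also have "\<dots> = (\<Sum>i\<in>UNIV. \<Sum>k\<in>UNIV. \<Sum>j\<in>UNIV. (C (E i) (E j) (E k) p)\<^sup>2)" by (rule sum.swap)
  also have "\<dots> = normC p" unfolding normC_def by (intro sum.cong refl sum.swap)
  finally show ?thesis .
qed

end

section \<open>From local frames to the whole manifold\<close>

context smooth_mfd
begin

text \<open>Intended for \<open>energy\<close>, which is given by a smooth formula only near each
  point. Around a point, the open preimage under the chart representative is carried back to
  \<open>M\<close> by the chart homeomorphism.\<close>

lemma continuous_map_if_locally_smooth:
  assumes "\<And>p. p \<in> topspace M \<Longrightarrow> \<exists>U h. openin M U \<and> p \<in> U \<and> smooth_fun A U h \<and> (\<forall>q\<in>U. f q = h q)"
  shows "continuous_map M euclideanreal f"
proof -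
  have "openin M {x \<in> topspace M. f x \<in> S}" if S: "open S" for S
  proof (subst openin_subopen, intro ballI)
    fix p assume "p \<in> {x \<in> topspace M. f x \<in> S}"
    then have p: "p \<in> topspace M" "f p \<in> S" by auto
    obtain U h where U: "openin M U" "p \<in> U" "smooth_fun A U h" "\<And>q. q \<in> U \<Longrightarrow> f q = h q"
      using assms[OF p(1)] by blast
    obtain c where c: "c \<in> A" "p \<in> fst c" using p(1) by (rule chart_at)
    let ?I = "snd c ` (fst c \<inter> U)"
    have o: "open ?I" by (rule chart_image_open[OF c(1) U(1)])
    have "continuous_on ?I (chart_rep c h)"
      by (rule smooth_on_imp_continuous_on[OF smooth_funD[OF U(3) c(1)]])
    then have O: "open (?I \<inter> chart_rep c h -` S)" by (rule continuous_open_preimage[OF _ o S])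
    let ?T = "{q \<in> topspace (subtopology M (fst c)). snd c q \<in> ?I \<inter> chart_rep c h -` S}"
    have "openin (top_of_set (snd c ` fst c)) (?I \<inter> chart_rep c h -` S)"
      using O by (intro open_openin_trans[OF chart_range_open[OF c(1)]] O) auto
    then have "openin (subtopology M (fst c)) ?T"
      by (rule openin_continuous_map_preimage[OF homeomorphic_imp_continuous_map[OF chart_homeomorphic[OF c(1)]]])
    then have "openin M ?T" by (rule openin_trans_full[OF _ chart_openin[OF c(1)]])
    moreover have "p \<in> ?T"
      using p c U by (simp add: topspace_chart chart_rep_apply)
    moreover have "?T \<subseteq> {x \<in> topspace M. f x \<in> S}"
    proof
      fix q assume "q \<in> ?T"
      then have q: "q \<in> fst c" "snd c q \<in> ?I" "chart_rep c h (snd c q) \<in> S"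
        by (auto simp: topspace_chart[OF c(1)])
      then have "q \<in> U" using inj_on_image_mem_iff[OF chart_inj[OF c(1)], of q "fst c \<inter> U"] by auto
      then show "q \<in> {x \<in> topspace M. f x \<in> S}"
        using q(3) U(4)[of q] openin_subset[OF U(1)] by (auto simp: chart_rep_apply[OF c(1) q(1)])
    qed
    ultimately show "\<exists>T. openin M T \<and> p \<in> T \<and> T \<subseteq> {x \<in> topspace M. f x \<in> S}" by blast
  qed
  then show ?thesis by (simp add: continuous_map_def)
qed

end

context affine_riemann_mfd
begin

lemma framed_patchI:
  "openin M U \<Longrightarrow> orthonormal_frame M A g U E \<Longrightarrow> framed_patch M A g nab D \<gamma> U E"
  by unfold_locales

lemma g_nonneg: "p \<in> topspace M \<Longrightarrow> u \<in> tangent_space M A p \<Longrightarrow> g p u u \<ge> 0"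
  using g_pos[of p u] g_zero[of p u] by (cases "u = (\<lambda>f. 0)") (auto intro: less_imp_le)

lemma ricci_nonneg_D: "ricci_nonneg M A g D"
  unfolding ricci_nonneg_def
proof (intro allI impI ballI)
  fix W E X p assume WE: "openin M W \<and> orthonormal_frame M A g W E"
    and X: "X \<in> smooth_vf M A W" and p: "p \<in> W"
  interpret framed_patch M A g nab D \<gamma> W E by (rule framed_patchI) (use WE in auto)
  show "0 \<le> ricci_in_frame M A g D E X X p"
    unfolding ricci_formula[OF X p] metric_pair_def
    by (intro sum_nonneg g_nonneg[OF mem_topspace[OF p] vf_tangent[OF \<gamma>_smooth[OF E_smooth X] p]])
qed

text \<open>\<open>ricci_formula\<close> writes the Ricci curvature in direction \<open>X\<close> as
  a sum of squared lengths, so each \<open>\<gamma> (E i) X\<close> vanishes, and the frame field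
  can be replaced by any field.\<close>

lemma ricci_flat_imp_\<gamma>_zero:
  assumes "ricci_flat M A g D"
  shows "tensor_eq M A \<gamma> tensor_zero"
  unfolding tensor_eq_def tensor_zero_def vf_eq_on_def vf_zero_def
proof (intro allI impI ballI)
  fix W X Y p assume W: "openin M W" and XY: "X \<in> smooth_vf M A W" "Y \<in> smooth_vf M A W" and p: "p \<in> W"
  have "p \<in> topspace M" using p openin_subset[OF W] by auto
  then obtain V E where V: "openin M V" "p \<in> V" "orthonormal_frame M A g V E" by (rule orthonormal_frame_exists)
  let ?U = "V \<inter> W"
  interpret framed_patch M A g nab D \<gamma> ?U E
    by (rule framed_patchI) (use V W in \<open>auto intro: orthonormal_frame_subset\<close>)
  have pU: "p \<in> ?U" using p V by auto
  have X: "X \<in> vfs" and Y: "Y \<in> vfs" using XY by (auto intro: smooth_vf_subset)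
  have "ricci_in_frame M A g D E X X p = 0"
    using assms[unfolded ricci_flat_def, rule_format, of ?U E X X p] U E X pU by simp
  then have "(\<Sum>i\<in>UNIV. gm (\<gamma> (E i) X) (\<gamma> (E i) X) p) = 0" using ricci_formula[OF X pU] by simp
  moreover have "gm (\<gamma> (E i) X) (\<gamma> (E i) X) p \<ge> 0" for i
    unfolding metric_pair_def by (rule g_nonneg[OF mem_topspace[OF pU] vf_tangent[OF \<gamma>_smooth[OF E_smooth X] pU]])
  ultimately have "gm (\<gamma> (E i) X) (\<gamma> (E i) X) p = 0" for i
    by (simp add: sum_nonneg_eq_0_iff)
  then have "\<gamma> (E i) X p = (\<lambda>f. 0)" for i
    by (intro gm_self_zero[OF \<gamma>_smooth[OF E_smooth X] pU]) simp
  then show "\<gamma> X Y p = (\<lambda>f. 0)" by (rule \<gamma>_zero_if_frame[OF X Y pU])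
qed

lemma \<gamma>_zero_imp_ricci_flat:
  assumes "tensor_eq M A \<gamma> tensor_zero"
  shows "ricci_flat M A g D"
  unfolding ricci_flat_def
proof (intro allI impI ballI)
  fix W E X Y p assume WE: "openin M W \<and> orthonormal_frame M A g W E"
    and X: "X \<in> smooth_vf M A W" and Y: "Y \<in> smooth_vf M A W" and p: "p \<in> W"
  interpret framed_patch M A g nab D \<gamma> W E by (rule framed_patchI) (use WE in auto)
  have "\<gamma> P Q p = (\<lambda>f. 0)" if "P \<in> vfs" "Q \<in> vfs" for P Q
    using assms that p U by (simp add: tensor_eq_def tensor_zero_def vf_eq_on_def vf_zero_def)
  then have C0: "C P Q Z p = 0" if "P \<in> vfs" "Q \<in> vfs" "Z \<in> vfs" for P Q Z
    using that g_zero[OF mem_topspace[OF p] vf_tangent[OF that(3) p]] by (simp add: C_def metric_pair_def)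
  have "gm (R (E i) X Y) (E i) p = 0" for i
    using gauss_codazzi(1)[OF E_smooth X Y E_smooth p, of i i]
    by (simp add: C0 X Y E_smooth \<gamma>_smooth)
  then show "ricci_in_frame M A g D E X Y p = 0"
    by (simp add: ricci_in_frame_def R_def)
qed

text \<open>\<open>|\<gamma>|\<^sup>2\<close>, computed in a local frame; the choice of frame is immaterial.\<close>

definition energy :: "'m \<Rightarrow> real" where
  "energy p = (SOME r. \<exists>U E. openin M U \<and> p \<in> U \<and> orthonormal_frame M A g U E \<and>
    r = framed_patch.normC g \<gamma> E p)"

lemma energy_eq:
  assumes U: "openin M U" "orthonormal_frame M A g U E" and p: "p \<in> U"
  shows "energy p = framed_patch.normC g \<gamma> E p"
  unfolding energy_def
proof (rule some_equality)
  show "\<exists>U E'. openin M U \<and> p \<in> U \<and> orthonormal_frame M A g U E' \<and>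
      framed_patch.normC g \<gamma> E p = framed_patch.normC g \<gamma> E' p"
    using assms by blast
  fix r assume "\<exists>U E. openin M U \<and> p \<in> U \<and> orthonormal_frame M A g U E \<and> r = framed_patch.normC g \<gamma> E p"
  then obtain V E' where V: "openin M V" "p \<in> V" "orthonormal_frame M A g V E'"
    and r: "r = framed_patch.normC g \<gamma> E' p" by blast
  \<comment> \<open>The two frames are compared on the intersection of their domains.
    \<open>normC\<close> depends on the frame but has no parameter for the open set, so shrinking
    the domain leaves its value unchanged.\<close>
  interpret e: framed_patch M A g nab D \<gamma> "U \<inter> V" E
    by (rule framed_patchI) (use U V in \<open>auto intro: orthonormal_frame_subset\<close>)
  have f: "orthonormal_frame M A g (U \<inter> V) E'" using V(3) by (auto intro: orthonormal_frame_subset)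
  interpret e': framed_patch M A g nab D \<gamma> "U \<inter> V" E'
    by (rule framed_patchI) (use U V f in auto)
  show "r = framed_patch.normC g \<gamma> E p"
    using e.normC_frame_independent[OF f, of p] p V unfolding r e'.normC_def by simp
qed

lemma \<gamma>_zero_if_compact:
  assumes "compact_space M"
  shows "tensor_eq M A \<gamma> tensor_zero"
  unfolding tensor_eq_def tensor_zero_def vf_eq_on_def vf_zero_def
proof (intro allI impI ballI)
  fix W X Y p assume W: "openin M W" and XY: "X \<in> smooth_vf M A W" "Y \<in> smooth_vf M A W" and p: "p \<in> W"
  have pM: "p \<in> topspace M" using p openin_subset[OF W] by auto
  have "continuous_map M euclideanreal energy"
  proof (rule continuous_map_if_locally_smooth)
    fix q assume "q \<in> topspace M"
    then obtain V E where V: "openin M V" "q \<in> V" "orthonormal_frame M A g V E" by (rule orthonormal_frame_exists)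
    interpret framed_patch M A g nab D \<gamma> V E by (rule framed_patchI[OF V(1,3)])
    show "\<exists>U h. openin M U \<and> q \<in> U \<and> smooth_fun A U h \<and> (\<forall>q\<in>U. energy q = h q)"
      using V normC_smooth energy_eq[OF V(1,3)] by blast
  qed
  then have "compact (energy ` topspace M)"
    using assms image_compactin[of M "topspace M" euclideanreal energy] by (simp add: compact_space_def)
  \<comment> \<open>A maximum exists only on a nonempty space; the point \<open>p\<close> at which
    \<gamma> is to vanish provides this.\<close>
  moreover have "energy ` topspace M \<noteq> {}" using pM by blast
  ultimately have "\<exists>s\<in>energy ` topspace M. \<forall>t\<in>energy ` topspace M. t \<le> s" by (rule compact_attains_sup)
  then obtain x where x: "x \<in> topspace M" "\<And>q. q \<in> topspace M \<Longrightarrow> energy q \<le> energy x" by auto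
  have "energy x = 0"
  proof -
    obtain V E where V: "openin M V" "x \<in> V" "orthonormal_frame M A g V E" using x(1) by (rule orthonormal_frame_exists)
    interpret framed_patch M A g nab D \<gamma> V E by (rule framed_patchI[OF V(1,3)])
    \<comment> \<open>On \<open>V\<close> the global function agrees with the local
      \<open>normC\<close>, so the global maximum at \<open>x\<close> is a maximum over the
      patch.\<close>
    have "normC x = 0"
      by (rule normC_max[OF V(2)]) (use x(2) mem_topspace energy_eq[OF V(1,3)] V(2) in metis)
    then show ?thesis using energy_eq[OF V(1,3,2)] by simp
  qed
  obtain V E where V: "openin M V" "p \<in> V" "orthonormal_frame M A g V E" using pM by (rule orthonormal_frame_exists)
  interpret framed_patch M A g nab D \<gamma> "V \<inter> W" E
    by (rule framed_patchI) (use V W in \<open>auto intro: orthonormal_frame_subset\<close>)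
  \<comment> \<open>The nonnegative value at \<open>p\<close> is bounded by the maximum, which is
    0.\<close>
  have "normC p = 0"
    using x(2)[OF pM] \<open>energy x = 0\<close> energy_eq[OF V(1,3,2)] normC_nonneg[of p] by simp
  then show "\<gamma> X Y p = (\<lambda>f. 0)"
    using XY p V by (intro \<gamma>_zero_if_normC) (auto intro: smooth_vf_subset)
qed

text \<open>When \<gamma> vanishes, \<open>nab\<close> and \<open>D\<close> agree on smooth fields,
  so metric compatibility passes from \<open>D\<close> to \<open>nab\<close>.\<close>

lemma levi_civita_if_\<gamma>_zero:
  assumes "tensor_eq M A \<gamma> tensor_zero"
  shows "levi_civita M A g nab"
proof -
  have "metric_connection M A g nab"
    unfolding metric_connection_def
  proof (intro allI impI ballI)
    fix W X Y Z p assume W: "openin M W" and p: "p \<in> W"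
      and X: "X \<in> smooth_vf M A W" and Y: "Y \<in> smooth_vf M A W" and Z: "Z \<in> smooth_vf M A W"
    interpret patch M A g nab D \<gamma> W by unfold_locales (rule W)
    have "nab X Q p = D X Q p" if "Q \<in> vfs" for Q
    proof
      fix f
      have "\<gamma> X Q p = (\<lambda>f. 0)"
        using assms that p U X by (simp add: tensor_eq_def tensor_zero_def vf_eq_on_def vf_zero_def)
      then show "nab X Q p f = D X Q p f" using \<gamma>_apply[of X Q p f] by simp
    qed
    then show "vf_apply X (metric_pair g Y Z) p = metric_pair g (nab X Y) Z p + metric_pair g Y (nab X Z) p"
      using D_metric[OF X Y Z p] Y Z by (simp add: vf_apply_def metric_pair_def)
  qed
  then show ?thesis using conn_nab torsionless_nab by (simp add: levi_civita_def)
qed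

end

theorem theorem8p3:
  fixes M :: "'m topology" and A :: "('m, 'n::finite) chart set"
    and nab D :: "'m connection" and g :: "'m metric_tensor"
    and \<gamma> \<gamma>_star :: "'m tensor12"
  assumes "affine_riemann M A nab g"
    and "levi_civita M A g D"
    and "\<gamma> = difference_tensor D nab"
    and "is_metric_adjoint M A g \<gamma> \<gamma>_star"
    and "tensor_eq M A \<gamma> \<gamma>_star"
    and "metric_trace_zero M A g \<gamma>"
  shows "ricci_nonneg M A g D \<and>
    (ricci_flat M A g D \<longleftrightarrow> tensor_eq M A \<gamma> tensor_zero) \<and>
    (compact_space M \<longrightarrow> tensor_eq M A \<gamma> tensor_zero \<and> levi_civita M A g nab)"
proof -
  interpret smooth_mfd M A
    by unfold_locales (use assms(1) in \<open>simp add: affine_riemann_def\<close>)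
  \<comment> \<open>Equality of \<gamma> and \<open>\<gamma>_star\<close> is pointwise on each open
    set, which is enough to transfer both the smoothness clause and the pairing identity.\<close>
  have self_adjoint: "is_metric_adjoint M A g \<gamma> \<gamma>"
    unfolding is_metric_adjoint_def
  proof (intro allI impI conjI ballI)
    fix W X Y assume W: "openin M W" and X: "X \<in> smooth_vf M A W" and Y: "Y \<in> smooth_vf M A W"
    have eq: "\<gamma> X Y p = \<gamma>_star X Y p" if "p \<in> W" for p
      using assms(5)[unfolded tensor_eq_def vf_eq_on_def, THEN spec, THEN mp, OF W] X Y that by blast
    note adj = assms(4)[unfolded is_metric_adjoint_def, THEN spec, THEN mp, OF W]
    have "\<gamma>_star X Y \<in> smooth_vf M A W" using adj[THEN conjunct1] X Y by blast
    then show "\<gamma> X Y \<in> smooth_vf M A W" by (rule smooth_vf_cong[OF W]) (simp add: eq)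
    fix Z p assume Z: "Z \<in> smooth_vf M A W" and p: "p \<in> W"
    have "metric_pair g (\<gamma>_star X Y) Z p = metric_pair g Y (\<gamma> X Z) p"
      using adj[THEN conjunct2] X Y Z p by blast
    then show "metric_pair g (\<gamma> X Y) Z p = metric_pair g Y (\<gamma> X Z) p"
      using eq[OF p] by (simp add: metric_pair_def)
  qed
  interpret affine_riemann_mfd M A g nab D \<gamma>
    by unfold_locales (use assms self_adjoint in \<open>simp_all add: affine_riemann_def\<close>)
  show ?thesis
    using ricci_nonneg_D ricci_flat_imp_\<gamma>_zero \<gamma>_zero_imp_ricci_flat \<gamma>_zero_if_compact
      levi_civita_if_\<gamma>_zero by blast
qed

end
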